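(* Let $\Theta$ be a convex overmarked box with parameters $(\zeta_t,\zeta_b)\in\,]-1,1[^2$, and for $\lambda=(\varepsilon,\delta)\in\mathbb{R}^2$ let $\rho^\lambda_\Theta:\mathrm{PSL}(2,\mathbb{Z})_o\to\mathrm{PGL}(3,\mathbb{R})$ be the representation defined (in a $\Theta$-basis) by $\rho^\lambda_\Theta(R)=[A_\Theta]$ and $\rho^\lambda_\Theta(IRI)=[\Sigma_\lambda^{-1}D_\Theta^{-1}\,{}^tA_\Theta^{-1}D_\Theta\Sigma_\lambda]$. Then there exist a real number $\varepsilon_0<0$ and a function $\delta_h:\,]\varepsilon_0,0]\to\mathbb{R}$ such that, for $\lambda=(\varepsilon,\delta_h(\varepsilon))$: (1) if $\varepsilon\in\,]\varepsilon_0,0]$, then $\rho^\lambda_\Theta$ extends to a representation $\bar\rho^\lambda_\Theta:\mathrm{PSL}(2,\mathbb{Z})\to\mathscr{G}$ (i.e. $\bar\rho^\lambda_\Theta$ restricted to $\mathrm{PSL}(2,\mathbb{Z})_o$ is $\rho^\lambda_\Theta$, with $\mathrm{PGL}(3,\mathbb{R})$ viewed as the subgroup of projective transformations of $\mathscr{G}$); (2) if $\varepsilon=0$, then $\bar\rho^\lambda_\Theta=\rho_\Theta$, the Schwartz representation; (3) if $\varepsilon\in\,]\varepsilon_0,0[$, then $\rho^\lambda_\Theta$ is Anosov.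
   Context: Let $V$ be a 3-dimensional real vector space, $\mathbf{P}(V)$ its projective plane and $\mathbf{P}(V^* )$ the dual plane. For distinct points $a,b$, $ab$ denotes the line through them; for distinct lines $A,B$, $AB$ denotes their intersection point. An overmarked box is a pair $\Theta=((p,q,r,s;t,b),(P,Q,R,S;T,B))$ with $p,\dots,b\in\mathbf{P}(V)$, $P,\dots,B\in\mathbf{P}(V^* )$, such that $P=ts$, $Q=tr$, $R=bq$, $S=bp$, $T=pq$, $B=rs$ and $TB\notin\{p,q,r,s,t,b\}$. A $\Theta$-basis is a basis of $V$ (unique up to scaling) in whose coordinates $p=[-1:1:0]$, $q=[1:1:0]$, $r=[1:0:1]$, $s=[-1:0:1]$; then $t=[\zeta_t:1:0]$, $b=[\zeta_b:0:1]$ with $\zeta_t,\zeta_b\ne\pm1$. $\Theta$ is convex iff $\zeta_t,\zeta_b\in\,]-1,1[$ (equivalently $p,q$ separate $t$ and $TB$ on $T$, and $r,s$ separate $b$ and $TB$ on $B$). $\mathrm{PSL}(2,\mathbb{Z})=\langle I,R\mid I^2=R^3=1\rangle$ with $I=\pm\begin{pmatrix}0&1\\-1&0\end{pmatrix}$, $R=\pm\begin{pmatrix}-1&1\\-1&0\end{pmatrix}$; $\mathrm{PSL}(2,\mathbb{Z})_o$ is its unique index-2 subgroup, generated by $R$ and $IRI$. Using a $\Theta$-basis and its dual basis identify $\mathbf{P}(V)$, $\mathbf{P}(V^* )$ with $\mathbf{P}(\mathbb{R}^3)$, incidence being $x\cdot X=0$; flag variety $\mathscr{F}=\{(x,X):x\cdot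 X=0\}$. The group $\mathscr{G}$ of projective symmetries consists of the projective transformations $(x,X)\mapsto(Mx,{}^tM^{-1}X)$ and the dualities $(x,X)\mapsto({}^tM^{-1}X,Mx)$ of $\mathscr{F}$, $M\in\mathrm{GL}(3,\mathbb{R})$; the projective transformations form an index-2 subgroup identified with $\mathrm{PGL}(3,\mathbb{R})$. Matrices: $$A_\Theta=\begin{pmatrix}\zeta_t\zeta_b-1&\zeta_t(1-\zeta_t\zeta_b)&\zeta_b-\zeta_t\\ \zeta_b-\zeta_t&1-\zeta_t\zeta_b&\zeta_t\zeta_b-1\\0&1-\zeta_t^2&0\end{pmatrix},\quad D_\Theta=\begin{pmatrix}1&-\zeta_t&-\zeta_b\\-\zeta_t&1&\zeta_t\zeta_b\\-\zeta_b&\zeta_t\zeta_b&1\end{pmatrix},\quad \Sigma_{(\varepsilon,\delta)}=\begin{pmatrix}1&0&0\\0&e^{-\delta}\cosh\varepsilon&-\sinh\varepsilon\\0&-\sinh\varepsilon&e^{\delta}\cosh\varepsilon\end{pmatrix}.$$ The Schwartz representation $\rho_\Theta:\mathrm{PSL}(2,\mathbb{Z})\to\mathscr{G}$ is defined by $\rho_\Theta(R)=$ projective transformation with matrix $A_\Theta$, $\rho_\Theta(I)=$ duality with matrix $D_\Theta$. Anosov: in the upper half-plane let $e_0$ be the geodesic from $\infty$ to $0$, $I$ the rotation $z\mapsto-1/z$, $\Delta$ a hyperideal triangle with side $e_0$ containing the ideal triangle $0,1,\infty$ and invariant under a clockwise order-3 rotation $R_*$ whose center projects on $e_0$ to the fixed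 point of $I$. Then $\Gamma_o=\langle R_*,IR_*I\rangle$ is convex cocompact, isomorphic to $\mathrm{PSL}(2,\mathbb{Z})_o$ via $R\mapsto R_*$, $IRI\mapsto IR_*I$, with limit set $\Lambda$. A representation $\rho:\Gamma_o\to\mathrm{PGL}(V)$ is Anosov if (i) there is a continuous $\rho$-equivariant map $\Phi=(\varphi,\varphi^* ):\Lambda\to\mathscr{F}$, and (ii) there are $\Gamma_o$-equivariant assignments, to every unit tangent vector $(x,v)$ tangent to an oriented geodesic $c$ with tail $c_-$ and head $c_+$ in $\Lambda$, of norms $\nu_+(x,v)$ on $T_{\varphi(c_+)}\mathbf{P}(V)$ and $\nu_-(x,v)$ on $T_{\varphi^*(c_-)}\mathbf{P}(V^* )$, such that along every such arclength-parametrized geodesic the $\nu_+(c(t),c'(t))$-size of each nonzero vector increases exponentially in $t$ and the $\nu_-(c(t),c'(t))$-size of each nonzero vector decreases exponentially in $t$ (uniformly). *)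

theory Defs
  imports "HOL-Analysis.Analysis"
begin

definition A_Th :: "real \<Rightarrow> real \<Rightarrow> real^3^3" where
  "A_Th zt zb = vector [
     vector [zt*zb - 1, zt*(1 - zt*zb), zb - zt],
     vector [zb - zt, 1 - zt*zb, zt*zb - 1],
     vector [0, 1 - zt^2, 0]]"

definition D_Th :: "real \<Rightarrow> real \<Rightarrow> real^3^3" where
  "D_Th zt zb = vector [
     vector [1, -zt, -zb],
     vector [-zt, 1, zt*zb],
     vector [-zb, zt*zb, 1]]"

definition Sigma :: "real \<Rightarrow> real \<Rightarrow> real^3^3" where
  "Sigma e d = vector [
     vector [1, 0, 0],
     vector [0, exp (-d) * cosh e, - sinh e],
     vector [0, - sinh e, exp d * cosh e]]"

definition invT :: "real^3^3 \<Rightarrow> real^3^3" where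
  "invT M = matrix_inv (transpose M)"

definition B_lam :: "real \<Rightarrow> real \<Rightarrow> real \<Rightarrow> real \<Rightarrow> real^3^3" where
  "B_lam zt zb e d = matrix_inv (Sigma e d) ** matrix_inv (D_Th zt zb) **
      invT (A_Th zt zb) ** D_Th zt zb ** Sigma e d"

text \<open>Nonzero vectors represent points of P(R^3); two represent the same point iff
  proportional.\<close>
definition proj_eq :: "real^3 \<Rightarrow> real^3 \<Rightarrow> bool" where
  "proj_eq u v \<longleftrightarrow> (\<exists>c. c \<noteq> 0 \<and> u = c *\<^sub>R v)"

definition flag_rep :: "real^3 \<Rightarrow> real^3 \<Rightarrow> bool" where
  "flag_rep x X \<longleftrightarrow> x \<noteq> 0 \<and> X \<noteq> 0 \<and> x \<bullet> X = 0"

text \<open>Elements of the group G: (False, M) is the projective transformation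
  (x,X) -> (Mx, tM^-1 X), (True, M) is the duality (x,X) -> (tM^-1 X, Mx),
  M invertible. They act on representatives of flags.\<close>
fun gact :: "bool \<times> (real^3^3) \<Rightarrow> (real^3) \<times> (real^3) \<Rightarrow> (real^3) \<times> (real^3)" where
  "gact (False, M) (x, X) = (M *v x, invT M *v X)"
| "gact (True, M) (x, X) = (invT M *v X, M *v x)"

definition F_eq :: "((real^3) \<times> (real^3) \<Rightarrow> (real^3) \<times> (real^3)) \<Rightarrow>
    ((real^3) \<times> (real^3) \<Rightarrow> (real^3) \<times> (real^3)) \<Rightarrow> bool" where
  "F_eq f g \<longleftrightarrow> (\<forall>x X. flag_rep x X \<longrightarrow>
      proj_eq (fst (f (x, X))) (fst (g (x, X))) \<and> proj_eq (snd (f (x, X))) (snd (g (x, X))))"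

text \<open>Since PSL(2,Z) = <I,R | I^2 = R^3 = 1>, a representation PSL(2,Z) -> G is given by
  images gI, gR in G satisfying the relations. The representation rho of PSL(2,Z)_o
  with rho(R) = [A], rho(IRI) = [B] extends to PSL(2,Z) via gI (with gR = [A]) iff
  gI^2 = 1, [A]^3 = 1 and gI [A] gI = [B] (PSL(2,Z)_o is generated by R and IRI).\<close>
definition extends_rep :: "bool \<times> (real^3^3) \<Rightarrow> real^3^3 \<Rightarrow> real^3^3 \<Rightarrow> bool" where
  "extends_rep gI A B \<longleftrightarrow>
     invertible (snd gI) \<and> invertible A \<and> invertible B \<and>
     F_eq (gact gI \<circ> gact gI) id \<and>
     F_eq (gact (False, A) \<circ> gact (False, A) \<circ> gact (False, A)) id \<and>
     F_eq (gact gI \<circ> gact (False, A) \<circ> gact gI) (gact (False, B))"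

definition cmat :: "complex \<Rightarrow> complex \<Rightarrow> complex \<Rightarrow> complex \<Rightarrow> complex^2^2" where
  "cmat a b c d = vector [vector [a, b], vector [c, d]]"

definition mob :: "complex^2^2 \<Rightarrow> complex \<Rightarrow> complex" where
  "mob M z = (M$1$1 * z + M$1$2) / (M$2$1 * z + M$2$2)"

definition mob_deriv :: "complex^2^2 \<Rightarrow> complex \<Rightarrow> complex" where
  "mob_deriv M z = (M$1$1 * M$2$2 - M$1$2 * M$2$1) / (M$2$1 * z + M$2$2)^2"

definition hdist :: "complex \<Rightarrow> complex \<Rightarrow> real" where
  "hdist z w = arcosh (1 + (cmod (z - w))^2 / (2 * Im z * Im w))"

text \<open>Cayley transform, identifying H u R u {oo} with the closed unit disc
  (oo corresponds to 1); boundary points of H are represented by unit complex numbers.\<close>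
definition cayley :: "complex \<Rightarrow> complex" where
  "cayley z = (z - \<i>) / (z + \<i>)"

definition bnd_act :: "complex^2^2 \<Rightarrow> complex \<Rightarrow> complex" where
  "bnd_act M \<xi> = mob (cmat 1 (-\<i>) 1 \<i> ** M ** cmat \<i> \<i> (-1) 1) \<xi>"

definition Imat :: "complex^2^2" where
  "Imat = cmat 0 1 (-1) 0"

text \<open>R_* : clockwise rotation of order 3 (angle -2pi/3) about the point e^{i theta}
  of H; conjugation by the Cayley-type map z -> (z - p)/(z - conj p).\<close>
definition Rstar :: "real \<Rightarrow> complex^2^2" where
  "Rstar \<theta> = (let p = cis \<theta>; a = - 2 * pi / 3 in
     cmat (- cnj p) p (-1) 1 ** cmat (cis (a/2)) 0 0 (cis (-a/2)) ** cmat 1 (-p) 1 (- cnj p))"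

definition word_mob :: "real \<Rightarrow> bool list \<Rightarrow> complex^2^2" where
  "word_mob \<theta> ws = foldr (\<lambda>b M. (if b then Rstar \<theta> else Imat ** Rstar \<theta> ** Imat) ** M) ws (mat 1)"

definition word_mat :: "real^3^3 \<Rightarrow> real^3^3 \<Rightarrow> bool list \<Rightarrow> real^3^3" where
  "word_mat A B ws = foldr (\<lambda>b M. (if b then A else B) ** M) ws (mat 1)"

definition limit_set :: "real \<Rightarrow> complex set" where
  "limit_set \<theta> = closure (cayley ` {mob (word_mob \<theta> ws) \<i> | ws. True}) \<inter> sphere 0 1"

definition is_geodesic :: "(real \<Rightarrow> complex) \<Rightarrow> bool" where
  "is_geodesic c \<longleftrightarrow> (\<forall>t. Im (c t) > 0) \<and> (\<forall>s t. hdist (c s) (c t) = \<bar>s - t\<bar>)"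

definition geod_ends :: "(real \<Rightarrow> complex) \<Rightarrow> complex \<Rightarrow> complex \<Rightarrow> bool" where
  "geod_ends c \<xi>m \<xi>p \<longleftrightarrow>
     ((\<lambda>t. cayley (c t)) \<longlongrightarrow> \<xi>p) at_top \<and> ((\<lambda>t. cayley (c t)) \<longlongrightarrow> \<xi>m) at_bot"

text \<open>embedding of P(R^3) into matrices (orthogonal projection onto the line);
  used to express continuity of maps into P(R^3)\<close>
definition pmat :: "real^3 \<Rightarrow> real^3^3" where
  "pmat u = (\<chi> i j. u$i * u$j / (u \<bullet> u))"

text \<open>A tangent vector to P(R^3) at [u] is represented by a pair (u,y), meaning the
  derivative at s=0 of [u + s y]; (u,y) and (c u, c y + t u) (c ~= 0) represent the same
  vector. N is a norm on T_[u] P(R^3) if it is well defined on such classes and is a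
  norm on the quotient R^3 / R u.\<close>
definition tangent_norm :: "real^3 \<Rightarrow> (real^3 \<Rightarrow> real^3 \<Rightarrow> real) \<Rightarrow> bool" where
  "tangent_norm u N \<longleftrightarrow>
     (\<forall>c t y. c \<noteq> 0 \<longrightarrow> N (c *\<^sub>R u) (c *\<^sub>R y + t *\<^sub>R u) = N u y) \<and>
     (\<forall>y. N u y \<ge> 0) \<and>
     (\<forall>y. N u y = 0 \<longleftrightarrow> (\<exists>t. y = t *\<^sub>R u)) \<and>
     (\<forall>y z. N u (y + z) \<le> N u y + N u z) \<and>
     (\<forall>r y. N u (r *\<^sub>R y) = \<bar>r\<bar> * N u y)"

text \<open>rho : Gamma_o -> PGL(3,R), given via R_* -> [A], I R_* I -> [B], is Anosov
  (Gamma_o built from the rotation R_* of angle parameter theta). Points of P(V*) are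
  represented by vectors of R^3 (dual basis), the action being by the inverse transpose.
  Unit tangent vectors of H are pairs (x,v) (base point, complex velocity).\<close>
definition anosov :: "real \<Rightarrow> real^3^3 \<Rightarrow> real^3^3 \<Rightarrow> bool" where
  "anosov \<theta> A B \<longleftrightarrow> (let \<Lambda> = limit_set \<theta> in
     \<exists>\<phi> \<phi>s :: complex \<Rightarrow> real^3.
       (\<forall>\<xi>\<in>\<Lambda>. \<phi> \<xi> \<noteq> 0 \<and> \<phi>s \<xi> \<noteq> 0 \<and> \<phi> \<xi> \<bullet> \<phi>s \<xi> = 0) \<and>
       continuous_on \<Lambda> (\<lambda>\<xi>. pmat (\<phi> \<xi>)) \<and> continuous_on \<Lambda> (\<lambda>\<xi>. pmat (\<phi>s \<xi>)) \<and>
       (\<forall>ws. \<forall>\<xi>\<in>\<Lambda>.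
          proj_eq (\<phi> (bnd_act (word_mob \<theta> ws) \<xi>)) (word_mat A B ws *v \<phi> \<xi>) \<and>
          proj_eq (\<phi>s (bnd_act (word_mob \<theta> ws) \<xi>)) (invT (word_mat A B ws) *v \<phi>s \<xi>)) \<and>
       (\<exists>(\<nu>p :: complex \<times> complex \<Rightarrow> real^3 \<Rightarrow> real^3 \<Rightarrow> real)
          (\<nu>m :: complex \<times> complex \<Rightarrow> real^3 \<Rightarrow> real^3 \<Rightarrow> real) (C::real) (a::real).
          C > 0 \<and> a > 0 \<and>
          (\<forall>c \<xi>m \<xi>p. is_geodesic c \<and> geod_ends c \<xi>m \<xi>p \<and> \<xi>m \<in> \<Lambda> \<and> \<xi>p \<in> \<Lambda> \<longrightarrow>
             (\<forall>t. tangent_norm (\<phi> \<xi>p) (\<nu>p (c t, vector_derivative c (at t))) \<and>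
                  tangent_norm (\<phi>s \<xi>m) (\<nu>m (c t, vector_derivative c (at t)))) \<and>
             (\<forall>ws t y. let M = word_mat A B ws; g = word_mob \<theta> ws;
                  x = c t; v = vector_derivative c (at t);
                  gxv = (mob g x, mob_deriv g x * v) in
                \<nu>p gxv (M *v \<phi> \<xi>p) (M *v y) = \<nu>p (x, v) (\<phi> \<xi>p) y \<and>
                \<nu>m gxv (invT M *v \<phi>s \<xi>m) (invT M *v y) = \<nu>m (x, v) (\<phi>s \<xi>m) y) \<and>
             (\<forall>s t y. s \<le> t \<longrightarrow>
                \<nu>p (c t, vector_derivative c (at t)) (\<phi> \<xi>p) y \<ge>
                  C * exp (a * (t - s)) * \<nu>p (c s, vector_derivative c (at s)) (\<phi> \<xi>p) y \<and>
                \<nu>m (c t, vector_derivative c (at t)) (\<phi>s \<xi>m) y \<le>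
                  (1 / C) * exp (- a * (t - s)) * \<nu>m (c s, vector_derivative c (at s)) (\<phi>s \<xi>m) y))))"

end

theory Submission
  imports Defs
begin

text \<open>
  Let \<open>\<Omega>\<^sub>+\<close> be the open quadrilateral of the box \<open>\<Theta>\<close> and \<open>\<Omega>\<^sub>-\<close> the image under \<open>\<Sigma>\<^sup>-\<^sup>1\<close> of the
  complementary quadrilateral with the same vertices. For \<open>\<epsilon> < 0\<close> and \<open>|\<delta>| \<le> |sinh \<epsilon>| / 2\<close> the matrix
  \<open>\<Sigma>\<^sup>-\<^sup>1\<close> pushes the complementary quadrilateral strictly inside itself, so the images of \<open>R\<^sup>\<plusminus>\<^sup>1\<close> and
  \<open>(IRI)\<^sup>\<plusminus>\<^sup>1\<close> exchange \<open>\<Omega>\<^sub>+\<close> and \<open>\<Omega>\<^sub>-\<close> with closure going to interior: a projective ping-pong. The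
  contraction of the Hilbert metric by positive maps (Birkhoff) yields an equivariant continuous
  map on the limit set and the contraction of tangent vectors along itineraries; the polar cones do
  the same for the dual representation. On the hyperbolic side, ping-pong with half planes codes
  the limit set, and a geodesic with ends in it crosses the images of the edge \<open>e\<^sub>0\<close> near the orbit of
  \<open>i\<close>, at times with bounded gaps. The norms on the tangent spaces are suprema of fixed norms
  transported by the group elements that bring the base point close to \<open>i\<close>.

  A duality extending the representation has a symmetric matrix \<open>C D \<Sigma>\<close> with \<open>C\<close> commuting with
  \<open>\<^sup>tA\<close>, that is, \<open>C\<close> a quadratic polynomial in \<open>\<^sup>tA\<close>. Symmetry is a linear \<open>3 \<times> 3\<close> system for the
  coefficients of \<open>C\<close>; its determinant changes sign on \<open>|\<delta>| \<le> |sinh \<epsilon>| / 2\<close>, which defines \<open>\<delta>\<^sub>h\<close>.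
\<close>

section \<open>Real Moebius maps and the hyperbolic distance\<close>

text \<open>At \<epsilon> = 0 the two quadrilaterals share their vertices and R sends some boundary
  points to boundary points, so the Birkhoff argument gives no uniform factor. The bound |\<delta>|
  \<le> |sinh \<epsilon>| / 2 is a compromise: since exp x \<ge> 1 + x it leaves the nesting strict,
  and it is wide enough for the part of the determinant that is odd in \<delta> to dominate the even
  part at the ends of the interval. The threshold \<epsilon>0 comes from the extension alone: the
  coefficients of C are minors of the system, C tends to a nonzero scalar matrix as \<epsilon> tends
  to 0, and so it is invertible near 0. On the hyperbolic side, distances enter through their cosh
  and the signed distance to e_0 through its sinh. These are rational in the coordinates, and the
  additive constants of coarse geometry become multiplicative ones. The condition \<theta> < \<pi>/3
  bounds the time between crossings from below and keeps the ends of e_0 off the limit set. The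
  decay of the second norm is the expansion for the dual representation along the reversed
  geodesic.\<close>

lemma cmat_nth [simp]:
  "cmat a b c d $ 1 $ 1 = a" "cmat a b c d $ 1 $ 2 = b"
  "cmat a b c d $ 2 $ 1 = c" "cmat a b c d $ 2 $ 2 = d"
  by (simp_all add: cmat_def)

lemma cmat_mult: "cmat a b c d ** cmat a' b' c' d'
    = cmat (a*a' + b*c') (a*b' + b*d') (c*a' + d*c') (c*b' + d*d')"
  by (simp add: vec_eq_iff matrix_matrix_mult_def forall_2 sum_2)

lemma cmat_eta: "M = cmat (M$1$1) (M$1$2) (M$2$1) (M$2$2)"
  by (simp add: vec_eq_iff forall_2)

lemma mat_1_cmat: "mat 1 = cmat 1 0 0 1"
  by (simp add: vec_eq_iff forall_2 mat_def)

lemma mob_cmat: "mob (cmat a b c d) z = (a*z + b) / (c*z + d)"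
  by (simp add: mob_def)

lemma mob_cmat_scale:
  assumes "k \<noteq> 0"
  shows "mob (cmat (k*a) (k*b) (k*c) (k*d)) z = (a*z + b) / (c*z + d)"
proof -
  have "mob (cmat (k*a) (k*b) (k*c) (k*d)) z = (k * (a*z + b)) / (k * (c*z + d))"
    by (simp add: mob_def algebra_simps)
  then show ?thesis using assms by (metis mult_divide_mult_cancel_left)
qed

lemma cmat_scalar_commute: "cmat u 0 0 u ** X = X ** cmat u 0 0 u"
  by (subst (1 2) cmat_eta[of X]) (simp only: cmat_mult, simp add: mult.commute)

lemma mob_scalar:
  assumes "u \<noteq> 0"
  shows "mob (X ** cmat u 0 0 u) z = mob X z"
proof -
  obtain a b c d where X: "X = cmat a b c d" using cmat_eta by blast
  show ?thesis using mob_cmat_scale[OF assms, of a b c d z]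
    by (simp add: X cmat_mult mob_cmat mult.commute)
qed

lemma mob_mult:
  assumes "N$2$1 * z + N$2$2 \<noteq> 0"
  shows "mob (M ** N) z = mob M (mob N z)"
proof -
  obtain a b c d where M: "M = cmat a b c d" using cmat_eta by blast
  obtain a' b' c' d' where N: "N = cmat a' b' c' d'" using cmat_eta by blast
  have nz: "c'*z + d' \<noteq> 0" using assms by (simp add: N)
  have "mob M (mob N z) = ((a * ((a'*z + b') / (c'*z + d')) + b) * (c'*z + d')) /
      ((c * ((a'*z + b') / (c'*z + d')) + d) * (c'*z + d'))"
    using nz by (simp add: M N mob_cmat)
  also have "\<dots> = (a * (a'*z + b') + b * (c'*z + d')) / (c * (a'*z + b') + d * (c'*z + d'))"
    using nz by (simp add: distrib_right)
  also have "\<dots> = mob (M ** N) z"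
    by (simp add: M N cmat_mult mob_cmat algebra_simps)
  finally show ?thesis by simp
qed

text \<open>The complex factor k is there because \<open>Rstar\<close> is a real matrix multiplied
  by 2i; Moebius actions do not see it.\<close>

definition real_mob :: "complex^2^2 \<Rightarrow> bool" where
  "real_mob M \<longleftrightarrow> (\<exists>k a b c d. k \<noteq> 0 \<and> a*d - b*c > (0::real) \<and>
     M = cmat (k * of_real a) (k * of_real b) (k * of_real c) (k * of_real d))"

lemma real_mobI:
  assumes "M = cmat (k * of_real a) (k * of_real b) (k * of_real c) (k * of_real d)"
    and "k \<noteq> 0" "a*d - b*c > 0"
  shows "real_mob M"
  using assms unfolding real_mob_def by blast

lemma real_mob_mult:
  assumes "real_mob M" "real_mob N"
  shows "real_mob (M ** N)"
proof -
  obtain k a b c d where M: "k \<noteq> 0" "a*d - b*c > 0"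
     "M = cmat (k * of_real a) (k * of_real b) (k * of_real c) (k * of_real d)"
    using assms(1) unfolding real_mob_def by blast
  obtain k' a' b' c' d' where N: "k' \<noteq> 0" "a'*d' - b'*c' > 0"
     "N = cmat (k' * of_real a') (k' * of_real b') (k' * of_real c') (k' * of_real d')"
    using assms(2) unfolding real_mob_def by blast
  have "(a*a' + b*c') * (c*b' + d*d') - (a*b' + b*d') * (c*a' + d*c')
      = (a*d - b*c) * (a'*d' - b'*c')"
    by (simp add: algebra_simps)
  then have "(a*a' + b*c') * (c*b' + d*d') - (a*b' + b*d') * (c*a' + d*c') > 0"
    using M(2) N(2) by simp
  moreover have "M ** N = cmat (k*k' * of_real (a*a' + b*c')) (k*k' * of_real (a*b' + b*d'))
      (k*k' * of_real (c*a' + d*c')) (k*k' * of_real (c*b' + d*d'))"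
    by (simp add: M N cmat_mult algebra_simps)
  ultimately show ?thesis using M(1) N(1) by (intro real_mobI[of _ "k*k'"]) auto
qed

text \<open>On the upper half-plane this is sinh of the signed distance to the imaginary axis
  e_0.\<close>

definition slope :: "complex \<Rightarrow> real" where "slope z = Re z / Im z"

text \<open>This is cosh of \<open>hdist\<close>.\<close>

definition chd :: "complex \<Rightarrow> complex \<Rightarrow> real" where
  "chd z w = 1 + (cmod (z - w))^2 / (2 * Im z * Im w)"

lemma chd_ge1: "Im z > 0 \<Longrightarrow> Im w > 0 \<Longrightarrow> chd z w \<ge> 1"
  by (simp add: chd_def)

lemma chd_commute: "chd z w = chd w z"
  by (simp add: chd_def norm_minus_commute mult_ac)

lemma chd_alt:
  assumes "Im z > 0" "Im w > 0"
  shows "2 * chd z w = ((cmod z)^2 + (cmod w)^2 - 2 * Re z * Re w) / (Im z * Im w)"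
  using assms unfolding chd_def cmod_power2 by (simp add: field_simps power2_eq_square)

lemma chd_i:
  assumes "Im z > 0"
  shows "2 * chd z \<i> = ((cmod z)^2 + 1) / Im z"
  using chd_alt[of z \<i>] assms by simp

text \<open>The triangle inequality in the form cosh (a + b) \<le> 2 cosh a cosh b. With the middle
  point at i it reduces to (|z| |w| - 1)^2 \<ge> 0.\<close>

lemma chd_quasi_triangle:
  assumes "Im z > 0" "Im w > 0"
  shows "chd z w \<le> 2 * chd z \<i> * chd \<i> w"
proof -
  have "- (2 * Re z * Re w) \<le> 2 * (cmod z * cmod w)"
    using abs_Re_le_cmod[of z] abs_Re_le_cmod[of w]
      mult_mono[of "\<bar>Re z\<bar>" "cmod z" "\<bar>Re w\<bar>" "cmod w"]
    unfolding abs_mult[symmetric] by (simp add: abs_le_iff mult.commute)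
  also have "\<dots> \<le> (cmod z)^2 * (cmod w)^2 + 1"
    using zero_le_power2[of "cmod z * cmod w - 1"] by (simp add: power2_eq_square algebra_simps)
  finally have "(cmod z)^2 + (cmod w)^2 - 2 * Re z * Re w \<le> ((cmod z)^2 + 1) * ((cmod w)^2 + 1)"
    by (simp add: algebra_simps)
  then have "2 * chd z w \<le> (2 * chd z \<i>) * (2 * chd w \<i>)"
    using assms unfolding chd_i[OF assms(1)] chd_i[OF assms(2)] chd_alt[OF assms]
    by (simp add: divide_right_mono)
  then show ?thesis by (simp add: chd_commute[of \<i> w] mult_ac)
qed

lemma slope_le_chd:
  assumes "Im z > 0"
  shows "\<bar>slope z\<bar> \<le> chd z \<i>"
proof -
  have "2 * \<bar>Re z\<bar> \<le> 2 * cmod z" using abs_Re_le_cmod by simp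
  also have "\<dots> \<le> (cmod z)^2 + 1"
    using zero_le_power2[of "cmod z - 1"] by (simp add: power2_eq_square algebra_simps)
  finally have "2 * \<bar>Re z\<bar> / Im z \<le> ((cmod z)^2 + 1) / Im z"
    using assms by (simp add: divide_right_mono)
  then show ?thesis using assms chd_i[OF assms] by (simp add: slope_def)
qed

text \<open>The point w lies on e_0, so its distance from z is at least the distance of z from e_0,
  and cosh^2 = 1 + sinh^2.\<close>

lemma chd_slope_zero:
  assumes "Im z > 0" "Im w > 0" "slope w = 0"
  shows "1 + (slope z)^2 \<le> (chd z w)^2"
proof -
  have w: "Re w = 0" using assms by (simp add: slope_def)
  have "(2 * cmod z * cmod w)^2 \<le> ((cmod z)^2 + (cmod w)^2)^2"
    using zero_le_power2[of "(cmod z)^2 - (cmod w)^2"]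
    by (simp add: power2_eq_square algebra_simps)
  then have "(2 * cmod z * cmod w)^2 / (Im z * Im w)^2 \<le> (2 * chd z w)^2"
    unfolding chd_alt[OF assms(1,2)] using w by (simp add: divide_right_mono power_divide)
  moreover have "(2 * cmod z * cmod w)^2 / (Im z * Im w)^2 = 4 * (1 + (slope z)^2)"
    using w assms by (simp add: slope_def power_mult_distrib cmod_power2 field_simps)
  ultimately show ?thesis by (simp add: power_mult_distrib)
qed

context
  fixes M k and a b c d :: real
  assumes M: "M = cmat (k * of_real a) (k * of_real b) (k * of_real c) (k * of_real d)"
    and k: "k \<noteq> 0" and det: "a*d - b*c > 0"
begin

lemma mob_real: "mob M z = (of_real a * z + of_real b) / (of_real c * z + of_real d)"
  unfolding M by (rule mob_cmat_scale[OF k])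

lemma mob_real_den: "Im z \<noteq> 0 \<Longrightarrow> complex_of_real c * z + of_real d \<noteq> 0"
  using det by (auto simp: complex_eq_iff)

lemma mob_real_Im: "Im z > 0 \<Longrightarrow> Im (mob M z) = (a*d - b*c) * Im z / (cmod (of_real c * z + of_real d))^2"
  unfolding mob_real Im_divide cmod_power2 by (simp add: algebra_simps)

lemma mob_real_slope:
  assumes "Im z > 0"
  shows "slope (mob M z)
     = (a*c*(cmod z)^2 + (a*d + b*c) * Re z + b*d) / ((a*d - b*c) * Im z)"
proof -
  have "(cmod (c*z + d))^2 \<noteq> 0" using mob_real_den assms by simp
  moreover have "Re (mob M z) = (a*c*(cmod z)^2 + (a*d + b*c) * Re z + b*d) / (cmod (of_real c * z + of_real d))^2"
    unfolding mob_real Re_divide cmod_power2 by (simp add: algebra_simps power2_eq_square)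
  ultimately show ?thesis unfolding slope_def mob_real_Im[OF assms] by simp
qed

lemma mob_real_chd:
  assumes "Im z > 0" "Im w > 0"
  shows "chd (mob M z) (mob M w) = chd z w"
proof -
  let ?e = "complex_of_real c * z + d" and ?f = "complex_of_real c * w + d"
  have e: "?e \<noteq> 0" and f: "?f \<noteq> 0" using mob_real_den assms by auto
  have "mob M z - mob M w = of_real (a*d - b*c) * (z - w) / (?e * ?f)"
    unfolding mob_real using e f by (simp add: field_simps)
  then have "(cmod (mob M z - mob M w))^2
      = (a*d - b*c)^2 * (cmod (z - w))^2 / ((cmod ?e)^2 * (cmod ?f)^2)"
    by (simp only: norm_divide norm_mult norm_of_real power_divide power_mult_distrib power2_abs)
  moreover have "2 * Im (mob M z) * Im (mob M w)
      = (a*d - b*c)^2 * (2 * Im z * Im w) / ((cmod ?e)^2 * (cmod ?f)^2)"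
    unfolding mob_real_Im[OF assms(1)] mob_real_Im[OF assms(2)]
    by (simp add: power2_eq_square algebra_simps)
  moreover have "(cmod ?e)^2 * (cmod ?f)^2 \<noteq> 0" "(a*d - b*c)^2 \<noteq> 0" using e f det by auto
  ultimately show ?thesis unfolding chd_def by simp
qed

text \<open>On the disc a real Moebius map becomes \<open>w \<mapsto> (\<mu> w + \<nu>) / (\<nu>\<^sup>* w + \<mu>\<^sup>*)\<close> with
  \<open>\<mu> = (a + d) + i (b - c)\<close> and \<open>\<nu> = (a - d) - i (b + c)\<close>.\<close>

lemma bnd_act_real: "bnd_act M w = (Complex (a+d) (b-c) * w + Complex (a-d) (-(b+c))) /
    (Complex (a-d) (b+c) * w + Complex (a+d) (c-b))"
proof -
  have "cmat 1 (-\<i>) 1 \<i> ** M ** cmat \<i> \<i> (-1) 1 =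
     cmat (\<i>*k * Complex (a+d) (b-c)) (\<i>*k * Complex (a-d) (-(b+c)))
       (\<i>*k * Complex (a-d) (b+c)) (\<i>*k * Complex (a+d) (c-b))"
    unfolding M cmat_mult Complex_eq by (simp add: algebra_simps)
  then show ?thesis unfolding bnd_act_def using k by (simp add: mob_cmat_scale)
qed

text \<open>The numbers \<mu> and \<nu> of the disc form satisfy |\<mu>|^2 - |\<nu>|^2 = 4 (ad - bc)
  > 0, so the denominator has no zero in the closed disc.\<close>

lemma bnd_act_real_den:
  assumes "cmod w \<le> 1"
  shows "Complex (a-d) (b+c) * w + Complex (a+d) (c-b) \<noteq> 0"
proof
  assume "Complex (a-d) (b+c) * w + Complex (a+d) (c-b) = 0"
  then have "Complex (a+d) (c-b) = - (Complex (a-d) (b+c) * w)"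
    by (simp add: add_eq_0_iff)
  then have "cmod (Complex (a+d) (c-b)) = cmod (Complex (a-d) (b+c)) * cmod w"
    by (simp only: norm_minus_cancel norm_mult)
  also have "\<dots> \<le> cmod (Complex (a-d) (b+c))"
    using assms by (simp add: mult_left_le)
  finally have "(a+d)^2 + (c-b)^2 \<le> (a-d)^2 + (b+c)^2"
    by (simp add: complex_norm)
  then show False using det by (simp add: power2_eq_square algebra_simps)
qed

text \<open>If w is the Cayley image of a real x, then 1 + Re w, - Im w and 1 - Re w are
  proportional to x^2, x and 1. The numerator is thus a multiple of (ax + b)(cx + d), which makes
  this the boundary version of \<open>mob_real_slope\<close>.\<close>

lemma bnd_act_real_Im:
  assumes "cmod w = 1"
  shows "Im (bnd_act M w) = - 4 * (a*c*(1 + Re w) - (a*d + b*c) * Im w + b*d*(1 - Re w)) /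
     (cmod (Complex (a-d) (b+c) * w + Complex (a+d) (c-b)))^2"
proof -
  have w: "Re w * Re w = 1 - Im w * Im w"
    using assms cmod_power2[of w] by (simp add: power2_eq_square)
  have "Im (Complex (a+d) (b-c) * w + Complex (a-d) (-(b+c))) *
      Re (Complex (a-d) (b+c) * w + Complex (a+d) (c-b)) -
     Re (Complex (a+d) (b-c) * w + Complex (a-d) (-(b+c))) *
      Im (Complex (a-d) (b+c) * w + Complex (a+d) (c-b))
    = - 4 * (a*c*(1 + Re w) - (a*d + b*c) * Im w + b*d*(1 - Re w))
      + 2*(a*c + b*d)*(1 - (Re w * Re w + Im w * Im w))"
    by (simp add: algebra_simps)
  then show ?thesis unfolding bnd_act_real Im_divide cmod_power2 by (simp add: w)
qed

lemma bnd_act_real_norm: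
  assumes "cmod w = 1"
  shows "cmod (bnd_act M w) = 1"
proof -
  have w: "w * cnj w = 1" using assms by (simp add: complex_norm_square[symmetric])
  \<comment> \<open>On the unit circle the numerator is w times the conjugate of the denominator, so
    both have the same modulus.\<close>
  have "Complex (a+d) (b-c) * w + Complex (a-d) (-(b+c))
     = w * cnj (Complex (a-d) (b+c) * w + Complex (a+d) (c-b))"
  proof -
    have "w * cnj (Complex (a-d) (b+c) * w + Complex (a+d) (c-b))
      = cnj (Complex (a-d) (b+c)) * (w * cnj w) + w * cnj (Complex (a+d) (c-b))"
      by (simp add: algebra_simps)
    then show ?thesis unfolding w by (simp add: complex_eq_iff)
  qed
  then have "cmod (Complex (a+d) (b-c) * w + Complex (a-d) (-(b+c)))
     = cmod (Complex (a-d) (b+c) * w + Complex (a+d) (c-b))"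
    using assms by (simp only: norm_mult complex_mod_cnj)
  then show ?thesis unfolding bnd_act_real norm_divide using bnd_act_real_den[of w] assms by simp
qed

lemma continuous_on_bnd_act_real: "continuous_on (cball 0 1) (bnd_act M)"
proof -
  have eq: "bnd_act M = (\<lambda>w. (Complex (a+d) (b-c) * w + Complex (a-d) (-(b+c))) /
    (Complex (a-d) (b+c) * w + Complex (a+d) (c-b)))" using bnd_act_real by auto
  show ?thesis unfolding eq
    by (intro continuous_intros) (use bnd_act_real_den in auto)
qed

end

lemma real_mob_den:
  assumes "real_mob M" "Im z \<noteq> 0"
  shows "M$2$1 * z + M$2$2 \<noteq> 0"
proof -
  obtain k a b c d where M: "k \<noteq> 0" "a*d - b*c > 0"
     "M = cmat (k * of_real a) (k * of_real b) (k * of_real c) (k * of_real d)"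
    using assms(1) unfolding real_mob_def by blast
  have "M$2$1 * z + M$2$2 = k * (of_real c * z + of_real d)" by (simp add: M algebra_simps)
  then show ?thesis using mob_real_den[OF M(3,1,2) assms(2)] M(1) by simp
qed

lemma real_mob_Im: "real_mob M \<Longrightarrow> Im z > 0 \<Longrightarrow> Im (mob M z) > 0"
proof -
  assume "real_mob M" and z: "Im z > 0"
  then obtain k a b c d where M: "k \<noteq> 0" "a*d - b*c > 0"
     "M = cmat (k * of_real a) (k * of_real b) (k * of_real c) (k * of_real d)"
    unfolding real_mob_def by blast
  have "complex_of_real c * z + of_real d \<noteq> 0" using mob_real_den[OF M(3,1,2)] z by simp
  then show ?thesis unfolding mob_real_Im[OF M(3,1,2) z] using M(2) z by simp
qed

lemma real_mob_chd: "real_mob M \<Longrightarrow> Im z > 0 \<Longrightarrow> Im w > 0 \<Longrightarrow> chd (mob M z) (mob M w) = chd z w"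
  unfolding real_mob_def using mob_real_chd by metis

lemma real_mob_norm: "real_mob M \<Longrightarrow> cmod w = 1 \<Longrightarrow> cmod (bnd_act M w) = 1"
  unfolding real_mob_def using bnd_act_real_norm by metis

lemma real_mob_continuous: "real_mob M \<Longrightarrow> continuous_on (cball 0 1) (bnd_act M)"
  unfolding real_mob_def using continuous_on_bnd_act_real by metis

section \<open>From the half-plane to the closed disc\<close>

lemma cayley_Im:
  "Im (cayley z) = - 2 * Re z / (cmod (z + \<i>))^2"
  unfolding cayley_def Im_divide cmod_power2 by (simp add: algebra_simps)

lemma cayley_norm:
  assumes "Im z > 0"
  shows "cmod (cayley z) < 1"
proof -
  have "(cmod (z - \<i>))^2 < (cmod (z + \<i>))^2"
    using assms unfolding cmod_power2 by (simp add: power2_eq_square algebra_simps)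
  then have "cmod (z - \<i>) < cmod (z + \<i>)" by (simp add: power2_less_imp_less)
  then show ?thesis unfolding cayley_def norm_divide
    using norm_ge_zero[of "z - \<i>"] by (simp add: divide_less_eq)
qed

lemma cayley_mob: "cayley z = mob (cmat 1 (-\<i>) 1 \<i>) z"
  by (simp add: cayley_def mob_cmat)

text \<open>The two Cayley matrices are inverse to each other only up to the scalar 2i, which is
  split off and then dropped by \<open>mob_scalar\<close>.\<close>

lemma cayley_equivariant:
  assumes "real_mob M" "Im z > 0"
  shows "cayley (mob M z) = bnd_act M (cayley z)"
proof -
  let ?C = "cmat 1 (-\<i>) 1 \<i>" and ?C' = "cmat \<i> \<i> (-1) 1"
  have CC: "?C' ** ?C = cmat (2*\<i>) 0 0 (2*\<i>)" by (simp add: cmat_mult)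
  have nz: "?C$2$1 * z + ?C$2$2 \<noteq> 0" using assms(2) by (auto simp: complex_eq_iff)
  have "bnd_act M (cayley z) = mob ((?C ** M ** ?C') ** ?C) z"
    unfolding bnd_act_def cayley_mob by (rule mob_mult[symmetric, OF nz])
  also have "(?C ** M ** ?C') ** ?C = (?C ** M) ** cmat (2*\<i>) 0 0 (2*\<i>)"
    by (simp add: matrix_mul_assoc[symmetric] CC)
  also have "mob \<dots> z = mob (?C ** M) z" by (rule mob_scalar) simp
  also have "\<dots> = mob ?C (mob M z)" using mob_mult real_mob_den assms by simp
  finally show ?thesis by (simp add: cayley_mob)
qed

lemma bnd_act_mult:
  assumes M: "real_mob M" and N: "real_mob N" and w: "cmod w \<le> 1"
  shows "bnd_act (M ** N) w = bnd_act M (bnd_act N w)"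
proof -
  let ?C = "cmat 1 (-\<i>) 1 \<i>" and ?C' = "cmat \<i> \<i> (-1) 1"
  have CC: "?C' ** ?C = cmat (2*\<i>) 0 0 (2*\<i>)" by (simp add: cmat_mult)
  obtain k a b c d where N': "k \<noteq> 0" "a*d - b*c > 0"
     "N = cmat (k * of_real a) (k * of_real b) (k * of_real c) (k * of_real d)"
    using N unfolding real_mob_def by blast
  have "(?C ** N ** ?C')$2$1 * w + (?C ** N ** ?C')$2$2
     = \<i>*k * (Complex (a-d) (b+c) * w + Complex (a+d) (c-b))"
    unfolding N' cmat_mult Complex_eq by (simp add: algebra_simps)
  then have nz: "(?C ** N ** ?C')$2$1 * w + (?C ** N ** ?C')$2$2 \<noteq> 0"
    using bnd_act_real_den[OF N'(3,1,2) w] N'(1) by simp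
  have "bnd_act M (bnd_act N w) = mob ((?C ** M ** ?C') ** (?C ** N ** ?C')) w"
    unfolding bnd_act_def by (rule mob_mult[symmetric, OF nz])
  also have "(?C ** M ** ?C') ** (?C ** N ** ?C') = (?C ** M) ** ((?C' ** ?C) ** (N ** ?C'))"
    by (simp add: matrix_mul_assoc)
  also have "\<dots> = (?C ** (M ** N) ** ?C') ** cmat (2*\<i>) 0 0 (2*\<i>)"
    unfolding CC cmat_scalar_commute by (simp add: matrix_mul_assoc)
  also have "mob \<dots> w = bnd_act (M ** N) w" unfolding bnd_act_def by (rule mob_scalar) simp
  finally show ?thesis by simp
qed

section \<open>The group generated by the two rotations and its limit set\<close>

definition sg :: "bool \<Rightarrow> real" where "sg \<sigma> = (if \<sigma> then 1 else - 1)"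

lemma sg_simps [simp]: "sg True = 1" "sg False = - 1" "sg (\<not> \<sigma>) = - sg \<sigma>" "sg \<sigma> * sg \<sigma> = 1"
  by (auto simp: sg_def)

text \<open>The letter \<open>(\<sigma>, s)\<close> stands for the generator \<open>\<sigma>\<close> if \<open>s\<close> holds, and otherwise for its square,
  which is also its inverse.\<close>

definition lw :: "bool \<times> bool \<Rightarrow> bool list" where
  "lw l = (if snd l then [fst l] else [fst l, fst l])"

definition wd :: "(bool \<times> bool) list \<Rightarrow> bool list" where
  "wd L = concat (map lw L)"

lemma wd_simps [simp]: "wd [] = []" "wd (l # L) = lw l @ wd L"
  by (simp_all add: wd_def)

definition linv :: "bool \<times> bool \<Rightarrow> bool \<times> bool" where "linv l = (fst l, \<not> snd l)"

lemma fst_linv [simp]: "fst (linv l) = fst l" and linv_linv [simp]: "linv (linv l) = l"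
  by (simp_all add: linv_def)

text \<open>These are the normal forms of the free product of two groups of order 3; the first
  argument names the generator of the first letter.\<close>

fun alternating :: "bool \<Rightarrow> (bool \<times> bool) list \<Rightarrow> bool" where
  "alternating \<sigma> [] \<longleftrightarrow> True"
| "alternating \<sigma> (l # L) \<longleftrightarrow> fst l = \<sigma> \<and> alternating (\<not> \<sigma>) L"

lemma foldr_matrix_mult:
  fixes f :: "'a \<Rightarrow> 'b::comm_semiring_1^'n^'n"
  shows "foldr (\<lambda>b M. f b ** M) (xs @ ys) (mat 1) =
     foldr (\<lambda>b M. f b ** M) xs (mat 1) ** foldr (\<lambda>b M. f b ** M) ys (mat 1)"
  by (induction xs) (simp_all add: matrix_mul_assoc[symmetric])

lemma word_mob_append: "word_mob \<theta> (xs @ ys) = word_mob \<theta> xs ** word_mob \<theta> ys"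
  unfolding word_mob_def by (rule foldr_matrix_mult)

lemma word_mat_append: "word_mat A B (xs @ ys) = word_mat A B xs ** word_mat A B ys"
  unfolding word_mat_def by (rule foldr_matrix_mult)

lemma word_mob_Nil [simp]: "word_mob \<theta> [] = mat 1"
  by (simp add: word_mob_def)

lemma word_mat_Nil [simp]: "word_mat A B [] = mat 1"
  by (simp add: word_mat_def)

lemma word_mob_Cons:
  "word_mob \<theta> (\<sigma> # ws) = (if \<sigma> then Rstar \<theta> else Imat ** Rstar \<theta> ** Imat) ** word_mob \<theta> ws"
  by (simp add: word_mob_def)

lemma word_mat_Cons: "word_mat A B (\<sigma> # ws) = (if \<sigma> then A else B) ** word_mat A B ws"
  by (simp add: word_mat_def)

locale hyperideal =
  fixes \<theta> :: real
  assumes \<theta>: "0 < \<theta>" "\<theta> < pi / 3"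
begin

text \<open>Up to the factor 2i, \<open>Rstar \<theta>\<close> is the real matrix with rows (rp,
  -rh) and (rh, -rq). Its determinant and the square of its trace both equal sin^2 \<theta>, as
  order 3 requires.\<close>

definition "rp = sin (pi/3 + \<theta>)"
definition "rq = sin (pi/3 - \<theta>)"
definition "rh = sqrt 3 / 2"

lemma rp_pos: "rp > 0" and rq_pos: "rq > 0" and rh_pos: "rh > 0"
  using \<theta> pi_gt_zero unfolding rp_def rq_def rh_def by (auto intro!: sin_gt_zero)

lemma rp_rq: "rp - rq = sin \<theta>"
  by (simp add: rp_def rq_def sin_add sin_diff cos_60 sin_60)

lemma rh_sq: "rh * rh = rp * rq + (rp - rq) * (rp - rq)"
proof -
  have "rp * rq = (sqrt 3 / 2 * cos \<theta>)^2 - (1/2 * sin \<theta>)^2"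
    by (simp add: rp_def rq_def sin_add sin_diff cos_60 sin_60 power2_eq_square algebra_simps)
  also have "\<dots> = 3/4 * (cos \<theta>)^2 - 1/4 * (sin \<theta>)^2"
    by (simp add: power_mult_distrib power_divide)
  also have "\<dots> = 3/4 - (sin \<theta>)^2"
    unfolding cos_squared_eq by (simp add: field_simps)
  finally show ?thesis unfolding rp_rq by (simp add: rh_def power2_eq_square)
qed

lemma rp_gt_rq: "rp > rq"
  using rp_rq sin_gt_zero[of \<theta>] \<theta> pi_gt_zero by linarith

lemma Rstar_real: "Rstar \<theta> = cmat (2*\<i> * rp) (2*\<i> * (-rh)) (2*\<i> * rh) (2*\<i> * (-rq))"
proof -
  have "cos \<theta> * (cos \<theta> * sqrt 3) + sin \<theta> * (sin \<theta> * sqrt 3)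
      = ((cos \<theta>)^2 + (sin \<theta>)^2) * sqrt 3"
    by (simp only: power2_eq_square distrib_right mult.assoc)
  then have cs: "cos \<theta> * (cos \<theta> * sqrt 3) + sin \<theta> * (sin \<theta> * sqrt 3) = sqrt 3" by simp
  have e: "(- 2 * pi / 3) / 2 = - (pi/3)" "- (- 2 * pi / 3) / 2 = pi/3" by simp_all
  show ?thesis
    unfolding Rstar_def Let_def e cmat_mult rp_def rq_def rh_def
    by (intro arg_cong4[where f = cmat])
      (simp_all add: complex_eq_iff sin_add sin_diff cos_60 sin_60 algebra_simps cs)
qed

text \<open>The diagonal entries of the real matrix of a letter. The off-diagonal entries -rh and rh
  are the same for all four letters.\<close>

definition "la l = (if fst l then (if snd l then rp else rq) else - (if snd l then rq else rp))"
definition "ld l = (if fst l then - (if snd l then rq else rp) else (if snd l then rp else rq))"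

lemma word_mob_gen: "\<exists>k\<noteq>0. word_mob \<theta> [\<sigma>] = cmat (k * of_real (la (\<sigma>,True)))
   (k * of_real (-rh)) (k * of_real rh) (k * of_real (ld (\<sigma>,True)))"
proof (cases \<sigma>)
  case True
  then show ?thesis
    by (intro exI[of _ "2*\<i>"]) (simp add: word_mob_Cons Rstar_real la_def ld_def)
next
  case False
  then show ?thesis
    by (intro exI[of _ "-2*\<i>"]) (simp add: word_mob_Cons Rstar_real Imat_def cmat_mult la_def ld_def)
qed

text \<open>By order 3 the square of a generator is proportional to its adjugate, so the diagonal
  entries are exchanged up to sign; \<open>rh_sq\<close> makes the product match.\<close>

lemma letter_mob: "\<exists>k\<noteq>0. word_mob \<theta> (lw l) = cmat (k * of_real (la l))
   (k * of_real (-rh)) (k * of_real rh) (k * of_real (ld l))"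
proof (cases "snd l")
  case True
  then show ?thesis using word_mob_gen[of "fst l"] by (cases l) (simp add: lw_def)
next
  case False
  obtain k where k: "k \<noteq> 0" "word_mob \<theta> [fst l] = cmat (k * of_real (la (fst l,True)))
   (k * of_real (-rh)) (k * of_real rh) (k * of_real (ld (fst l,True)))"
    using word_mob_gen by blast
  have c: "complex_of_real rh * complex_of_real rh = rp * rq + (rp - rq) * (rp - rq)"
    unfolding of_real_mult[symmetric] rh_sq by simp
  have "word_mob \<theta> (lw l) = word_mob \<theta> [fst l] ** word_mob \<theta> [fst l]"
    using False word_mob_append[of \<theta> "[fst l]" "[fst l]"] by (simp add: lw_def)
  also have "\<dots> = cmat ((k*k * (rp - rq)) * of_real (la l))
   ((k*k * (rp - rq)) * of_real (-rh)) ((k*k * (rp - rq)) * of_real rh)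
   ((k*k * (rp - rq)) * of_real (ld l))"
    unfolding k cmat_mult using False
    by (intro arg_cong4[where f = cmat])
      (auto simp: la_def ld_def algebra_simps c)
  finally show ?thesis using k(1) rp_gt_rq by (intro exI[of _ "k*k * (rp - rq)"]) auto
qed

lemma word_mob_cube: "\<exists>k\<noteq>0. word_mob \<theta> [\<sigma>,\<sigma>,\<sigma>] = cmat k 0 0 k"
proof -
  obtain k where k: "k \<noteq> 0" "word_mob \<theta> [\<sigma>] = cmat (k * of_real (la (\<sigma>,True)))
   (k * of_real (-rh)) (k * of_real rh) (k * of_real (ld (\<sigma>,True)))"
    using word_mob_gen by blast
  obtain k' where k': "k' \<noteq> 0" "word_mob \<theta> (lw (\<sigma>,False)) = cmat (k' * of_real (la (\<sigma>,False)))
   (k' * of_real (-rh)) (k' * of_real rh) (k' * of_real (ld (\<sigma>,False)))"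
    using letter_mob by blast
  have c: "complex_of_real rh * complex_of_real rh = rp * rq + (rp - rq) * (rp - rq)"
    unfolding of_real_mult[symmetric] rh_sq by simp
  have "word_mob \<theta> [\<sigma>,\<sigma>,\<sigma>] = word_mob \<theta> (lw (\<sigma>,False)) ** word_mob \<theta> [\<sigma>]"
    using word_mob_append[of \<theta> "lw (\<sigma>,False)" "[\<sigma>]"] by (simp add: lw_def)
  also have "\<dots> = cmat (- (k*k' * (rp - rq) * (rp - rq))) 0 0 (- (k*k' * (rp - rq) * (rp - rq)))"
    unfolding k k' cmat_mult
    by (intro arg_cong4[where f = cmat])
      (auto simp: la_def ld_def algebra_simps c)
  finally show ?thesis using k(1) k'(1) rp_gt_rq
    by (intro exI[of _ "- (k*k' * (rp - rq) * (rp - rq))"]) auto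
qed

lemma letter_det: "la l * ld l - (-rh) * rh = (rp - rq) * (rp - rq)"
  by (cases l) (auto simp: la_def ld_def rh_sq algebra_simps)

lemma letter_det_pos: "la l * ld l - (-rh) * rh > 0"
  unfolding letter_det using rp_gt_rq by simp

lemma real_mob_word: "real_mob (word_mob \<theta> ws)"
proof (induction ws)
  case Nil
  show ?case by (rule real_mobI[of _ 1 1 0 0 1]) (simp_all add: mat_1_cmat)
next
  case (Cons \<sigma> ws)
  have "real_mob (word_mob \<theta> [\<sigma>])"
    using word_mob_gen[of \<sigma>] letter_det_pos[of "(\<sigma>,True)"] real_mobI by blast
  from real_mob_mult[OF this Cons] show ?case
    using word_mob_append[of \<theta> "[\<sigma>]" ws] by simp
qed

definition act :: "bool list \<Rightarrow> complex \<Rightarrow> complex" where "act ws z = mob (word_mob \<theta> ws) z"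
definition bact :: "bool list \<Rightarrow> complex \<Rightarrow> complex" where "bact ws \<xi> = bnd_act (word_mob \<theta> ws) \<xi>"

lemma act_Im: "Im z > 0 \<Longrightarrow> Im (act ws z) > 0"
  unfolding act_def by (rule real_mob_Im[OF real_mob_word])

lemma act_chd: "Im z > 0 \<Longrightarrow> Im w > 0 \<Longrightarrow> chd (act ws z) (act ws w) = chd z w"
  unfolding act_def by (rule real_mob_chd[OF real_mob_word])

lemma act_append: "Im z > 0 \<Longrightarrow> act (xs @ ys) z = act xs (act ys z)"
  unfolding act_def word_mob_append by (rule mob_mult, rule real_mob_den[OF real_mob_word]) simp

lemma act_Nil [simp]: "act [] z = z"
  by (simp add: act_def mat_1_cmat mob_cmat)

lemma act_cube [simp]: "act [\<sigma>,\<sigma>,\<sigma>] z = z"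
proof -
  obtain k where "k \<noteq> 0" "word_mob \<theta> [\<sigma>,\<sigma>,\<sigma>] = cmat k 0 0 k" using word_mob_cube by blast
  then show ?thesis by (simp add: act_def mob_cmat)
qed

lemma bact_norm: "cmod \<xi> = 1 \<Longrightarrow> cmod (bact ws \<xi>) = 1"
  unfolding bact_def by (rule real_mob_norm[OF real_mob_word])

lemma bact_append: "cmod \<xi> \<le> 1 \<Longrightarrow> bact (xs @ ys) \<xi> = bact xs (bact ys \<xi>)"
  unfolding bact_def word_mob_append by (rule bnd_act_mult[OF real_mob_word real_mob_word])

lemma bact_cont: "continuous_on (cball 0 1) (bact ws)"
  unfolding bact_def[abs_def] by (rule real_mob_continuous[OF real_mob_word])

lemma bnd_act_scalar:
  assumes "k \<noteq> 0" shows "bnd_act (cmat k 0 0 k) \<xi> = \<xi>"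
proof -
  have "bnd_act (cmat k 0 0 k) \<xi> = mob (cmat ((2*\<i>*k)*1) ((2*\<i>*k)*0) ((2*\<i>*k)*0) ((2*\<i>*k)*1)) \<xi>"
    unfolding bnd_act_def cmat_mult by (simp add: algebra_simps)
  also have "\<dots> = \<xi>" using assms by (subst mob_cmat_scale) auto
  finally show ?thesis .
qed

lemma bact_Nil [simp]: "bact [] \<xi> = \<xi>"
  by (simp add: bact_def mat_1_cmat bnd_act_scalar)

lemma bact_cube [simp]: "bact [\<sigma>,\<sigma>,\<sigma>] \<xi> = \<xi>"
proof -
  obtain k where "k \<noteq> 0" "word_mob \<theta> [\<sigma>,\<sigma>,\<sigma>] = cmat k 0 0 k" using word_mob_cube by blast
  then show ?thesis by (simp add: bact_def bnd_act_scalar)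
qed

lemma cayley_act: "Im z > 0 \<Longrightarrow> cayley (act ws z) = bact ws (cayley z)"
  unfolding act_def bact_def by (rule cayley_equivariant[OF real_mob_word])

lemma act_linv: "Im z > 0 \<Longrightarrow> act (lw (linv l)) (act (lw l) z) = z"
  by (subst act_append[symmetric]) (auto simp: lw_def linv_def)

lemma bact_linv: "cmod \<xi> \<le> 1 \<Longrightarrow> bact (lw (linv l)) (bact (lw l) \<xi>) = \<xi>"
  by (subst bact_append[symmetric]) (auto simp: lw_def linv_def)

lemma act_linv': "Im z > 0 \<Longrightarrow> act (lw l) (act (lw (linv l)) z) = z"
  using act_linv[of z "linv l"] by simp

lemma bact_linv': "cmod \<xi> \<le> 1 \<Longrightarrow> bact (lw l) (bact (lw (linv l)) \<xi>) = \<xi>"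
  using bact_linv[of \<xi> "linv l"] by simp

text \<open>The gain in \<open>slope\<close> per letter. The root comes from the inequality of
  arithmetic and geometric means applied to the quadratic part of the numerator, the denominator is
  the determinant of the letter.\<close>

definition "shift = 2 * rh * sqrt (rp * rq) / ((rp - rq) * (rp - rq))"

lemma shift_pos: "shift > 0"
  unfolding shift_def using rp_pos rq_pos rh_pos rp_gt_rq by simp

text \<open>This is where the triangle has to be hyperideal: for \<open>\<theta> = \<pi> / 3\<close> the coefficient \<open>shift\<close>
  would vanish.\<close>

lemma slope_letter:
  assumes z: "Im z > 0" and s: "sg (fst l) * slope z \<le> 0"
  shows "sg (fst l) * slope (act (lw l) z) \<ge> - (sg (fst l) * slope z) + shift"
proof -
  define P where "P = (if snd l then rp else rq)"
  define Q where "Q = (if snd l then rq else rp)"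
  define m where "m = (rp - rq) * (rp - rq)"
  have PQ: "P > 0" "Q > 0" "P * Q = rp * rq" using rp_pos rq_pos by (auto simp: P_def Q_def)
  have m: "m > 0" "rh * rh = P * Q + m" using rp_gt_rq rh_sq PQ(3) by (auto simp: m_def)
  obtain k where k: "k \<noteq> 0" "word_mob \<theta> (lw l) = cmat (k * of_real (la l))
   (k * of_real (-rh)) (k * of_real rh) (k * of_real (ld l))"
    using letter_mob by blast
  define C where "C = (cmod z)^2"
  have sl: "slope (act (lw l) z) = (la l * rh * C + (la l * ld l - rh * rh) * Re z - rh * ld l) / (m * Im z)"
    unfolding act_def mob_real_slope[OF k(2,1) letter_det_pos z] letter_det C_def m_def by simp
  have C: "C \<ge> (Im z)^2" unfolding C_def cmod_power2 by simp
  have am: "2 * sqrt (P*Q) * Im z \<le> X * C + Y" if "X > 0" "Y > 0" "X * Y = P * Q" for X Y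
  proof -
    have "2 * (sqrt X * Im z) * sqrt Y \<le> (sqrt X * Im z)^2 + (sqrt Y)^2"
      by (rule sum_squares_bound)
    also have "\<dots> \<le> X * C + Y" using that C by (simp add: power_mult_distrib)
    finally show ?thesis unfolding that(3)[symmetric] real_sqrt_mult by (simp add: mult_ac)
  qed
  define x where "x = sg (fst l) * Re z"
  have x: "x \<le> 0" using s z unfolding slope_def x_def by (simp add: divide_le_0_iff)
  define X where "X = (if fst l then P else Q)"
  define Y where "Y = (if fst l then Q else P)"
  have XY: "X > 0" "Y > 0" "X * Y = P * Q"
    using PQ(1,2) by (auto simp: X_def Y_def mult.commute)
  have "sg (fst l) * slope (act (lw l) z) = (rh * (X * C + Y) - (P * Q + rh * rh) * x) / (m * Im z)"
    unfolding sl x_def X_def Y_def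
    by (cases l) (auto simp: la_def ld_def P_def Q_def algebra_simps)
  also have "\<dots> \<ge> (rh * (2 * sqrt (P*Q) * Im z) - m * x) / (m * Im z)"
  proof (rule divide_right_mono)
    have "P * Q > 0" using PQ(1,2) by simp
    then have "m * - x \<le> (P * Q + rh * rh) * - x" using m x by (intro mult_right_mono) simp_all
    moreover have "rh * (2 * sqrt (P*Q) * Im z) \<le> rh * (X * C + Y)"
      using am[OF XY] rh_pos by (intro mult_left_mono) auto
    ultimately show "rh * (2 * sqrt (P*Q) * Im z) - m * x \<le> rh * (X * C + Y) - (P * Q + rh * rh) * x"
      by simp
  qed (use m z in simp)
  also have "(rh * (2 * sqrt (P*Q) * Im z) - m * x) / (m * Im z) = - (sg (fst l) * slope z) + shift"
    using m z unfolding shift_def x_def slope_def m_def[symmetric] PQ(3)[symmetric]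
    by (simp add: field_simps)
  finally show ?thesis .
qed

text \<open>Ping-pong on the circle, where Im < 0 is the side of the positive reals because the
  Cayley transform reverses the sign. The inequality is strict even at the ends of e_0, since X and
  Y are both positive, that is, since rq > 0.\<close>

lemma bact_letter:
  assumes \<xi>: "cmod \<xi> = 1" and s: "sg (fst l) * Im \<xi> \<ge> 0"
  shows "sg (fst l) * Im (bact (lw l) \<xi>) < 0"
proof -
  obtain k where k: "k \<noteq> 0" "word_mob \<theta> (lw l) = cmat (k * of_real (la l))
   (k * of_real (-rh)) (k * of_real rh) (k * of_real (ld l))"
    using letter_mob by blast
  define P where "P = (if snd l then rp else rq)"
  define Q where "Q = (if snd l then rq else rp)"
  have PQ: "P > 0" "Q > 0" using rp_pos rq_pos by (auto simp: P_def Q_def)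
  define X where "X = (if fst l then P else Q)"
  define Y where "Y = (if fst l then Q else P)"
  have XY: "X > 0" "Y > 0" using PQ by (auto simp: X_def Y_def)
  have r: "- 1 \<le> Re \<xi>" "Re \<xi> \<le> 1" using abs_Re_le_cmod[of \<xi>] \<xi> by auto
  have "rh * (X * (1 + Re \<xi>)) \<ge> 0" "rh * (Y * (1 - Re \<xi>)) \<ge> 0"
    using XY r rh_pos by auto
  moreover have "rh * (X * (1 + Re \<xi>)) + rh * (Y * (1 - Re \<xi>)) > 0"
  proof (cases "Re \<xi> = 1")
    case True then show ?thesis using XY rh_pos by simp
  next
    case False then show ?thesis using XY rh_pos r
      by (intro add_nonneg_pos) auto
  qed
  moreover have "(P * Q + rh * rh) * (sg (fst l) * Im \<xi>) \<ge> 0"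
    using s PQ rh_pos by simp
  moreover have "sg (fst l) * (la l * rh * (1 + Re \<xi>) - (la l * ld l + (-rh) * rh) * Im \<xi>
       + (-rh) * ld l * (1 - Re \<xi>)) =
     rh * (X * (1 + Re \<xi>)) + rh * (Y * (1 - Re \<xi>)) + (P * Q + rh * rh) * (sg (fst l) * Im \<xi>)"
    unfolding X_def Y_def
    by (cases l) (auto simp: la_def ld_def P_def Q_def algebra_simps)
  ultimately have pos: "sg (fst l) * (la l * rh * (1 + Re \<xi>) - (la l * ld l + (-rh) * rh) * Im \<xi>
       + (-rh) * ld l * (1 - Re \<xi>)) > 0" by linarith
  have "(cmod (Complex (la l - ld l) (-rh + rh) * \<xi> + Complex (la l + ld l) (rh - -rh)))^2 > 0"
    using bnd_act_real_den[OF k(2,1) letter_det_pos, of \<xi>] \<xi> by simp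
  then show ?thesis using pos
    unfolding bact_def bnd_act_real_Im[OF k(2,1) letter_det_pos \<xi>]
    by (simp add: mult_less_0_iff divide_less_0_iff zero_less_mult_iff)
      (smt (verit) mult_minus_right)
qed

text \<open>Each letter throws the point across e_0 and adds at least \<open>shift\<close>. Thus the
  length of a normal form is controlled by the position of its orbit point, which later gives proper
  discontinuity.\<close>

lemma alternating_slope:
  "alternating \<sigma> L \<Longrightarrow> sg \<sigma> * slope (act (wd L) \<i>) \<ge> length L * shift"
proof (induction L arbitrary: \<sigma>)
  case Nil then show ?case by (simp add: slope_def)
next
  case (Cons l L)
  let ?z = "act (wd L) \<i>"
  have z: "Im ?z > 0" by (rule act_Im) simp
  have "- sg \<sigma> * slope ?z \<ge> length L * shift" using Cons.IH[of "\<not> \<sigma>"] Cons.prems by simp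
  moreover have "length L * shift \<ge> 0" using shift_pos by simp
  ultimately have *: "- sg \<sigma> * slope ?z \<ge> length L * shift" "- sg \<sigma> * slope ?z \<ge> 0" by linarith+
  have "sg (fst l) * slope (act (lw l) ?z) \<ge> - (sg (fst l) * slope ?z) + shift"
    using * Cons.prems by (intro slope_letter[OF z]) simp
  moreover have "act (wd (l # L)) \<i> = act (lw l) ?z" by (simp add: act_append)
  ultimately show ?case using * Cons.prems by (simp add: algebra_simps)
qed


lemma alternating_cases:
  assumes "alternating \<sigma> L"
  obtains "L = []" | s L' where "L = (\<sigma>, s) # L'" "alternating (\<not> \<sigma>) L'"
proof (cases L)
  case (Cons l L')
  then show ?thesis using that(2)[of "snd l" L'] assms by (cases l) auto
qed (use that in simp)

text \<open>Every word can be rewritten, by cancelling cubes, to an alternating one. The predicate \<open>P\<close>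
  collects whatever relation is to be preserved.\<close>

lemma word_reduce:
  fixes P :: "bool list \<Rightarrow> bool list \<Rightarrow> bool"
  assumes refl: "\<And>ws. P ws ws" and trans: "\<And>x y z. P x y \<Longrightarrow> P y z \<Longrightarrow> P x z"
    and cons: "\<And>\<sigma> x y. P x y \<Longrightarrow> P (\<sigma> # x) (\<sigma> # y)"
    and cube: "\<And>\<sigma> x. P (\<sigma> # \<sigma> # \<sigma> # x) x"
  shows "\<exists>\<sigma> L. alternating \<sigma> L \<and> P ws (wd L)"
proof (induction ws)
  case Nil
  show ?case by (rule exI[of _ True], rule exI[of _ "[]"]) (simp add: refl)
next
  case (Cons \<sigma> ws)
  then obtain \<tau> L where L: "alternating \<tau> L" "P (\<sigma> # ws) (\<sigma> # wd L)" using cons by blast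
  from L(1) show ?case
  proof (cases rule: alternating_cases)
    case 1
    then show ?thesis using L
      by (intro exI[of _ \<sigma>] exI[of _ "[(\<sigma>,True)]"]) (simp add: lw_def)
  next
    case (2 s L')
    show ?thesis
    proof (cases "\<sigma> = \<tau>")
      case False
      then show ?thesis using L
        by (intro exI[of _ \<sigma>] exI[of _ "(\<sigma>,True) # L"]) (auto simp: lw_def)
    next
      case True
      show ?thesis
      proof (cases s)
        case True
        then show ?thesis using L 2 \<open>\<sigma> = \<tau>\<close>
          by (intro exI[of _ \<sigma>] exI[of _ "(\<sigma>,False) # L'"]) (auto simp: lw_def)
      next
        case False
        then have "P (\<sigma> # ws) (wd L')" using L 2 \<open>\<sigma> = \<tau>\<close> cube trans by (auto simp: lw_def)
        then show ?thesis using 2 by blast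
      qed
    qed
  qed
qed

lemma orbit_reduce: "\<exists>\<sigma> L. alternating \<sigma> L \<and> act ws \<i> = act (wd L) \<i>"
proof -
  have "\<exists>\<sigma> L. alternating \<sigma> L \<and> (\<forall>z. Im z > 0 \<longrightarrow> act ws z = act (wd L) z)"
  proof (rule word_reduce)
    fix \<sigma> x y assume "\<forall>z. Im z > 0 \<longrightarrow> act x z = act y z"
    then show "\<forall>z. Im z > 0 \<longrightarrow> act (\<sigma> # x) z = act (\<sigma> # y) z"
      using act_append[of _ "[\<sigma>]"] by simp
  next
    fix \<sigma> x
    show "\<forall>z. Im z > 0 \<longrightarrow> act (\<sigma> # \<sigma> # \<sigma> # x) z = act x z"
      using act_append[of _ "[\<sigma>,\<sigma>,\<sigma>]" x] by simp
  qed simp_all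
  then obtain \<sigma> L where "alternating \<sigma> L" "\<And>z. Im z > 0 \<Longrightarrow> act ws z = act (wd L) z" by blast
  then show ?thesis by (intro exI[of _ \<sigma>] exI[of _ L]) simp
qed

section \<open>Coding of the limit set by first letters\<close>

abbreviation "\<Lambda> \<equiv> limit_set \<theta>"

lemma limit_set_eq: "\<Lambda> = closure (cayley ` range (\<lambda>ws. act ws \<i>)) \<inter> sphere 0 1"
  unfolding limit_set_def act_def by (simp add: full_SetCompr_eq)

lemma limit_norm [simp]: "\<xi> \<in> \<Lambda> \<Longrightarrow> cmod \<xi> = 1"
  by (simp add: limit_set_eq)

lemma compact_limit: "compact \<Lambda>"
  unfolding limit_set_eq by (intro closed_Int_compact) auto

lemma orbit_closure_subset: "closure (cayley ` range (\<lambda>ws. act ws \<i>)) \<subseteq> cball 0 1"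
proof (rule closure_minimal)
  show "cayley ` range (\<lambda>ws. act ws \<i>) \<subseteq> cball 0 1"
    using cayley_norm[OF act_Im[of \<i>]] by (auto simp: less_imp_le)
qed simp

lemma limit_bact:
  assumes "\<xi> \<in> \<Lambda>"
  shows "bact ws \<xi> \<in> \<Lambda>"
proof -
  let ?O = "cayley ` range (\<lambda>ws. act ws \<i>)"
  have "bact ws (cayley (act xs \<i>)) = cayley (act (ws @ xs) \<i>)" for xs
    using cayley_act[OF act_Im[of \<i> xs], of ws] act_append[of \<i> ws xs] by simp
  then have "bact ws ` ?O \<subseteq> ?O" by auto
  then have "bact ws ` closure ?O \<subseteq> closure ?O"
    by (intro image_closure_subset[OF continuous_on_subset[OF bact_cont orbit_closure_subset]]
        closed_closure order_trans[OF _ closure_subset])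
  then have "bact ws \<xi> \<in> closure ?O" using assms unfolding limit_set_eq by blast
  then show ?thesis using assms bact_norm[of \<xi> ws] unfolding limit_set_eq by simp
qed

text \<open>An orbit point other than i comes from a nonempty normal form and lies in the closed set
  \<open>U l\<close> of its first letter. There are four letters, so the closure of the orbit is
  covered by these sets and the point 0, the Cayley image of i, which is not on the circle.\<close>

lemma limit_letter:
  assumes \<xi>: "\<xi> \<in> \<Lambda>"
  shows "\<exists>l. sg (fst l) * Im (bact (lw (linv l)) \<xi>) \<ge> 0"
proof -
  define U where "U l = cball 0 1 \<inter> {w \<in> cball 0 1. 0 \<le> sg (fst l) * Im (bact (lw (linv l)) w)}" for l
  let ?O = "cayley ` range (\<lambda>ws. act ws \<i>)"
  have cl: "closed (U l)" for l
    unfolding U_def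
    by (intro closed_Int closed_cball continuous_closed_preimage_constant
        continuous_on_closed_Collect_le continuous_intros continuous_on_subset[OF bact_cont]) auto
  have "?O \<subseteq> {0} \<union> (\<Union>l. U l)"
  proof
    fix w assume "w \<in> ?O"
    then obtain ws where w: "w = cayley (act ws \<i>)" by auto
    obtain \<sigma> L where L: "alternating \<sigma> L" "act ws \<i> = act (wd L) \<i>" using orbit_reduce by blast
    show "w \<in> {0} \<union> (\<Union>l. U l)"
    proof (cases L)
      case Nil then show ?thesis using L w by (simp add: cayley_def)
    next
      case (Cons l L')
      let ?z = "act (wd L') \<i>"
      have z: "Im ?z > 0" by (rule act_Im) simp
      have aw: "act ws \<i> = act (lw l) ?z" using L Cons by (simp add: act_append)
      have "bact (lw (linv l)) w = cayley ?z"
        unfolding w aw using cayley_act[OF act_Im[OF z], of "lw (linv l)" "lw l"] act_linv[OF z] by simp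
      moreover have "sg (fst l) * Im (cayley ?z) \<ge> 0"
      proof -
        have "- sg \<sigma> * slope ?z \<ge> length L' * shift"
          using alternating_slope[of "\<not> \<sigma>" L'] L Cons by simp
        then have "- sg \<sigma> * slope ?z \<ge> 0" using shift_pos
          by (meson less_imp_le mult_nonneg_nonneg of_nat_0_le_iff order_trans)
        then have "- sg \<sigma> * Re ?z \<ge> 0" using z by (simp add: slope_def zero_le_divide_iff divide_le_0_iff)
        then show ?thesis using L Cons unfolding cayley_Im
          by (auto simp: divide_le_0_iff zero_le_divide_iff mult_le_0_iff zero_le_mult_iff sg_def split: if_splits)
      qed
      moreover have "cmod w \<le> 1" unfolding w using cayley_norm[OF act_Im[of \<i>]] by (simp add: less_imp_le)
      ultimately have "w \<in> U l" by (simp add: U_def)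
      then show ?thesis by blast
    qed
  qed
  then have "closure ?O \<subseteq> {0} \<union> (\<Union>l. U l)"
    by (intro closure_minimal closed_Un closed_UN ballI cl) simp_all
  then have "\<xi> \<in> {0} \<union> (\<Union>l. U l)" using \<xi> unfolding limit_set_eq by blast
  then show ?thesis using limit_norm[OF \<xi>] unfolding U_def by force
qed

definition sd :: "complex \<Rightarrow> bool" where "sd \<xi> \<longleftrightarrow> Im \<xi> < 0"

text \<open>A limit point is the image under its first letter of a point on the opposite closed
  side, and \<open>bact_letter\<close> is strict; hence the ends of e_0 are not limit
  points.\<close>

lemma sd_sg: "\<xi> \<in> \<Lambda> \<Longrightarrow> sg (sd \<xi>) * Im \<xi> < 0"
proof -
  assume \<xi>: "\<xi> \<in> \<Lambda>"
  obtain l where l: "sg (fst l) * Im (bact (lw (linv l)) \<xi>) \<ge> 0" using limit_letter[OF \<xi>] by blast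
  have "sg (fst l) * Im (bact (lw l) (bact (lw (linv l)) \<xi>)) < 0"
    using bact_letter[OF _ l] bact_norm \<xi> by simp
  then have "Im \<xi> \<noteq> 0" using bact_linv'[of \<xi> l] \<xi> by (auto simp: sg_def)
  then show ?thesis by (auto simp: sd_def sg_def)
qed

lemma sd_eqI: "\<xi> \<in> \<Lambda> \<Longrightarrow> sg \<sigma> * Im \<xi> \<le> 0 \<Longrightarrow> sd \<xi> = \<sigma>"
  using sd_sg[of \<xi>] by (cases \<sigma>; cases "sd \<xi>") auto

lemma sd_bact_lw:
  assumes "\<xi> \<in> \<Lambda>" "sd \<xi> \<noteq> fst l"
  shows "sd (bact (lw l) \<xi>) = fst l"
proof -
  have "sg (fst l) * Im \<xi> \<ge> 0" using sd_sg[OF assms(1)] assms(2) by (cases "fst l"; cases "sd \<xi>") auto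
  then show ?thesis
    using bact_letter[of \<xi> l] assms limit_bact by (intro sd_eqI) (auto simp: less_imp_le)
qed

definition lt :: "complex \<Rightarrow> bool \<times> bool" where
  "lt \<xi> = (SOME l. fst l = sd \<xi> \<and> sd (bact (lw (linv l)) \<xi>) \<noteq> sd \<xi>)"

definition sh :: "complex \<Rightarrow> complex" where "sh \<xi> = bact (lw (linv (lt \<xi>))) \<xi>"

lemma ltI:
  assumes \<xi>: "\<xi> \<in> \<Lambda>" shows "fst (lt \<xi>) = sd \<xi>" "sd (sh \<xi>) = (\<not> sd \<xi>)"
proof -
  obtain l where l: "sg (fst l) * Im (bact (lw (linv l)) \<xi>) \<ge> 0" using limit_letter[OF \<xi>] by blast
  let ?e = "bact (lw (linv l)) \<xi>"
  have e: "?e \<in> \<Lambda>" by (rule limit_bact[OF \<xi>])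
  have "sd ?e = (\<not> fst l)" using l by (intro sd_eqI[OF e]) auto
  moreover have "sd \<xi> = fst l"
    using sd_bact_lw[OF e, of l] calculation bact_linv'[of \<xi> l] \<xi> by simp
  ultimately have "fst l = sd \<xi> \<and> sd (bact (lw (linv l)) \<xi>) \<noteq> sd \<xi>" by simp
  then have "fst (lt \<xi>) = sd \<xi> \<and> sd (sh \<xi>) \<noteq> sd \<xi>" unfolding lt_def sh_def by (rule someI)
  then show "fst (lt \<xi>) = sd \<xi>" "sd (sh \<xi>) = (\<not> sd \<xi>)" by auto
qed

lemma sh_limit: "\<xi> \<in> \<Lambda> \<Longrightarrow> sh \<xi> \<in> \<Lambda>"
  unfolding sh_def by (rule limit_bact)

lemma bact_sh: "\<xi> \<in> \<Lambda> \<Longrightarrow> bact (lw (lt \<xi>)) (sh \<xi>) = \<xi>"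
  unfolding sh_def by (rule bact_linv') simp

lemma bact_sq: "cmod \<xi> \<le> 1 \<Longrightarrow> bact (lw l) (bact (lw l) \<xi>) = bact (lw (linv l)) \<xi>"
proof -
  assume "cmod \<xi> \<le> 1"
  then have "bact (lw l @ lw l) \<xi> = bact (lw (linv l)) \<xi>"
    using bact_append[of \<xi> "[fst l, fst l, fst l]" "[fst l]"]
    by (cases l; cases "snd l") (auto simp: lw_def linv_def)
  then show ?thesis using bact_append \<open>cmod \<xi> \<le> 1\<close> by simp
qed

text \<open>Uniqueness of the first letter. If \<open>linv l\<close> were chosen, removing it would
  apply \<open>l\<close> a second time; the result is \<open>linv l\<close> applied to \<xi>, which
  is still on the side of \<open>l\<close>, whereas removing a first letter must change the
  side.\<close>

lemma lt_bact_lw: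
  assumes \<xi>: "\<xi> \<in> \<Lambda>" "sd \<xi> \<noteq> fst l"
  shows "lt (bact (lw l) \<xi>) = l" "sh (bact (lw l) \<xi>) = \<xi>"
proof -
  let ?e = "bact (lw l) \<xi>"
  have e: "?e \<in> \<Lambda>" by (rule limit_bact[OF \<xi>(1)])
  have sd: "sd ?e = fst l" by (rule sd_bact_lw[OF \<xi>])
  have "snd (lt ?e) = snd l"
  proof (rule ccontr)
    assume "snd (lt ?e) \<noteq> snd l"
    then have "lt ?e = linv l" using ltI(1)[OF e] sd by (cases "lt ?e") (auto simp: linv_def)
    then have "sh ?e = bact (lw l) (bact (lw l) \<xi>)" by (simp add: sh_def)
    also have "\<dots> = bact (lw (linv l)) \<xi>" using bact_sq \<xi> by simp
    finally have "sd (sh ?e) = fst l" using sd_bact_lw[of \<xi> "linv l"] \<xi> by simp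
    then show False using ltI(2)[OF e] sd by simp
  qed
  then show l: "lt ?e = l" using ltI(1)[OF e] sd by (simp add: prod_eq_iff)
  show "sh ?e = \<xi>" unfolding sh_def l using bact_linv \<xi> by simp
qed

text \<open>This replaces the choice in \<open>lt\<close> by a closed condition, so that the four
  pieces are closed and maps defined letter by letter can be glued.\<close>

lemma lt_iff:
  assumes "\<xi> \<in> \<Lambda>"
  shows "lt \<xi> = l \<longleftrightarrow> sg (fst l) * Im (bact (lw (linv l)) \<xi>) \<ge> 0"
proof
  have *: "bact (lw (linv l)) \<xi> \<in> \<Lambda>" by (rule limit_bact[OF assms])
  { assume l: "lt \<xi> = l"
    then have "sd (bact (lw (linv l)) \<xi>) \<noteq> fst l" using ltI[OF assms] unfolding sh_def by simp
    then show "sg (fst l) * Im (bact (lw (linv l)) \<xi>) \<ge> 0"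
      using sd_sg[OF *] by (cases "fst l"; cases "sd (bact (lw (linv l)) \<xi>)") auto }
  { assume l: "sg (fst l) * Im (bact (lw (linv l)) \<xi>) \<ge> 0"
    have "sd (bact (lw (linv l)) \<xi>) \<noteq> fst l"
    proof
      assume "sd (bact (lw (linv l)) \<xi>) = fst l"
      then show False using sd_sg[OF *] l by simp
    qed
    then show "lt \<xi> = l" using lt_bact_lw(1)[OF *, of l] bact_linv'[of \<xi> l] assms by simp }
qed

definition piece :: "bool \<times> bool \<Rightarrow> complex set" where "piece l = {\<xi> \<in> \<Lambda>. lt \<xi> = l}"

lemma closed_piece: "closed (piece l)"
proof -
  have "piece l = {\<xi> \<in> \<Lambda>. 0 \<le> sg (fst l) * Im (bact (lw (linv l)) \<xi>)}"
    unfolding piece_def using lt_iff[of _ l] by blast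
  also have "closed \<dots>"
    by (intro continuous_on_closed_Collect_le continuous_intros
       continuous_on_subset[OF bact_cont] compact_imp_closed compact_limit) auto
  finally show ?thesis .
qed

lemma limit_pieces: "\<Lambda> = (\<Union>l. piece l)"
  by (auto simp: piece_def)

lemma sd_cont: "continuous_on \<Lambda> (\<lambda>\<xi>. f (sd \<xi>) :: 'a::topological_space)"
proof -
  have "continuous_on (\<Union>l. piece l) (\<lambda>\<xi>. f (sd \<xi>))"
  proof (rule continuous_on_closed_Union)
    fix l
    have "continuous_on (piece l) (\<lambda>\<xi>. f (fst l))" by simp
    then show "continuous_on (piece l) (\<lambda>\<xi>. f (sd \<xi>))"
      by (rule continuous_on_eq) (use ltI in \<open>auto simp: piece_def\<close>)
  qed (auto simp: closed_piece)
  then show ?thesis using limit_pieces by simp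
qed

text \<open>Compactness turns \<open>sd_sg\<close> into a uniform gap between the limit set and the
  ends of e_0.\<close>

lemma limit_Im_bound: "\<exists>m>0. \<forall>\<xi>\<in>\<Lambda>. \<bar>Im \<xi>\<bar> \<ge> m"
proof (cases "\<Lambda> = {}")
  case True then show ?thesis by (intro exI[of _ 1]) simp
next
  case False
  have "continuous_on \<Lambda> (\<lambda>\<xi>. \<bar>Im \<xi>\<bar>)" by (intro continuous_intros)
  then obtain \<eta> where "\<eta> \<in> \<Lambda>" "\<And>\<xi>. \<xi> \<in> \<Lambda> \<Longrightarrow> \<bar>Im \<eta>\<bar> \<le> \<bar>Im \<xi>\<bar>"
    using continuous_attains_inf[OF compact_limit False] by metis
  then show ?thesis using sd_sg[of \<eta>] by (intro exI[of _ "\<bar>Im \<eta>\<bar>"]) auto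
qed

end

section \<open>Geodesics with ends in the limit set\<close>

text \<open>The form ac - b^2 has signature (1,2) and (A,B,C) is timelike. The form is definite on
  the orthogonal complement, so a null vector there is zero.\<close>

lemma null_orthogonal_zero:
  fixes a b c A B C :: real
  assumes "a * c = b * b" "a * C + c * A = 2 * b * B" "A * C = 1 + B * B"
  shows "a = 0 \<and> b = 0 \<and> c = 0"
proof -
  have "(a*C - c*A)*(a*C - c*A) = (a*C + c*A)*(a*C + c*A) - 4*(a*c)*(A*C)"
    by (simp add: algebra_simps)
  also have "\<dots> = - 4 * (b * b)" unfolding assms by (simp add: algebra_simps)
  finally have *: "(a*C - c*A)*(a*C - c*A) + 4 * (b * b) = 0" by simp
  have "(a*C - c*A)*(a*C - c*A) \<ge> 0" "b * b \<ge> 0" by simp_all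
  with * have "(a*C - c*A)*(a*C - c*A) = 0" "b * b = 0" by linarith+
  then have b: "b = 0" and e: "a*C = c*A" by simp_all
  have "A \<noteq> 0" "C \<noteq> 0" using assms(3) by (auto simp: add_nonneg_eq_0_iff)
  then show ?thesis using assms(2) b e by auto
qed

text \<open>In the hyperboloid model, with coordinates \<open>(1/y, x/y, |z|\<^sup>2/y)\<close>, a geodesic is the
  intersection with a plane.\<close>

lemma geodesic_coordinates:
  fixes A B C :: "real \<Rightarrow> real"
  assumes g: "\<And>s t. A s * C t + C s * A t - 2 * B s * B t = 2 * cosh (s - t)"
  obtains a1 a2 b1 b2 c1 c2 where
    "\<And>t. A t = a1 * exp t + a2 * exp (-t)" "\<And>t. B t = b1 * exp t + b2 * exp (-t)"
    "\<And>t. C t = c1 * exp t + c2 * exp (-t)" "a1 * c2 + a2 * c1 - 2 * b1 * b2 = 1"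
    "a1 * c1 = b1 * b1" "a2 * c2 = b2 * b2"
proof -
  define S where "S = sinh (1::real)"
  have S: "S > 0" by (simp add: S_def)
  \<comment> \<open>Each point of the curve is compared with the hyperbolic interpolation between
    times 0 and 1. The difference is null (by \<open>e2\<close>) and orthogonal to the point at time
    0 (by \<open>e1\<close>), hence zero.\<close>
  have *: "A t = sinh (1-t)/S * A 0 + sinh t/S * A 1 \<and> B t = sinh (1-t)/S * B 0 + sinh t/S * B 1 \<and>
      C t = sinh (1-t)/S * C 0 + sinh t/S * C 1" for t
  proof -
    define f where "f = sinh (1-t)/S" define h where "h = sinh t/S"
    have i1: "f + h * cosh 1 = cosh t" and i2: "h + f * cosh 1 = cosh (1-t)"
      and i3: "f * cosh t + h * cosh (1-t) = 1"
    proof -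
      show "f + h * cosh 1 = cosh t" using S unfolding f_def h_def S_def
        by (simp add: field_simps sinh_diff)
      have "sinh t + sinh (1-t) * cosh 1 = cosh (1-t) * sinh 1"
        using sinh_diff[of 1 "1-t"] by (simp add: algebra_simps)
      then show "h + f * cosh 1 = cosh (1-t)" using S unfolding f_def h_def S_def
        by (simp add: field_simps)
      have "sinh (1-t) * cosh t + sinh t * cosh (1-t) = sinh 1"
        using sinh_add[of "1-t" t] by (simp add: algebra_simps)
      then show "f * cosh t + h * cosh (1-t) = 1" using S unfolding f_def h_def S_def
        by (simp add: field_simps)
    qed
    have g00: "A 0 * C 0 - B 0 * B 0 = 1" and g11: "A 1 * C 1 - B 1 * B 1 = 1"
      and gtt: "A t * C t - B t * B t = 1" using g[of 0 0] g[of 1 1] g[of t t] by simp_all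
    have g01: "A 0 * C 1 + C 0 * A 1 - 2 * B 0 * B 1 = 2 * cosh 1"
      and gt0: "A t * C 0 + C t * A 0 - 2 * B t * B 0 = 2 * cosh t"
      and gt1: "A t * C 1 + C t * A 1 - 2 * B t * B 1 = 2 * cosh (1-t)"
      using g[of 0 1] g[of t 0] g[of t 1] cosh_minus[of "t-1"] by simp_all
    have e1: "(A t - f * A 0 - h * A 1) * C 0 + (C t - f * C 0 - h * C 1) * A 0
       - 2 * (B t - f * B 0 - h * B 1) * B 0 = 2 * cosh t - 2 * (f + h * cosh 1)"
    proof -
      have "(A t - f * A 0 - h * A 1) * C 0 + (C t - f * C 0 - h * C 1) * A 0
       - 2 * (B t - f * B 0 - h * B 1) * B 0 = (A t * C 0 + C t * A 0 - 2 * B t * B 0)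
        - 2 * f * (A 0 * C 0 - B 0 * B 0) - h * (A 0 * C 1 + C 0 * A 1 - 2 * B 0 * B 1)"
        by (simp add: algebra_simps)
      then show ?thesis unfolding g00 g01 gt0 by simp
    qed
    have e2: "(A t - f * A 0 - h * A 1) * (C t - f * C 0 - h * C 1)
       - (B t - f * B 0 - h * B 1) * (B t - f * B 0 - h * B 1)
      = 1 + f * (f + h * cosh 1) + h * (h + f * cosh 1) - 2 * (f * cosh t + h * cosh (1-t))"
    proof -
      have "(A t - f * A 0 - h * A 1) * (C t - f * C 0 - h * C 1)
       - (B t - f * B 0 - h * B 1) * (B t - f * B 0 - h * B 1) =
        (A t * C t - B t * B t) + f * f * (A 0 * C 0 - B 0 * B 0) + h * h * (A 1 * C 1 - B 1 * B 1)
        + f * h * (A 0 * C 1 + C 0 * A 1 - 2 * B 0 * B 1)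
        - f * (A t * C 0 + C t * A 0 - 2 * B t * B 0) - h * (A t * C 1 + C t * A 1 - 2 * B t * B 1)"
        by (simp add: algebra_simps)
      then show ?thesis unfolding g00 g11 g01 gt0 gt1 gtt by (simp add: algebra_simps)
    qed
    have "A t - f * A 0 - h * A 1 = 0 \<and> B t - f * B 0 - h * B 1 = 0 \<and> C t - f * C 0 - h * C 1 = 0"
    proof (rule null_orthogonal_zero[where A = "A 0" and B = "B 0" and C = "C 0"])
      show "(A t - f * A 0 - h * A 1) * (C t - f * C 0 - h * C 1)
          = (B t - f * B 0 - h * B 1) * (B t - f * B 0 - h * B 1)"
      proof (rule eq_iff_diff_eq_0[THEN iffD2])
        show "(A t - f * A 0 - h * A 1) * (C t - f * C 0 - h * C 1)
          - (B t - f * B 0 - h * B 1) * (B t - f * B 0 - h * B 1) = 0"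
          unfolding e2 i1 i2 using i3 by (simp add: algebra_simps)
      qed
      show "(A t - f * A 0 - h * A 1) * C 0 + (C t - f * C 0 - h * C 1) * A 0
          = 2 * (B t - f * B 0 - h * B 1) * B 0"
        using e1 unfolding i1 by linarith
      show "A 0 * C 0 = 1 + B 0 * B 0" using g00 by linarith
    qed
    then show ?thesis unfolding f_def h_def by auto
  qed
  define al where "al x0 x1 = (x1 - exp (-1) * x0) / (2*S)" for x0 x1
  define be where "be x0 x1 = (exp 1 * x0 - x1) / (2*S)" for x0 x1
  have ex: "sinh (1-t)/S * x0 + sinh t/S * x1 = al x0 x1 * exp t + be x0 x1 * exp (-t)" for t x0 x1
  proof -
    have s1: "sinh (1-t) = (exp 1 * exp (-t) - exp (-1) * exp t) / 2"
      by (simp add: sinh_field_def exp_diff exp_minus field_simps)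
    have s2: "sinh t = (exp t - exp (-t)) / 2" by (simp add: sinh_field_def)
    show ?thesis unfolding al_def be_def s1 s2 using S by (simp add: field_simps)
  qed
  have AA: "A t = al (A 0) (A 1) * exp t + be (A 0) (A 1) * exp (-t)"
    and BB: "B t = al (B 0) (B 1) * exp t + be (B 0) (B 1) * exp (-t)"
    and CC: "C t = al (C 0) (C 1) * exp t + be (C 0) (C 1) * exp (-t)" for t
    using *[of t] unfolding ex by blast+
  \<comment> \<open>With x = exp t, the identity AC - B^2 = 1 reads P x^2 + Q / x^2 + R = 1. The
    values x = 1, 2, 1/2 force P = Q = 0 and R = 1.\<close>
  define P where "P = al (A 0) (A 1) * al (C 0) (C 1) - al (B 0) (B 1) * al (B 0) (B 1)"
  define Q where "Q = be (A 0) (A 1) * be (C 0) (C 1) - be (B 0) (B 1) * be (B 0) (B 1)"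
  define R where "R = al (A 0) (A 1) * be (C 0) (C 1) + be (A 0) (A 1) * al (C 0) (C 1)
      - 2 * al (B 0) (B 1) * be (B 0) (B 1)"
  have q: "P * (x * x) + Q * (y * y) + R = 1" if "x = exp t" "y = exp (-t)" for x y t
  proof -
    have xy: "x * y = 1" using that by (simp add: exp_minus)
    have "A t * C t - B t * B t = P * (x * x) + Q * (y * y) + R * (x * y)"
      unfolding AA[of t] BB[of t] CC[of t] that[symmetric] P_def Q_def R_def by (simp add: algebra_simps)
    then show ?thesis using g[of t t] xy by simp
  qed
  have "P + Q + R = 1" "4 * P + Q / 4 + R = 1" "P / 4 + 4 * Q + R = 1"
    using q[of 1 0 1] q[of 2 "ln 2" "1/2"] q[of "1/2" "- ln 2" 2]
    by (simp_all add: exp_minus)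
  then have "P = 0" "Q = 0" "R = 1" by linarith+
  then show ?thesis
    by (intro that[OF AA BB CC]) (simp_all add: P_def Q_def R_def)
qed

lemma exp_neg_tendsto: "((\<lambda>t::real. exp (-t)) \<longlongrightarrow> 0) at_top"
  using filterlim_compose[OF exp_at_bot filterlim_uminus_at_bot_at_top] .

lemma leading_nonneg:
  fixes a b :: real
  assumes "\<And>t. a * exp t + b * exp (-t) > 0"
  shows "a \<ge> 0"
proof (rule tendsto_lowerbound)
  show "((\<lambda>t::real. a + b * (exp (-t) * exp (-t))) \<longlongrightarrow> a) at_top"
    by (rule tendsto_eq_intros exp_neg_tendsto | simp)+
  have "a + b * (exp (-t) * exp (-t)) \<ge> 0" for t
  proof -
    have "a + b * (exp (-t) * exp (-t)) = exp (-t) * (a * exp t + b * exp (-t))"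
      by (simp add: algebra_simps exp_minus)
    then show ?thesis using assms[of t] by simp
  qed
  then show "\<forall>\<^sub>F t in at_top. 0 \<le> a + b * (exp (-t) * exp (-t))" by simp
qed simp

lemma chd_coordinates:
  assumes "Im z > 0" "Im w > 0"
  shows "2 * chd z w = 1 / Im z * ((cmod w)^2 / Im w) + (cmod z)^2 / Im z * (1 / Im w)
     - 2 * slope z * slope w"
  unfolding chd_alt[OF assms] slope_def using assms by (simp add: field_simps)

text \<open>The isometry that sends z to (z - Re a) / Im a moves the middle point to i.\<close>

lemma chd_quasi_triangle':
  assumes z: "Im z > 0" and w: "Im w > 0" and a: "Im a > 0"
  shows "chd z w \<le> 2 * chd z a * chd a w"
proof -
  define M where "M = cmat (1 * of_real 1) (1 * of_real (- Re a)) (1 * of_real 0) (1 * of_real (Im a))"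
  have M: "real_mob M" by (rule real_mobI[OF M_def]) (use a in auto)
  have "mob M a = \<i>" unfolding M_def using a by (simp add: mob_cmat complex_eq_iff Re_divide Im_divide power2_eq_square)
  then show ?thesis
    using chd_quasi_triangle[OF real_mob_Im[OF M z] real_mob_Im[OF M w]] real_mob_chd[OF M] z w a
    by metis
qed

lemma hdist_chd: "hdist z w = arcosh (chd z w)"
  by (simp add: hdist_def chd_def)

lemma is_geodesic_chd:
  assumes "is_geodesic c" shows "chd (c s) (c t) = cosh (s - t)"
proof -
  have c: "Im (c s) > 0" "Im (c t) > 0" "arcosh (chd (c s) (c t)) = \<bar>s - t\<bar>"
    using assms unfolding is_geodesic_def hdist_chd by auto
  have "chd (c s) (c t) = cosh \<bar>s - t\<bar>"
    using cosh_arcosh_real[OF chd_ge1[OF c(1,2)]] c(3) by simp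
  then show ?thesis by simp
qed

text \<open>Along a geodesic \<open>slope\<close> and the \<open>chd\<close> to i are combinations
  of exp t and exp (-t); in this form the ends can be computed as limits.\<close>

lemma cayley_Im_coordinates:
  assumes "Im z > 0"
  shows "Im (cayley z) = - 2 * slope z / (2 * chd z \<i> + 2)"
proof -
  have "(cmod (z + \<i>))^2 = Im z * (2 * chd z \<i> + 2)"
    using assms unfolding chd_i[OF assms] cmod_power2
    by (simp add: field_simps power2_eq_square)
  then show ?thesis unfolding cayley_Im slope_def by simp
qed

lemma end_limit:
  fixes u v p q :: real
  assumes "p > 0"
  shows "((\<lambda>t. - 2 * (u * exp t + v * exp (-t)) / (p * exp t + q * exp (-t) + 2))
     \<longlongrightarrow> - 2 * u / p) at_top"
proof -
  have "((\<lambda>t. - 2 * (u + v * (exp (-t) * exp (-t))) / (p + q * (exp (-t) * exp (-t)) + 2 * exp (-t)))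
     \<longlongrightarrow> - 2 * u / p) at_top"
    by (rule tendsto_eq_intros exp_neg_tendsto | use assms in simp)+
  moreover have "- 2 * (u + v * (exp (-t) * exp (-t))) / (p + q * (exp (-t) * exp (-t)) + 2 * exp (-t))
    = - 2 * (u * exp t + v * exp (-t)) / (p * exp t + q * exp (-t) + 2)" for t :: real
  proof -
    have e: "exp t * exp (-t) = (1::real)" by (simp add: exp_minus)
    have "exp t * (- 2 * (u + v * (exp (-t) * exp (-t)))) = - 2 * (u * exp t + v * exp (-t) * (exp t * exp (-t)))"
      "exp t * (p + q * (exp (-t) * exp (-t)) + 2 * exp (-t))
       = p * exp t + q * exp (-t) * (exp t * exp (-t)) + 2 * (exp t * exp (-t))"
      by (simp_all only: distrib_left distrib_right mult_ac)
    then have "- 2 * (u * exp t + v * exp (-t)) = exp t * (- 2 * (u + v * (exp (-t) * exp (-t))))"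
      "p * exp t + q * exp (-t) + 2 = exp t * (p + q * (exp (-t) * exp (-t)) + 2 * exp (-t))"
      unfolding e by simp_all
    then show ?thesis by (simp only: mult_divide_mult_cancel_left[OF exp_not_eq_zero])
  qed
  ultimately show ?thesis by simp
qed

text \<open>The leading coefficients at both ends determine the end points. The last inequality is
  what remains of a1 c2 + a2 c1 - 2 b1 b2 = 1 when the nonnegative terms are dropped; it confines
  the crossing with e_0 to a bounded part of e_0.\<close>

lemma geodesic_slope:
  assumes c: "is_geodesic c" and e: "geod_ends c \<xi>m \<xi>p"
  obtains u v p q where "\<And>t. slope (c t) = u * exp t + v * exp (-t)"
    "\<And>t. 2 * chd (c t) \<i> = p * exp t + q * exp (-t)"
    "p > 0" "q > 0" "Im \<xi>p = - 2 * u / p" "Im \<xi>m = - 2 * v / q" "- 2 * u * v \<le> 1"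
proof -
  have im: "Im (c t) > 0" for t using c by (simp add: is_geodesic_def)
  obtain a1 a2 b1 b2 c1 c2 where
    A: "\<And>t. 1 / Im (c t) = a1 * exp t + a2 * exp (-t)" and
    B: "\<And>t. slope (c t) = b1 * exp t + b2 * exp (-t)" and
    C: "\<And>t. (cmod (c t))^2 / Im (c t) = c1 * exp t + c2 * exp (-t)" and
    r: "a1 * c2 + a2 * c1 - 2 * b1 * b2 = 1" "a1 * c1 = b1 * b1" "a2 * c2 = b2 * b2"
    by (rule geodesic_coordinates[of "\<lambda>t. 1 / Im (c t)" "\<lambda>t. (cmod (c t))^2 / Im (c t)" "\<lambda>t. slope (c t)"])
      (use chd_coordinates[OF im im] is_geodesic_chd[OF c] in \<open>simp, blast\<close>)
  have pos: "a1 * exp t + a2 * exp (-t) > 0" "c1 * exp t + c2 * exp (-t) \<ge> 0" for t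
    unfolding A[symmetric] C[symmetric] using im[of t] by simp_all
  have posC: "c1 * exp t + c2 * exp (-t) > 0" for t
  proof -
    have "(cmod (c t))^2 > 0" using im[of t] by auto
    then show ?thesis unfolding C[symmetric] using im[of t] by simp
  qed
  have a1: "a1 \<ge> 0" and c1: "c1 \<ge> 0" using leading_nonneg pos posC by blast+
  have "a2 \<ge> 0" using leading_nonneg[of a2 a1] pos[of "- t" for t] by (simp add: add.commute)
  have c2: "c2 \<ge> 0" using leading_nonneg[of c2 c1] posC[of "- t" for t] by (simp add: add.commute)
  note a2 = \<open>a2 \<ge> 0\<close>
  have p: "a1 + c1 > 0" and q: "a2 + c2 > 0"
    using r a1 a2 c1 c2 by (auto simp: less_le add_nonneg_eq_0_iff)
  have i: "2 * chd (c t) \<i> = (a1 + c1) * exp t + (a2 + c2) * exp (-t)" for t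
    unfolding chd_i[OF im] add_divide_distrib A C by (simp add: algebra_simps)
  have cay: "Im (cayley (c t)) = - 2 * (b1 * exp t + b2 * exp (-t)) /
      ((a1 + c1) * exp t + (a2 + c2) * exp (-t) + 2)" for t
    unfolding cayley_Im_coordinates[OF im] i B ..
  have "((\<lambda>t. Im (cayley (c t))) \<longlongrightarrow> Im \<xi>p) at_top"
    using e unfolding geod_ends_def by (intro tendsto_Im) simp
  from tendsto_unique[OF _ this] have ep: "Im \<xi>p = - 2 * b1 / (a1 + c1)"
    unfolding cay using end_limit[OF p] by simp
  have "((\<lambda>t. Im (cayley (c (- t)))) \<longlongrightarrow> Im \<xi>m) at_top"
    using e unfolding geod_ends_def
    by (intro tendsto_Im) (simp add: filterlim_at_bot_mirror)
  from tendsto_unique[OF _ this] have em: "Im \<xi>m = - 2 * b2 / (a2 + c2)"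
    unfolding cay using end_limit[OF q, of b2 b1 "a1 + c1"] by (simp add: add_ac)
  have "a1 * c2 \<ge> 0" "a2 * c1 \<ge> 0" using a1 a2 c1 c2 by auto
  then have "- 2 * b1 * b2 \<le> 1" using r(1) by linarith
  then show ?thesis using that[OF B i p q ep em] by blast
qed

section \<open>Crossings of the edge e_0\<close>

context hyperideal
begin

definition geod :: "(real \<Rightarrow> complex) \<Rightarrow> complex \<Rightarrow> complex \<Rightarrow> bool" where
  "geod c \<xi>m \<xi>p \<longleftrightarrow> is_geodesic c \<and> geod_ends c \<xi>m \<xi>p \<and> \<xi>m \<in> \<Lambda> \<and> \<xi>p \<in> \<Lambda>"

lemma geodD:
  assumes "geod c \<xi>m \<xi>p"
  shows "is_geodesic c" "geod_ends c \<xi>m \<xi>p" "\<xi>m \<in> \<Lambda>" "\<xi>p \<in> \<Lambda>" "Im (c t) > 0"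
  using assms unfolding geod_def is_geodesic_def by auto

lemma geod_reverse:
  assumes "geod c \<xi>m \<xi>p" shows "geod (\<lambda>t. c (- t)) \<xi>p \<xi>m"
proof -
  have "\<bar>- s - - t\<bar> = \<bar>s - t\<bar>" for s t :: real by simp
  then show ?thesis using assms unfolding geod_def is_geodesic_def geod_ends_def
    by (auto simp: filterlim_at_bot_mirror)
qed

lemma geod_act:
  assumes g: "geod c \<xi>m \<xi>p" shows "geod (\<lambda>t. act ws (c t)) (bact ws \<xi>m) (bact ws \<xi>p)"
proof -
  have im: "Im (c t) > 0" for t using geodD(5)[OF g] .
  have cn: "cayley (c t) \<in> cball 0 1" for t using cayley_norm[OF im, of t] by (simp add: less_imp_le)
  have "((\<lambda>t. bact ws (cayley (c t))) \<longlongrightarrow> bact ws \<xi>) F"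
    if "((\<lambda>t. cayley (c t)) \<longlongrightarrow> \<xi>) F" "\<xi> \<in> \<Lambda>" for \<xi> F
    by (rule continuous_on_tendsto_compose[OF bact_cont that(1)]) (use that(2) cn in simp_all)
  then show ?thesis using g im unfolding geod_def is_geodesic_def geod_ends_def hdist_chd
    by (simp add: act_Im act_chd cayley_act limit_bact)
qed

lemma geod_chd: "geod c \<xi>m \<xi>p \<Longrightarrow> chd (c s) (c t) = cosh (s - t)"
  by (rule is_geodesic_chd[OF geodD(1)])

definition m0 :: real where "m0 = (SOME m. m > 0 \<and> (\<forall>\<xi>\<in>\<Lambda>. \<bar>Im \<xi>\<bar> \<ge> m))"

lemma m0: "m0 > 0" "\<xi> \<in> \<Lambda> \<Longrightarrow> \<bar>Im \<xi>\<bar> \<ge> m0"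
proof -
  have "m0 > 0 \<and> (\<forall>\<xi>\<in>\<Lambda>. \<bar>Im \<xi>\<bar> \<ge> m0)"
    unfolding m0_def by (rule someI_ex[OF limit_Im_bound])
  then show "m0 > 0" "\<xi> \<in> \<Lambda> \<Longrightarrow> \<bar>Im \<xi>\<bar> \<ge> m0" by auto
qed

definition crossing :: "(real \<Rightarrow> complex) \<Rightarrow> complex \<Rightarrow> complex \<Rightarrow> real \<Rightarrow> bool" where
  "crossing c \<xi>m \<xi>p \<tau> \<longleftrightarrow> geod c \<xi>m \<xi>p \<and> sd \<xi>m = (\<not> sd \<xi>p) \<and> slope (c \<tau>) = 0"

lemma same_side:
  assumes g: "geod c \<xi>m \<xi>p" and s: "sd \<xi>m = sd \<xi>p"
  shows "sg (sd \<xi>p) * slope (c t) > 0"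
proof -
  obtain u v p q where 1: "\<And>t. slope (c t) = u * exp t + v * exp (-t)" "p > 0" "q > 0"
    "Im \<xi>p = - 2 * u / p" "Im \<xi>m = - 2 * v / q"
    using geodesic_slope[OF geodD(1,2)[OF g]] by metis
  have "sg (sd \<xi>p) * u > 0" "sg (sd \<xi>p) * v > 0"
    using sd_sg[of \<xi>p] sd_sg[of \<xi>m] geodD(3,4)[OF g] 1(2-) s
    by (auto simp: mult_less_0_iff zero_less_mult_iff divide_less_0_iff zero_less_divide_iff)
  then have "sg (sd \<xi>p) * u * exp t > 0" "sg (sd \<xi>p) * v * exp (-t) > 0" by auto
  then show ?thesis unfolding 1(1) distrib_left mult.assoc by linarith
qed

text \<open>With ends on opposite sides, \<open>slope\<close> is up to sign u exp t - v exp (-t)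
  with u, v > 0, so its only zero is ln (v / u) / 2. There both terms are at most 1 because u v
  \<le> 1, and the gap \<open>m0\<close> bounds p and q by multiples of u and v; hence the crossing
  point is close to i.\<close>

lemma crossing_props:
  assumes g: "geod c \<xi>m \<xi>p" and s: "sd \<xi>m = (\<not> sd \<xi>p)"
  shows "\<exists>\<tau>. crossing c \<xi>m \<xi>p \<tau> \<and> chd (c \<tau>) \<i> \<le> 2 / m0 \<and>
    (\<forall>t<\<tau>. sg (sd \<xi>p) * slope (c t) < 0) \<and> (\<forall>t>\<tau>. sg (sd \<xi>p) * slope (c t) > 0)"
proof -
  obtain u' v' p q where 1: "\<And>t. slope (c t) = u' * exp t + v' * exp (-t)"
    "\<And>t. 2 * chd (c t) \<i> = p * exp t + q * exp (-t)" "p > 0" "q > 0"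
    "Im \<xi>p = - 2 * u' / p" "Im \<xi>m = - 2 * v' / q" "- 2 * u' * v' \<le> 1"
    using geodesic_slope[OF geodD(1,2)[OF g]] by metis
  define u where "u = sg (sd \<xi>p) * u'"
  define v where "v = - sg (sd \<xi>p) * v'"
  have u: "u > 0" and v: "v > 0"
    using sd_sg[of \<xi>p] sd_sg[of \<xi>m] geodD(3,4)[OF g] 1(3-6) s
    by (auto simp: u_def v_def mult_less_0_iff zero_less_mult_iff divide_less_0_iff zero_less_divide_iff)
  have uv: "u * v = - u' * v'" by (cases "sd \<xi>p") (auto simp: u_def v_def)
  have sl: "sg (sd \<xi>p) * slope (c t) = u * exp t - v * exp (-t)" for t
    unfolding 1(1) u_def v_def by (simp add: algebra_simps)
  have au: "\<bar>u'\<bar> = u" "\<bar>v'\<bar> = v" using u v unfolding u_def v_def by (cases "sd \<xi>p"; simp)+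
  have pq: "p * m0 \<le> 2 * u" "q * m0 \<le> 2 * v"
    using m0(2)[OF geodD(4)[OF g]] m0(2)[OF geodD(3)[OF g]] 1(3-6) au
    by (simp_all add: abs_mult field_simps)
  define \<tau> where "\<tau> = ln (v / u) / 2"
  have "exp (\<tau> + \<tau>) = v / u" unfolding \<tau>_def using u v by simp
  then have "u * (exp \<tau> * exp \<tau>) = v" using u unfolding exp_add by simp
  then have e: "u * exp \<tau> = v * exp (- \<tau>)" by (auto simp: exp_minus)
  have lt: "u * exp t - v * exp (-t) < 0" if "t < \<tau>" for t
  proof -
    have "u * exp t < u * exp \<tau>" "v * exp (-\<tau>) < v * exp (-t)" using u v that by auto
    then show ?thesis using e by linarith
  qed
  have gt: "u * exp t - v * exp (-t) > 0" if "t > \<tau>" for t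
  proof -
    have "u * exp \<tau> < u * exp t" "v * exp (-t) < v * exp (-\<tau>)" using u v that by auto
    then show ?thesis using e by linarith
  qed
  have "(u * exp \<tau>) * (u * exp \<tau>) = (u * exp \<tau>) * (v * exp (- \<tau>))" using e by simp
  also have "\<dots> = u * v" by (simp add: exp_minus)
  finally have "(u * exp \<tau>)^2 \<le> 1^2" using uv 1(7) by (simp add: power2_eq_square)
  then have le1: "u * exp \<tau> \<le> 1" by (rule power2_le_imp_le) simp
  have "2 * chd (c \<tau>) \<i> * m0 = p * m0 * exp \<tau> + q * m0 * exp (-\<tau>)"
    unfolding 1(2) by (simp add: algebra_simps)
  also have "\<dots> \<le> 2 * u * exp \<tau> + 2 * v * exp (-\<tau>)"
    using pq by (intro add_mono mult_right_mono) auto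
  also have "\<dots> \<le> 4" using e le1 by simp
  finally have "chd (c \<tau>) \<i> \<le> 2 / m0" using m0(1) by (simp add: field_simps)
  moreover have "slope (c \<tau>) = 0" using sl[of \<tau>] e by (cases "sd \<xi>p") auto
  ultimately show ?thesis using lt gt g s unfolding crossing_def sl by blast
qed

definition "D0 = 2 / m0"

lemma crossing_bound:
  assumes "crossing c \<xi>m \<xi>p \<tau>"
  shows "chd (c \<tau>) \<i> \<le> D0" "t < \<tau> \<longleftrightarrow> sg (sd \<xi>p) * slope (c t) < 0"
proof -
  obtain \<tau>' where t: "chd (c \<tau>') \<i> \<le> 2 / m0"
    "\<forall>t<\<tau>'. sg (sd \<xi>p) * slope (c t) < 0" "\<forall>t>\<tau>'. sg (sd \<xi>p) * slope (c t) > 0" "slope (c \<tau>') = 0"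
    using crossing_props[of c \<xi>m \<xi>p] assms unfolding crossing_def by blast
  have "\<tau>' = \<tau>" using t(2,3) assms unfolding crossing_def
    by (metis less_irrefl linorder_neqE_linordered_idom mult_zero_right)
  then show "chd (c \<tau>) \<i> \<le> D0" using t(1) by (simp add: D0_def)
  show "t < \<tau> \<longleftrightarrow> sg (sd \<xi>p) * slope (c t) < 0"
    using t(2,3,4) unfolding \<open>\<tau>' = \<tau>\<close>
    by (metis less_asym less_irrefl linorder_neqE_linordered_idom mult_zero_right)
qed

lemma crossing_exists:
  assumes "geod c \<xi>m \<xi>p" "sd \<xi>m = (\<not> sd \<xi>p)" obtains \<tau> where "crossing c \<xi>m \<xi>p \<tau>"
  using crossing_props[OF assms] by blast

lemma crossing_reverse: "crossing c \<xi>m \<xi>p \<tau> \<Longrightarrow> crossing (\<lambda>t. c (- t)) \<xi>p \<xi>m (- \<tau>)"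
  unfolding crossing_def using geod_reverse by auto

definition "D1 = (\<Sum>l\<in>UNIV. chd (act (lw l) \<i>) \<i>)"

lemma letter_D1: "chd (act (lw l) \<i>) \<i> \<le> D1"
proof -
  have "chd (act (lw l) \<i>) \<i> \<ge> 0" for l using chd_ge1[OF act_Im[of \<i> "lw l"], of \<i>] by simp
  then show ?thesis unfolding D1_def by (intro member_le_sum) auto
qed

text \<open>\<open>K0\<close> bounds the delay between consecutive crossings: two quasi triangle
  inequalities bound its cosh by 4 D0^2 D1, and x \<le> 2 cosh x gives the factor 8.
  \<open>\<delta>0\<close> is the lower bound for the delay, and \<open>DD\<close> bounds the cosh
  of the distance from i within time \<open>K0\<close> of a crossing.\<close>

definition "K0 = 8 * D0 * D0 * D1"
definition "\<delta>0 = arsinh shift"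
definition "DD = 2 * cosh K0 * D0"

lemma \<delta>0_pos: "\<delta>0 > 0" using shift_pos by (simp add: \<delta>0_def)

text \<open>Removing the first letter of the head exchanges the sides of both ends. The old crossing
  point lands on the side of the new tail, at slope at least \<open>shift\<close> in modulus, so the
  new crossing comes later by at least arsinh \<open>shift\<close>. Both crossing points are near i
  and the letter moves i by a bounded amount, which gives the upper bound.\<close>

lemma crossing_step:
  assumes c: "crossing c \<xi>m \<xi>p \<tau>"
  obtains \<tau>' where "crossing (\<lambda>t. act (lw (linv (lt \<xi>p))) (c t)) (bact (lw (linv (lt \<xi>p))) \<xi>m) (sh \<xi>p) \<tau>'"
    "\<tau> + \<delta>0 \<le> \<tau>'" "\<tau>' \<le> \<tau> + K0"
proof -
  let ?l = "linv (lt \<xi>p)"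
  let ?c = "\<lambda>t. act (lw ?l) (c t)"
  have g: "geod c \<xi>m \<xi>p" and s: "sd \<xi>m = (\<not> sd \<xi>p)" and z: "slope (c \<tau>) = 0"
    using c by (auto simp: crossing_def)
  have im: "Im (c t) > 0" for t using geodD(5)[OF g] .
  have p: "\<xi>p \<in> \<Lambda>" and m: "\<xi>m \<in> \<Lambda>" using geodD[OF g] by auto
  have g': "geod ?c (bact (lw ?l) \<xi>m) (sh \<xi>p)" unfolding sh_def by (rule geod_act[OF g])
  have sp: "sd (sh \<xi>p) = (\<not> sd \<xi>p)" by (rule ltI(2)[OF p])
  have sm: "sd (bact (lw ?l) \<xi>m) = sd \<xi>p" using sd_bact_lw[of \<xi>m ?l] m s ltI(1)[OF p] by simp
  obtain \<tau>' where c': "crossing ?c (bact (lw ?l) \<xi>m) (sh \<xi>p) \<tau>'"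
    using crossing_exists[OF g'] sp sm by auto
  have sl: "sg (sd \<xi>p) * slope (?c \<tau>) \<ge> shift"
    using slope_letter[OF im, of ?l \<tau>] z ltI(1)[OF p] by simp
  then have "sg (sd (sh \<xi>p)) * slope (?c \<tau>) < 0" using sp shift_pos by simp
  then have lt: "\<tau> < \<tau>'" using crossing_bound(2)[OF c'] by simp
  have "1 + (slope (?c \<tau>))^2 \<le> (cosh (\<tau> - \<tau>'))^2"
    using chd_slope_zero[of "?c \<tau>" "?c \<tau>'"] act_Im[OF im] c' geod_chd[OF g']
    unfolding crossing_def by auto
  moreover have "shift^2 \<le> (slope (?c \<tau>))^2"
  proof -
    have "shift \<le> \<bar>slope (?c \<tau>)\<bar>" using sl by (cases "sd \<xi>p") auto
    then show ?thesis using shift_pos power_mono[of shift "\<bar>slope (?c \<tau>)\<bar>" 2] by simp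
  qed
  ultimately have "shift^2 \<le> (sinh (\<tau>' - \<tau>))^2"
    using sinh_minus[of "\<tau>' - \<tau>"] by (simp add: cosh_square_eq)
  then have "shift \<le> sinh (\<tau>' - \<tau>)" by (rule power2_le_imp_le) (use lt in simp)
  then have "sinh \<delta>0 \<le> sinh (\<tau>' - \<tau>)" by (simp add: \<delta>0_def)
  then have l1: "\<tau> + \<delta>0 \<le> \<tau>'" by simp
  have D0: "D0 > 0" using m0 by (simp add: D0_def)
  have "D1 \<ge> 1" using letter_D1[of ?l] chd_ge1[OF act_Im, of \<i> \<i> "lw ?l"] by simp
  then have D01: "D0 * D1 \<ge> 0" using D0 by simp
  have "chd (?c \<tau>) \<i> \<le> 2 * chd (?c \<tau>) (act (lw ?l) \<i>) * chd (act (lw ?l) \<i>) \<i>"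
    by (rule chd_quasi_triangle') (auto intro: act_Im im)
  also have "\<dots> = 2 * chd (c \<tau>) \<i> * chd (act (lw ?l) \<i>) \<i>" using act_chd[OF im, of \<i>] by simp
  also have "\<dots> \<le> 2 * D0 * D1"
    using crossing_bound(1)[OF c] letter_D1[of ?l] chd_ge1[OF im, of \<i>] chd_ge1[OF act_Im, of \<i> \<i>] D0
    by (intro mult_mono) (auto intro: order_trans[OF zero_le_one])
  finally have b: "chd (?c \<tau>) \<i> \<le> 2 * D0 * D1" .
  have "cosh (\<tau> - \<tau>') = chd (?c \<tau>) (?c \<tau>')" by (rule geod_chd[OF g', symmetric])
  also have "\<dots> \<le> 2 * chd (?c \<tau>) \<i> * chd \<i> (?c \<tau>')"
    by (rule chd_quasi_triangle) (auto intro: act_Im im)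
  also have "\<dots> \<le> 2 * (2 * D0 * D1) * D0"
    using crossing_bound(1)[OF c'] b chd_ge1[OF act_Im[OF im], of \<i>] D0 D01
    by (intro mult_mono) (auto simp: chd_commute intro: order_trans[OF zero_le_one])
  finally have "cosh (\<tau>' - \<tau>) \<le> 2 * (2 * D0 * D1) * D0"
    by (metis cosh_minus minus_diff_eq)
  moreover have "\<tau>' - \<tau> \<le> 2 * cosh (\<tau>' - \<tau>)"
  proof -
    have "1 + (\<tau>' - \<tau>) \<le> exp (\<tau>' - \<tau>)" by (rule exp_ge_add_one_self)
    also have "\<dots> \<le> 2 * cosh (\<tau>' - \<tau>)" by (simp add: cosh_field_def)
    finally show ?thesis by simp
  qed
  ultimately have "\<tau>' \<le> \<tau> + K0" unfolding K0_def by (simp add: algebra_simps)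
  then show ?thesis using that c' l1 by blast
qed

lemma crossing_near:
  assumes c: "crossing c \<xi>m \<xi>p \<tau>" and t: "\<bar>t - \<tau>\<bar> \<le> K0"
  shows "chd (c t) \<i> \<le> DD"
proof -
  have g: "geod c \<xi>m \<xi>p" using c by (simp add: crossing_def)
  have im: "Im (c t) > 0" for t using geodD(5)[OF g] .
  have "chd (c t) \<i> \<le> 2 * chd (c t) (c \<tau>) * chd (c \<tau>) \<i>"
    by (rule chd_quasi_triangle') (use im in auto)
  also have "\<dots> \<le> 2 * cosh K0 * D0"
  proof -
    have "cosh \<bar>t - \<tau>\<bar> \<le> cosh K0" using t by (intro cosh_real_nonneg_le_iff[THEN iffD2]) auto
    then show ?thesis using crossing_bound(1)[OF c] chd_ge1[OF im, of \<i> \<tau>] geod_chd[OF g, of t \<tau>]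
      by (intro mult_mono) (auto intro: order_trans[OF zero_le_one] cosh_real_nonneg)
  qed
  finally show ?thesis by (simp add: DD_def)
qed

section \<open>Itineraries along a geodesic\<close>

fun its :: "nat \<Rightarrow> complex \<Rightarrow> (bool \<times> bool) list" where
  "its 0 \<xi> = []"
| "its (Suc n) \<xi> = lt \<xi> # its n (sh \<xi>)"

lemma length_its [simp]: "length (its n \<xi>) = n"
  by (induction n arbitrary: \<xi>) auto

lemma funpow_sh_limit: "\<xi> \<in> \<Lambda> \<Longrightarrow> (sh ^^ n) \<xi> \<in> \<Lambda>"
  by (induction n) (auto simp: sh_limit)

lemma alternating_its: "\<xi> \<in> \<Lambda> \<Longrightarrow> alternating (sd \<xi>) (its n \<xi>)"
proof (induction n arbitrary: \<xi>)
  case (Suc n)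
  then show ?case using Suc.IH[OF sh_limit[OF Suc.prems]] ltI[OF Suc.prems] by (simp add: its.simps)
qed simp

fun winv :: "(bool \<times> bool) list \<Rightarrow> bool list" where
  "winv [] = []"
| "winv (l # L) = winv L @ lw (linv l)"

text \<open>The lower bound \<delta>0 on the delays lets the induction on n reach t. The upper bound
  \<open>K0\<close> makes some crossing fall within \<open>K0\<close> of t and forces the number k
  of removed letters to grow linearly in t - \<tau>.\<close>

lemma crossing_forward:
  "crossing c \<xi>m \<xi>p \<tau> \<Longrightarrow> \<tau> \<le> t \<Longrightarrow> t < \<tau> + real n * \<delta>0 \<Longrightarrow> \<exists>k \<tau>'.
     crossing (\<lambda>t. act (winv (its k \<xi>p)) (c t)) (bact (winv (its k \<xi>p)) \<xi>m) (bact (winv (its k \<xi>p)) \<xi>p) \<tau>' \<and>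
     \<bar>t - \<tau>'\<bar> \<le> K0 \<and> t - \<tau> \<le> (real k + 1) * K0"
proof (induction n arbitrary: c \<xi>m \<xi>p \<tau>)
  case (Suc n)
  show ?case
  proof (cases "t \<le> \<tau> + K0")
    case True
    then show ?thesis using Suc.prems by (intro exI[of _ 0] exI[of _ \<tau>]) auto
  next
    case False
    let ?w = "lw (linv (lt \<xi>p))"
    obtain \<tau>' where c': "crossing (\<lambda>t. act ?w (c t)) (bact ?w \<xi>m) (sh \<xi>p) \<tau>'"
      "\<tau> + \<delta>0 \<le> \<tau>'" "\<tau>' \<le> \<tau> + K0" using crossing_step[OF Suc.prems(1)] by metis
    have "\<tau>' \<le> t" "t < \<tau>' + n * \<delta>0" using False c' Suc.prems(3) by (auto simp: algebra_simps)
    then obtain k \<tau>'' where k: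
      "crossing (\<lambda>t. act (winv (its k (sh \<xi>p))) (act ?w (c t))) (bact (winv (its k (sh \<xi>p))) (bact ?w \<xi>m))
         (bact (winv (its k (sh \<xi>p))) (sh \<xi>p)) \<tau>''"
      "\<bar>t - \<tau>''\<bar> \<le> K0" "t - \<tau>' \<le> (real k + 1) * K0"
      using Suc.IH[OF c'(1)] by blast
    have g: "geod c \<xi>m \<xi>p" using Suc.prems(1) by (simp add: crossing_def)
    have eq: "winv (its (Suc k) \<xi>p) = winv (its k (sh \<xi>p)) @ ?w" by (simp add: its.simps)
    have "crossing (\<lambda>t. act (winv (its (Suc k) \<xi>p)) (c t)) (bact (winv (its (Suc k) \<xi>p)) \<xi>m)
         (bact (winv (its (Suc k) \<xi>p)) \<xi>p) \<tau>''"
      using k(1) geodD[OF g] unfolding eq sh_def[of \<xi>p] by (simp add: act_append bact_append)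
    moreover have "t - \<tau> \<le> (real (Suc k) + 1) * K0" using k(3) c'(3) by (simp add: algebra_simps)
    ultimately show ?thesis using k(2) by blast
  qed
qed simp

lemma crossing_forward':
  assumes "crossing c \<xi>m \<xi>p \<tau>" "\<tau> \<le> t"
  obtains k \<tau>' where
     "crossing (\<lambda>t. act (winv (its k \<xi>p)) (c t)) (bact (winv (its k \<xi>p)) \<xi>m) (bact (winv (its k \<xi>p)) \<xi>p) \<tau>'"
     "\<bar>t - \<tau>'\<bar> \<le> K0" "t - \<tau> \<le> (real k + 1) * K0"
proof -
  obtain n :: nat where "t - \<tau> < n * \<delta>0" using \<delta>0_pos reals_Archimedean3 by blast
  then show ?thesis using crossing_forward[OF assms, of n] that by auto
qed

text \<open>Ends on the same side with different first letters are separated by removing the first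
  letter of the head. With equal first letters, removing it lowers |slope| at time 0 by at least
  \<open>shift\<close>, so this happens at most n times.\<close>

lemma crossing_first:
  "geod c \<xi>m \<xi>p \<Longrightarrow> \<bar>slope (c 0)\<bar> \<le> real n * shift \<Longrightarrow>
    \<exists>ws \<tau>. crossing (\<lambda>t. act ws (c t)) (bact ws \<xi>m) (bact ws \<xi>p) \<tau>"
proof (induction n arbitrary: c \<xi>m \<xi>p)
  case 0
  have "sd \<xi>m = (\<not> sd \<xi>p)" using same_side[OF 0(1), of 0] 0(2) by auto
  then obtain \<tau> where "crossing c \<xi>m \<xi>p \<tau>" using crossing_exists[OF 0(1)] by blast
  then show ?case by (intro exI[of _ "[]"] exI[of _ \<tau>]) simp
next
  case (Suc n)
  note g = Suc.prems(1)
  have p: "\<xi>p \<in> \<Lambda>" and m: "\<xi>m \<in> \<Lambda>" and im: "Im (c t) > 0" for t using geodD[OF g] by auto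
  show ?case
  proof (cases "sd \<xi>m = sd \<xi>p")
    case False
    then obtain \<tau> where "crossing c \<xi>m \<xi>p \<tau>" using crossing_exists[OF g] by blast
    then show ?thesis by (intro exI[of _ "[]"] exI[of _ \<tau>]) simp
  next
    case True
    let ?l = "linv (lt \<xi>p)"
    let ?c = "\<lambda>t. act (lw ?l) (c t)"
    have g': "geod ?c (bact (lw ?l) \<xi>m) (bact (lw ?l) \<xi>p)" by (rule geod_act[OF g])
    have sp: "sd (bact (lw ?l) \<xi>p) = (\<not> sd \<xi>p)" using ltI(2)[OF p] unfolding sh_def .
    show ?thesis
    proof (cases "lt \<xi>m = lt \<xi>p")
      case False
      then have l: "lt \<xi>m = ?l" using ltI(1)[OF p] ltI(1)[OF m] True
        by (auto simp: prod_eq_iff linv_def)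
      have "bact (lw ?l) \<xi>m = bact (lw ?l) (bact (lw ?l) (sh \<xi>m))" using bact_sh[OF m] l by simp
      also have "\<dots> = bact (lw (lt \<xi>p)) (sh \<xi>m)" using bact_sq[of "sh \<xi>m" ?l] sh_limit[OF m] by simp
      finally have "sd (bact (lw ?l) \<xi>m) = sd \<xi>p"
        using sd_bact_lw[OF sh_limit[OF m], of "lt \<xi>p"] ltI[OF p] ltI[OF m] True by simp
      then obtain \<tau> where "crossing ?c (bact (lw ?l) \<xi>m) (bact (lw ?l) \<xi>p) \<tau>"
        using crossing_exists[OF g'] sp by auto
      then show ?thesis by blast
    next
      case lt: True
      have sm: "sd (bact (lw ?l) \<xi>m) = (\<not> sd \<xi>p)" using ltI(2)[OF m] lt True unfolding sh_def by simp
      have "sg (sd \<xi>p) * slope (?c 0) < 0" using same_side[OF g', of 0] sp sm by simp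
      moreover have "sg (sd \<xi>p) * slope (c 0) \<ge> - (sg (sd \<xi>p) * slope (?c 0)) + shift"
        using slope_letter[OF act_Im[OF im, of "lw ?l" 0], of "lt \<xi>p"] calculation act_linv'[OF im, of "lt \<xi>p" 0]
          ltI(1)[OF p] by simp
      ultimately have "\<bar>slope (?c 0)\<bar> \<le> n * shift"
        using Suc.prems(2) shift_pos by (cases "sd \<xi>p") (auto simp: algebra_simps)
      then obtain ws \<tau> where "crossing (\<lambda>t. act ws (?c t)) (bact ws (bact (lw ?l) \<xi>m)) (bact ws (bact (lw ?l) \<xi>p)) \<tau>"
        using Suc.IH[OF g'] by blast
      then have "crossing (\<lambda>t. act (ws @ lw ?l) (c t)) (bact (ws @ lw ?l) \<xi>m) (bact (ws @ lw ?l) \<xi>p) \<tau>"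
        using p m im by (simp add: act_append bact_append)
      then show ?thesis by blast
    qed
  qed
qed

text \<open>For times before the crossing that was found, the forward argument is applied to the
  reversed geodesic, with the letters of the tail.\<close>

lemma crossing_at:
  assumes g: "geod c \<xi>m \<xi>p"
  shows "\<exists>ws \<tau>. crossing (\<lambda>t. act ws (c t)) (bact ws \<xi>m) (bact ws \<xi>p) \<tau> \<and> \<bar>s - \<tau>\<bar> \<le> K0"
proof -
  have p: "\<xi>p \<in> \<Lambda>" and m: "\<xi>m \<in> \<Lambda>" and im: "Im (c t) > 0" for t using geodD[OF g] by auto
  obtain n :: nat where "\<bar>slope (c 0)\<bar> \<le> n * shift"
    using shift_pos reals_Archimedean3 less_imp_le by metis
  then obtain ws \<tau> where c: "crossing (\<lambda>t. act ws (c t)) (bact ws \<xi>m) (bact ws \<xi>p) \<tau>"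
    using crossing_first[OF g] by blast
  show ?thesis
  proof (cases "\<tau> \<le> s")
    case True
    from crossing_forward'[OF c this] obtain k \<tau>' where
     k: "crossing (\<lambda>t. act (winv (its k (bact ws \<xi>p))) (act ws (c t)))
       (bact (winv (its k (bact ws \<xi>p))) (bact ws \<xi>m)) (bact (winv (its k (bact ws \<xi>p))) (bact ws \<xi>p)) \<tau>'"
     "\<bar>s - \<tau>'\<bar> \<le> K0" by metis
    let ?u = "winv (its k (bact ws \<xi>p)) @ ws"
    have "crossing (\<lambda>t. act ?u (c t)) (bact ?u \<xi>m) (bact ?u \<xi>p) \<tau>'"
      using k(1) p m im by (simp add: act_append bact_append)
    then show ?thesis using k(2) by blast
  next
    case False
    have "- \<tau> \<le> - s" using False by simp
    from crossing_forward'[OF crossing_reverse[OF c] this] obtain k \<tau>' where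
     k: "crossing (\<lambda>t. act (winv (its k (bact ws \<xi>m))) (act ws (c (- t))))
       (bact (winv (its k (bact ws \<xi>m))) (bact ws \<xi>p)) (bact (winv (its k (bact ws \<xi>m))) (bact ws \<xi>m)) \<tau>'"
     "\<bar>- s - \<tau>'\<bar> \<le> K0" by metis
    let ?u = "winv (its k (bact ws \<xi>m)) @ ws"
    have "crossing (\<lambda>t. act ?u (c t)) (bact ?u \<xi>m) (bact ?u \<xi>p) (- \<tau>')"
      using crossing_reverse[OF k(1)] p m im by (simp add: act_append bact_append)
    moreover have "\<bar>s - - \<tau>'\<bar> \<le> K0" using k(2) by linarith
    ultimately show ?thesis by blast
  qed
qed

text \<open>Of the two extra units of \<open>K0\<close>, one pays for the gap between s and its
  crossing and one for the gap between t and its crossing.\<close>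

lemma geodesic_itinerary:
  assumes g: "geod c \<xi>m \<xi>p" and st: "s \<le> t"
  obtains ws k where "chd (act ws (c s)) \<i> \<le> DD"
    "chd (act (winv (its k (bact ws \<xi>p))) (act ws (c t))) \<i> \<le> DD" "t - s \<le> (real k + 2) * K0"
proof -
  obtain ws \<tau> where c: "crossing (\<lambda>t. act ws (c t)) (bact ws \<xi>m) (bact ws \<xi>p) \<tau>" "\<bar>s - \<tau>\<bar> \<le> K0"
    using crossing_at[OF g] by blast
  have s: "chd (act ws (c s)) \<i> \<le> DD" by (rule crossing_near[OF c])
  show ?thesis
  proof (cases "\<tau> \<le> t")
    case True
    from crossing_forward'[OF c(1) this] obtain k \<tau>' where
     k: "crossing (\<lambda>t. act (winv (its k (bact ws \<xi>p))) (act ws (c t)))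
       (bact (winv (its k (bact ws \<xi>p))) (bact ws \<xi>m)) (bact (winv (its k (bact ws \<xi>p))) (bact ws \<xi>p)) \<tau>'"
     "\<bar>t - \<tau>'\<bar> \<le> K0" "t - \<tau> \<le> (real k + 1) * K0" by metis
    have "t - s \<le> (real k + 2) * K0" using k(3) c(2) by (simp add: algebra_simps)
    then show ?thesis by (rule that[OF s crossing_near[OF k(1,2)]])
  next
    case False
    then have "\<bar>t - \<tau>\<bar> \<le> K0" "t - s \<le> (0 + 2) * K0" using st c(2) by auto
    then show ?thesis using that[OF s, of 0] crossing_near[OF c(1), of t] by simp
  qed
qed

end

section \<open>Cone-preserving representations\<close>

definition pcoef :: "'a::real_inner \<Rightarrow> 'a \<Rightarrow> real" where "pcoef u y = (u \<bullet> y) / (u \<bullet> u)"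

text \<open>The round metric of projective space on a tangent vector represented by the pair (u, y):
  it does not change when the pair is rescaled or a multiple of u is added to y.\<close>

definition pn :: "'a::real_inner \<Rightarrow> 'a \<Rightarrow> real" where
  "pn u y = norm (y - pcoef u y *\<^sub>R u) / norm u"

text \<open>The orthogonal projection minimises the distance from y to the line of u, so any
  convenient coefficient r gives an upper bound.\<close>

lemma pn_le:
  assumes "u \<noteq> 0" shows "pn u y \<le> norm (y - r *\<^sub>R u) / norm u"
proof -
  let ?p = "y - pcoef u y *\<^sub>R u"
  have "u \<bullet> ?p = 0" using assms by (simp add: pcoef_def inner_diff_right)
  then have o: "?p \<bullet> u = 0" by (simp add: inner_commute)
  have eq: "y - r *\<^sub>R u = ?p + (pcoef u y - r) *\<^sub>R u" by (simp add: algebra_simps)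
  have "(norm (y - r *\<^sub>R u))^2 = (norm ?p)^2 + (norm ((pcoef u y - r) *\<^sub>R u))^2"
    by (subst eq, subst norm_add_Pythagorean) (simp_all only: orthogonal_def inner_scaleR_right o mult_zero_right)
  then have "(norm ?p)^2 \<le> (norm (y - r *\<^sub>R u))^2" by simp
  then have "norm ?p \<le> norm (y - r *\<^sub>R u)" by (rule power2_le_imp_le) simp
  then show ?thesis unfolding pn_def by (rule divide_right_mono) simp
qed

lemma pn_nonneg: "pn u y \<ge> 0" by (simp add: pn_def)

lemma pn_scale:
  assumes "c \<noteq> 0" shows "pn (c *\<^sub>R u) (c *\<^sub>R y + t *\<^sub>R u) = pn u y"
proof (cases "u = 0")
  case True then show ?thesis by (simp add: pn_def)
next
  case False
  then have uu: "u \<bullet> u \<noteq> 0" by simp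
  have "pcoef (c *\<^sub>R u) (c *\<^sub>R y + t *\<^sub>R u) = pcoef u y + t / c"
    using assms uu by (simp add: pcoef_def inner_add_right field_simps)
  then have "c *\<^sub>R y + t *\<^sub>R u - pcoef (c *\<^sub>R u) (c *\<^sub>R y + t *\<^sub>R u) *\<^sub>R c *\<^sub>R u = c *\<^sub>R (y - pcoef u y *\<^sub>R u)"
    using assms by (simp add: algebra_simps)
  then show ?thesis using assms by (simp add: pn_def)
qed

lemma pn_scale': "c \<noteq> 0 \<Longrightarrow> pn (c *\<^sub>R u) (c *\<^sub>R y) = pn u y"
  using pn_scale[of c u y 0] by simp

lemma pn_eq_0: "u \<noteq> 0 \<Longrightarrow> pn u y = 0 \<longleftrightarrow> (\<exists>t. y = t *\<^sub>R u)"
  by (auto simp: pn_def pcoef_def)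

lemma pn_triangle: "pn u (y + z) \<le> pn u y + pn u z"
proof -
  have "y + z - pcoef u (y + z) *\<^sub>R u = (y - pcoef u y *\<^sub>R u) + (z - pcoef u z *\<^sub>R u)"
    by (simp add: pcoef_def inner_add_right add_divide_distrib algebra_simps)
  then show ?thesis unfolding pn_def add_divide_distrib[symmetric]
    by (metis divide_right_mono norm_ge_zero norm_triangle_ineq)
qed

lemma pn_homogeneous: "pn u (r *\<^sub>R y) = \<bar>r\<bar> * pn u y"
proof -
  have "r *\<^sub>R y - pcoef u (r *\<^sub>R y) *\<^sub>R u = r *\<^sub>R (y - pcoef u y *\<^sub>R u)"
    by (simp add: pcoef_def algebra_simps)
  then show ?thesis by (simp add: pn_def)
qed

lemma matrix_bound: "\<exists>K>0. \<forall>x. norm ((M::real^'n^'m) *v x) \<le> K * norm x"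
  using linear_bounded_pos[OF matrix_vector_mul_linear[of M]] by (auto simp: mult.commute)

lemma matrix_inv_both:
  assumes "invertible (M::real^'n^'n)"
  shows "M ** matrix_inv M = mat 1" "matrix_inv M ** M = mat 1"
  using someI_ex[OF assms[unfolded invertible_def]] unfolding matrix_inv_def by auto

lemma matrix_inv_eqI:
  assumes "(M::real^'n^'n) ** N = mat 1" shows "matrix_inv M = N"
proof -
  have "invertible M" using assms by (simp add: invertible_right_inverse) blast
  then have "matrix_inv M ** (M ** N) = N" by (simp add: matrix_mul_assoc matrix_inv_both)
  then show ?thesis using assms by simp
qed

lemma invertible_mult_vec: "invertible (M::real^'n^'n) \<Longrightarrow> matrix_inv M *v (M *v x) = x"
  by (simp add: matrix_vector_mul_assoc matrix_inv_both(2))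

lemma invertible_vec_eq_0: "invertible (M::real^'n^'n) \<Longrightarrow> M *v x = 0 \<longleftrightarrow> x = 0"
  using invertible_mult_vec[of M x] by auto

text \<open>The constant is the product of norm bounds for M and its inverse. The maximum with 1
  makes its powers increase with the word length.\<close>

lemma pn_Lipschitz:
  fixes M :: "real^'n^'n"
  assumes M: "invertible M"
  shows "\<exists>K\<ge>1. \<forall>u y. u \<noteq> 0 \<longrightarrow> pn (M *v u) (M *v y) \<le> K * pn u y"
proof -
  obtain K1 where K1: "K1 > 0" "\<And>x. norm (M *v x) \<le> K1 * norm x" using matrix_bound[of M] by blast
  obtain K2 where K2: "K2 > 0" "\<And>x. norm (matrix_inv M *v x) \<le> K2 * norm x"
    using matrix_bound[of "matrix_inv M"] by blast
  have *: "pn (M *v u) (M *v y) \<le> (K1 * K2) * pn u y" if u: "u \<noteq> 0" for u y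
  proof -
    have Mu: "M *v u \<noteq> 0" using u M by (simp add: invertible_vec_eq_0)
    have n: "norm u \<le> K2 * norm (M *v u)" using K2(2)[of "M *v u"] M by (simp add: invertible_mult_vec)
    have "pn (M *v u) (M *v y) \<le> norm (M *v y - pcoef u y *\<^sub>R (M *v u)) / norm (M *v u)"
      by (rule pn_le[OF Mu])
    also have "M *v y - pcoef u y *\<^sub>R (M *v u) = M *v (y - pcoef u y *\<^sub>R u)"
      by (simp add: matrix_vector_mult_diff_distrib matrix_vector_mult_scaleR)
    also have "norm \<dots> / norm (M *v u) \<le> (K1 * norm (y - pcoef u y *\<^sub>R u)) / (norm u / K2)"
      using K1 K2 n u Mu by (intro frac_le) (auto simp: field_simps)
    also have "\<dots> = (K1 * K2) * pn u y" by (simp add: pn_def)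
    finally show ?thesis .
  qed
  have "pn (M *v u) (M *v y) \<le> max 1 (K1 * K2) * pn u y" if "u \<noteq> 0" for u y
    by (rule order_trans[OF *[OF that]]) (intro mult_right_mono pn_nonneg, simp)
  then show ?thesis by (intro exI[of _ "max 1 (K1 * K2)"]) simp
qed

lemma norm_sgn_diff:
  fixes x y :: "'a::real_normed_vector"
  assumes "x \<noteq> 0" "y \<noteq> 0"
  shows "norm (sgn x - sgn y) \<le> 2 * norm (x - y) / norm y"
proof -
  have "sgn x - sgn y = (x - y) /\<^sub>R norm y + (1 / norm x - 1 / norm y) *\<^sub>R x"
    by (simp add: sgn_div_norm algebra_simps divide_inverse)
  also have "norm \<dots> \<le> norm ((x - y) /\<^sub>R norm y) + norm ((1 / norm x - 1 / norm y) *\<^sub>R x)"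
    by (rule norm_triangle_ineq)
  also have "norm ((1 / norm x - 1 / norm y) *\<^sub>R x) = \<bar>norm y - norm x\<bar> / norm y"
    using assms by (simp add: abs_mult[symmetric] field_simps)
  also have "\<dots> \<le> norm (x - y) / norm y"
    by (intro divide_right_mono) (metis abs_minus_commute norm_triangle_ineq3, simp)
  finally show ?thesis by (simp add: divide_inverse mult.commute)
qed

section \<open>Polyhedral cones and ping-pong data\<close>

definition fcone :: "'a::real_inner set \<Rightarrow> 'a set" where "fcone F = {u. \<forall>f\<in>F. f \<bullet> u \<ge> 0}"

lemma closed_cone: "closed (fcone F)"
proof -
  have "fcone F = (\<Inter>f\<in>F. {u. f \<bullet> u \<ge> 0})" by (auto simp: fcone_def)
  then show ?thesis by (simp add: closed_halfspace_ge closed_INT)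
qed

text \<open>The unit vectors of the cone form a compact set, on which a positive function has a
  positive minimum.\<close>

lemma cone_lower_bound:
  fixes g :: "'a::euclidean_space \<Rightarrow> real"
  assumes g: "linear g" and pos: "\<And>u. u \<in> fcone F \<Longrightarrow> u \<noteq> 0 \<Longrightarrow> g u > 0"
  shows "\<exists>c>0. \<forall>u\<in>fcone F. c * norm u \<le> g u"
proof (cases "fcone F \<inter> sphere 0 1 = {}")
  case True
  have "u = 0" if "u \<in> fcone F" for u
  proof (rule ccontr)
    assume "u \<noteq> 0"
    then have "sgn u \<in> fcone F \<inter> sphere 0 1"
      using that by (simp add: fcone_def sgn_div_norm norm_sgn)
    then show False using True by blast
  qed
  then show ?thesis using linear_0[OF g] by (intro exI[of _ 1]) fastforce
next
  case False
  have "compact (fcone F \<inter> sphere 0 1)" by (simp add: closed_Int_compact closed_cone)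
  moreover have "continuous_on (fcone F \<inter> sphere 0 1) g"
    by (rule linear_continuous_on[OF g[unfolded linear_conv_bounded_linear]])
  ultimately obtain w where w: "w \<in> fcone F \<inter> sphere 0 1" "\<And>u. u \<in> fcone F \<inter> sphere 0 1 \<Longrightarrow> g w \<le> g u"
    using continuous_attains_inf[of "fcone F \<inter> sphere 0 1" g] False by blast
  have "g w * norm u \<le> g u" if u: "u \<in> fcone F" for u
  proof (cases "u = 0")
    case True then show ?thesis using linear_0[OF g] by simp
  next
    case False
    have "g w \<le> g (sgn u)" using w(2)[of "sgn u"] u False by (simp add: fcone_def sgn_div_norm norm_sgn)
    also have "\<dots> = g u / norm u" using linear_cmul[OF g] by (simp add: sgn_div_norm divide_inverse mult.commute)
    finally show ?thesis using False by (simp add: field_simps)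
  qed
  moreover have "w \<noteq> 0" using w(1) by force
  then have "g w > 0" using w(1) pos[of w] by blast
  ultimately show ?thesis by blast
qed

lemma mult_vec_foldr: "foldr (\<lambda>l M. f l ** M) (L1 @ L2) (mat 1) *v x
   = foldr (\<lambda>l M. f l ** M) L1 (mat 1) *v (foldr (\<lambda>l M. f l ** M) L2 (mat 1) *v (x::real^'n))"
  by (simp only: foldr_matrix_mult matrix_vector_mul_assoc)

text \<open>Projective ping-pong: a letter sends the closed cone of the other side, without 0, into
  the interior of the cone of its own side. The scalars \<open>e l\<close> select lifts from
  PGL(3,R) for which the image is this cone and not its negative. The condition \<open>sep\<close>
  says that the cones contain no line. The vectors \<open>v \<sigma>\<close> start the approximation
  of the limit map.\<close>

locale cone_rep = hyperideal +
  fixes A B :: "real^3^3" and e :: "bool \<times> bool \<Rightarrow> real"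
    and F :: "bool \<Rightarrow> (real^3) set" and v :: "bool \<Rightarrow> real^3"
  assumes inv: "invertible A" "invertible B"
    and cube: "\<exists>k. k \<noteq> 0 \<and> A ** A ** A = k *\<^sub>R mat 1" "\<exists>k. k \<noteq> 0 \<and> B ** B ** B = k *\<^sub>R mat 1"
    and e: "e l \<noteq> 0" and finF: "finite (F \<sigma>)"
    and sep: "(\<And>f. f \<in> F \<sigma> \<Longrightarrow> f \<bullet> u = 0) \<Longrightarrow> u = 0"
    and cone_map: "u \<in> fcone (F (\<not> fst l)) \<Longrightarrow> u \<noteq> 0 \<Longrightarrow> f \<in> F (fst l)
       \<Longrightarrow> f \<bullet> ((e l *\<^sub>R word_mat A B (lw l)) *v u) > 0"
    and v: "v \<sigma> \<in> fcone (F \<sigma>)" "v \<sigma> \<noteq> 0"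
begin

definition "W ws = word_mat A B ws"
definition "H l = e l *\<^sub>R W (lw l)"
definition "HL L = foldr (\<lambda>l M. H l ** M) L (mat 1)"

lemma HL_simps [simp]: "HL [] *v x = x" "HL (l # L) *v x = H l *v (HL L *v x)"
  by (simp_all add: HL_def matrix_vector_mul_assoc[symmetric])

lemma HL_append: "HL (L1 @ L2) *v x = HL L1 *v (HL L2 *v x)"
  unfolding HL_def by (rule mult_vec_foldr)

lemma W_append: "W (xs @ ys) *v x = W xs *v (W ys *v x)"
  unfolding W_def word_mat_append by (simp add: matrix_vector_mul_assoc)

lemma W_Nil [simp]: "W [] *v x = x" by (simp add: W_def)

lemma invertible_W: "invertible (W ws)"
proof (induction ws)
  case Nil show ?case by (auto simp: W_def invertible_def intro!: exI[of _ "mat 1"])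
next
  case (Cons \<sigma> ws) then show ?case using inv by (simp add: W_def word_mat_Cons invertible_mult)
qed

lemma W_cube: "\<exists>k. k \<noteq> 0 \<and> (\<forall>x. W (\<sigma> # \<sigma> # \<sigma> # ws) *v x = k *\<^sub>R (W ws *v x))"
proof -
  let ?M = "if \<sigma> then A else B"
  obtain k where k: "k \<noteq> 0" "?M ** ?M ** ?M = k *\<^sub>R mat 1" using cube by (cases \<sigma>) auto
  have "W (\<sigma> # \<sigma> # \<sigma> # ws) = (?M ** ?M ** ?M) ** W ws"
    by (simp add: W_def word_mat_Cons matrix_mul_assoc)
  then have "W (\<sigma> # \<sigma> # \<sigma> # ws) *v x = k *\<^sub>R (W ws *v x)" for x
    by (simp add: k(2) matrix_vector_mul_assoc[symmetric] scaleR_matrix_vector_assoc[symmetric])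
  then show ?thesis using k(1) by blast
qed

lemma H_vec: "H l *v x = e l *\<^sub>R (W (lw l) *v x)"
  by (simp add: H_def scaleR_matrix_vector_assoc)

lemma invertible_H: "invertible (H l)"
  using invertible_W e unfolding H_def by (simp add: scalar_invertible)

lemma H_eq_0: "H l *v x = 0 \<longleftrightarrow> x = 0" by (rule invertible_vec_eq_0[OF invertible_H])

lemma HL_eq_0: "HL L *v x = 0 \<longleftrightarrow> x = 0"
  by (induction L) (auto simp: H_eq_0)

lemma HL_word: "\<exists>k. k \<noteq> 0 \<and> (\<forall>x. HL L *v x = k *\<^sub>R (W (wd L) *v x))"
proof (induction L)
  case Nil show ?case by (intro exI[of _ 1]) simp
next
  case (Cons l L)
  then obtain k where "k \<noteq> 0" "\<And>x. HL L *v x = k *\<^sub>R (W (wd L) *v x)" by blast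
  then show ?case using e[of l]
    by (intro exI[of _ "k * e l"]) (simp add: H_vec W_append matrix_vector_mult_scaleR)
qed

lemma H_cone: "u \<in> fcone (F (\<not> fst l)) \<Longrightarrow> u \<noteq> 0 \<Longrightarrow> f \<in> F (fst l) \<Longrightarrow> f \<bullet> (H l *v u) > 0"
  unfolding H_def W_def by (rule cone_map)

lemma H_cone': "u \<in> fcone (F (\<not> fst l)) \<Longrightarrow> H l *v u \<in> fcone (F (fst l))"
proof (cases "u = 0")
  case False
  assume "u \<in> fcone (F (\<not> fst l))"
  then show ?thesis using H_cone[OF _ False] unfolding fcone_def by (auto simp: less_imp_le)
qed (simp add: fcone_def)

lemma F_nonempty: "F \<sigma> \<noteq> {}"
  using sep[of \<sigma> "axis 1 1"] by (auto simp: axis_eq_0_iff)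

text \<open>A functional that is positive on the nonzero vectors of the cone, hence comparable to
  the norm there.\<close>

definition fs :: "bool \<Rightarrow> real^3" where "fs \<sigma> = (\<Sum>f\<in>F \<sigma>. f)"

lemma fs_pos:
  assumes u: "u \<in> fcone (F \<sigma>)" "u \<noteq> 0" shows "fs \<sigma> \<bullet> u > 0"
proof -
  obtain f where f: "f \<in> F \<sigma>" "f \<bullet> u \<noteq> 0" using sep u(2) by blast
  then show ?thesis using u(1) unfolding fs_def inner_sum_left fcone_def
    by (intro sum_pos2[OF finF f(1)]) (auto simp: less_le)
qed

text \<open>Sides, letters and functionals are finite in number, so all bounds can be made uniform.
  One c serves for all lower bounds and one C for all upper bounds; the contraction factor depends
  on their ratio.\<close>

lemma constants:
  obtains c C K where "c > 0" "C > 0" "K \<ge> 1"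
    "\<And>\<sigma> u. u \<in> fcone (F \<sigma>) \<Longrightarrow> c * norm u \<le> fs \<sigma> \<bullet> u"
    "\<And>l u f. u \<in> fcone (F (\<not> fst l)) \<Longrightarrow> f \<in> F (fst l) \<Longrightarrow> c * norm u \<le> f \<bullet> (H l *v u)"
    "\<And>l u f. f \<in> F (fst l) \<Longrightarrow> \<bar>f \<bullet> (H l *v u)\<bar> \<le> C * norm u"
    "\<And>\<sigma> u f. f \<in> F \<sigma> \<Longrightarrow> \<bar>f \<bullet> u\<bar> \<le> C * norm u"
    "\<And>\<sigma> u. \<bar>fs \<sigma> \<bullet> u\<bar> \<le> C * norm u"
    "\<And>l u. norm (H l *v u) \<le> C * norm u"
    "\<And>l u y. u \<noteq> 0 \<Longrightarrow> pn (H l *v u) (H l *v y) \<le> K * pn u y"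
proof -
  have "\<forall>\<sigma>. \<exists>c>0. \<forall>u\<in>fcone (F \<sigma>). c * norm u \<le> fs \<sigma> \<bullet> u"
    using cone_lower_bound[where g = "\<lambda>u. fs _ \<bullet> u"] fs_pos
    by (simp add: bounded_linear.linear bounded_linear_inner_right)
  then obtain c1 where c1: "\<And>\<sigma>. c1 \<sigma> > 0" "\<And>\<sigma> u. u \<in> fcone (F \<sigma>) \<Longrightarrow> c1 \<sigma> * norm u \<le> fs \<sigma> \<bullet> u" by metis
  have ex: "\<exists>c>0. \<forall>u\<in>fcone (F (\<not> fst l)). c * norm u \<le> f \<bullet> (H l *v u)" if "f \<in> F (fst l)" for l f
  proof (rule cone_lower_bound)
    show "linear (\<lambda>u. f \<bullet> (H l *v u))"
      by (rule linearI) (simp_all add: matrix_vector_right_distrib inner_add_right matrix_vector_mult_scaleR)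
  qed (use H_cone that in blast)
  define c2 where "c2 l f = (SOME c. c > 0 \<and> (\<forall>u\<in>fcone (F (\<not> fst l)). c * norm u \<le> f \<bullet> (H l *v u)))" for l f
  have "c2 l f > 0 \<and> (\<forall>u\<in>fcone (F (\<not> fst l)). c2 l f * norm u \<le> f \<bullet> (H l *v u))"
    if "f \<in> F (fst l)" for l f
    unfolding c2_def by (rule someI_ex[OF ex[OF that]])
  then have c2: "\<And>l f. f \<in> F (fst l) \<Longrightarrow> c2 l f > 0"
     "\<And>l f u. f \<in> F (fst l) \<Longrightarrow> u \<in> fcone (F (\<not> fst l)) \<Longrightarrow> c2 l f * norm u \<le> f \<bullet> (H l *v u)"
    by blast+
  obtain K1 where K1: "\<And>l. K1 l > 0" "\<And>l x. norm (H l *v x) \<le> K1 l * norm x"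
    using matrix_bound[of "H _"] by metis
  obtain K2 where K2: "\<And>l. K2 l \<ge> 1" "\<And>l u y. u \<noteq> 0 \<Longrightarrow> pn (H l *v u) (H l *v y) \<le> K2 l * pn u y"
    using pn_Lipschitz[OF invertible_H] by metis
  define S where "S = range c1 \<union> (\<lambda>(l,f). c2 l f) ` (SIGMA l:UNIV. F (fst l))"
  have S: "finite S" "S \<noteq> {}" "\<And>x. x \<in> S \<Longrightarrow> x > 0"
    unfolding S_def using finF c1 c2 by auto
  define c where "c = Min S"
  define N where "N = (\<Sum>\<sigma>\<in>UNIV. norm (fs \<sigma>) + (\<Sum>f\<in>F \<sigma>. norm f))"
  define K3 where "K3 = (\<Sum>l\<in>UNIV. K1 l)"
  define K where "K = (\<Sum>l\<in>UNIV. K2 l)"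
  define C where "C = N * K3 + N + K3 + 1"
  have K1le: "K1 l \<le> K3" for l unfolding K3_def using K1(1) by (intro member_le_sum) (auto simp: less_imp_le)
  have K2le: "K2 l \<le> K" for l unfolding K_def using K2(1) by (intro member_le_sum) (auto intro: order_trans[OF zero_le_one])
  have N: "norm (fs \<sigma>) + (\<Sum>f\<in>F \<sigma>. norm f) \<le> N" for \<sigma>
    unfolding N_def by (rule member_le_sum) (auto intro!: sum_nonneg add_nonneg_nonneg)
  have N1: "norm (fs \<sigma>) \<le> N" for \<sigma>
  proof -
    have "(\<Sum>f\<in>F \<sigma>. norm f) \<ge> 0" by (rule sum_nonneg) simp
    then show ?thesis using N[of \<sigma>] by linarith
  qed
  have N2: "norm f \<le> N" if "f \<in> F \<sigma>" for f \<sigma>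
  proof -
    have "norm f \<le> (\<Sum>f\<in>F \<sigma>. norm f)" using that finF by (intro member_le_sum) auto
    then show ?thesis using N[of \<sigma>] norm_ge_zero[of "fs \<sigma>"] by linarith
  qed
  have N0: "N \<ge> 0" using N1[of True] norm_ge_zero order_trans by blast
  have K30: "K3 > 0" using K1(1) K1le less_le_trans by blast
  have CC: "N \<le> C" "K3 \<le> C" "N * K3 \<le> C" "C > 0"
    using N0 K30 mult_nonneg_nonneg[OF N0 less_imp_le[OF K30]] unfolding C_def by linarith+
  have Kge: "K \<ge> 1" using K2(1) K2le order_trans by blast
  have b: "\<bar>f \<bullet> u\<bar> \<le> N * norm u" if "norm f \<le> N" for f u :: "real^3"
    using Cauchy_Schwarz_ineq2[of f u] mult_right_mono[OF that norm_ge_zero[of u]] by linarith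
  have b': "N * norm u \<le> C * norm u" "K3 * norm u \<le> C * norm u" for u :: "real^3"
    using CC by (auto intro: mult_right_mono)
  have Hb: "norm (H l *v u) \<le> K3 * norm u" for l u
    using K1(2)[of l u] mult_right_mono[OF K1le[of l] norm_ge_zero[of u]] by linarith
  show ?thesis
  proof (rule that[of c C K])
    show "c > 0" unfolding c_def using S by simp
    show "C > 0" "K \<ge> 1" by fact+
    show "c * norm u \<le> fs \<sigma> \<bullet> u" if "u \<in> fcone (F \<sigma>)" for \<sigma> u
    proof -
      have "c \<le> c1 \<sigma>" unfolding c_def using S(1) by (intro Min_le) (auto simp: S_def)
      then show ?thesis using c1(2)[OF that] mult_right_mono[OF _ norm_ge_zero[of u]] order_trans by blast
    qed
    show "c * norm u \<le> f \<bullet> (H l *v u)" if "u \<in> fcone (F (\<not> fst l))" "f \<in> F (fst l)" for l u f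
    proof -
      have "c \<le> c2 l f" unfolding c_def using S(1) that(2) by (intro Min_le) (auto simp: S_def)
      then show ?thesis using c2(2)[OF that(2,1)] mult_right_mono[OF _ norm_ge_zero[of u]] order_trans by blast
    qed
    show "\<bar>f \<bullet> (H l *v u)\<bar> \<le> C * norm u" if "f \<in> F (fst l)" for l u f
    proof -
      have "\<bar>f \<bullet> (H l *v u)\<bar> \<le> N * norm (H l *v u)" by (rule b[OF N2[OF that]])
      also have "\<dots> \<le> N * (K3 * norm u)" by (rule mult_left_mono[OF Hb N0])
      also have "\<dots> \<le> C * norm u" using mult_right_mono[OF CC(3) norm_ge_zero[of u]] by (simp add: mult.assoc)
      finally show ?thesis .
    qed
    show "\<bar>f \<bullet> u\<bar> \<le> C * norm u" if "f \<in> F \<sigma>" for \<sigma> u f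
      using b[OF N2[OF that], of u] b'(1)[of u] by linarith
    show "\<bar>fs \<sigma> \<bullet> u\<bar> \<le> C * norm u" for \<sigma> u
      using b[OF N1[of \<sigma>], of u] b'(1)[of u] by linarith
    show "norm (H l *v u) \<le> C * norm u" for l u using Hb[of l u] b'(2)[of u] by linarith
    show "pn (H l *v u) (H l *v y) \<le> K * pn u y" if "u \<noteq> 0" for l u y
      using K2(2)[OF that, of l y] mult_right_mono[OF K2le[of l] pn_nonneg[of u y]] by linarith
  qed
qed

text \<open>For an alternating word whose first letter has side \<sigma>, this is the side of the
  cone on which the word acts: the opposite of the side of its last letter.\<close>

definition endst :: "bool \<Rightarrow> 'a list \<Rightarrow> bool" where
  "endst \<sigma> L = (if even (length L) then \<sigma> else \<not> \<sigma>)"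

lemma endst_simps [simp]: "endst \<sigma> [] = \<sigma>" "endst \<sigma> (l # L) = endst (\<not> \<sigma>) L"
  by (auto simp: endst_def)

lemma HL_cone: "alternating \<sigma> L \<Longrightarrow> u \<in> fcone (F (endst \<sigma> L)) \<Longrightarrow> HL L *v u \<in> fcone (F \<sigma>)"
proof (induction L arbitrary: \<sigma>)
  case (Cons l L)
  then show ?case using H_cone'[of "HL L *v u" l] by auto
qed simp

text \<open>A positive map contracts the oscillation of \<open>f y / f u\<close> over the functionals \<open>f\<close> cutting
  out the cone (Birkhoff); the factor is uniform since \<open>H l\<close> maps the cone into the interior.\<close>

lemma oscillation_step:
  assumes c: "c > 0" "C > 0" and
    lo: "\<And>l u f. u \<in> fcone (F (\<not> fst l)) \<Longrightarrow> f \<in> F (fst l) \<Longrightarrow> c * norm u \<le> f \<bullet> (H l *v u)" and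
    hi: "\<And>l u f. f \<in> F (fst l) \<Longrightarrow> \<bar>f \<bullet> (H l *v u)\<bar> \<le> C * norm u" and
    k: "1 - (c / C)^2 \<le> \<kappa>" "0 \<le> \<kappa>" and
    u: "u \<in> fcone (F (\<not> fst l))" "u \<noteq> 0" and
    y: "y - m *\<^sub>R u \<in> fcone (F (\<not> fst l))" "M *\<^sub>R u - y \<in> fcone (F (\<not> fst l))"
  shows "\<exists>m' M'. H l *v y - m' *\<^sub>R (H l *v u) \<in> fcone (F (fst l)) \<and>
      M' *\<^sub>R (H l *v u) - H l *v y \<in> fcone (F (fst l)) \<and> m \<le> m' \<and> m' \<le> M' \<and> M' \<le> M \<and>
      M' - m' \<le> \<kappa> * (M - m)"
proof -
  define r where "r f = (f \<bullet> (H l *v y)) / (f \<bullet> (H l *v u))" for f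
  let ?G = "F (fst l)"
  have pos: "f \<bullet> (H l *v u) > 0" if "f \<in> ?G" for f using H_cone[OF u that] .
  have rf: "f \<bullet> (H l *v y) = r f * (f \<bullet> (H l *v u))" if "f \<in> ?G" for f
    using pos[OF that] by (simp add: r_def)
  have fin: "finite (r ` ?G)" "r ` ?G \<noteq> {}" using finF F_nonempty by auto
  define m' where "m' = Min (r ` ?G)"
  define M' where "M' = Max (r ` ?G)"
  have rb: "m' \<le> r f" "r f \<le> M'" if "f \<in> ?G" for f using that fin by (auto simp: m'_def M'_def)
  obtain f1 where f1: "f1 \<in> ?G" "M' = r f1" using Max_in[OF fin] unfolding M'_def by blast
  obtain f2 where f2: "f2 \<in> ?G" "m' = r f2" using Min_in[OF fin] unfolding m'_def by blast
  let ?a = "y - m *\<^sub>R u"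
  have Ha: "f \<bullet> (H l *v ?a) = (r f - m) * (f \<bullet> (H l *v u))" if "f \<in> ?G" for f
    using rf[OF that] by (simp add: matrix_vector_mult_diff_distrib matrix_vector_mult_scaleR inner_diff_right algebra_simps)
  have Hb: "f \<bullet> (H l *v (M *\<^sub>R u - y)) = (M - r f) * (f \<bullet> (H l *v u))" if "f \<in> ?G" for f
    using rf[OF that] by (simp add: matrix_vector_mult_diff_distrib matrix_vector_mult_scaleR inner_diff_right algebra_simps)
  have ml: "m \<le> r f" "r f \<le> M" if "f \<in> ?G" for f
  proof -
    have "0 \<le> f \<bullet> (H l *v ?a)" "0 \<le> f \<bullet> (H l *v (M *\<^sub>R u - y))"
      using H_cone'[OF y(1)] H_cone'[OF y(2)] that by (auto simp: fcone_def)
    then show "m \<le> r f" "r f \<le> M" unfolding Ha[OF that] Hb[OF that] using pos[OF that]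
      by (auto simp: zero_le_mult_iff)
  qed
  have nu: "norm u > 0" using u(2) by simp
  \<comment> \<open>The vector \<open>?a\<close> lies in the source cone, so the excess over m of
    the largest and of the smallest ratio are both comparable to its norm. Therefore the smallest
    excess is at least (c/C)^2 times the largest.\<close>
  have x1: "r f1 - m \<le> C * norm ?a / (c * norm u)"
  proof -
    have "(r f1 - m) * (c * norm u) \<le> (r f1 - m) * (f1 \<bullet> (H l *v u))"
      using ml(1)[OF f1(1)] lo[OF u(1) f1(1)] by (intro mult_left_mono) auto
    also have "\<dots> \<le> C * norm ?a" using hi[OF f1(1), of ?a] unfolding Ha[OF f1(1)] by linarith
    finally show ?thesis using c nu by (simp add: pos_le_divide_eq)
  qed
  have x2: "r f2 - m \<ge> c * norm ?a / (C * norm u)"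
  proof -
    have "c * norm ?a \<le> (r f2 - m) * (f2 \<bullet> (H l *v u))" using lo[OF y(1) f2(1)] unfolding Ha[OF f2(1)] .
    also have "\<dots> \<le> (r f2 - m) * (C * norm u)"
      using ml(1)[OF f2(1)] hi[OF f2(1), of u] by (intro mult_left_mono) auto
    finally show ?thesis using c nu by (simp add: pos_divide_le_eq)
  qed
  have "(c/C)^2 * (r f1 - m) \<le> (c/C)^2 * (C * norm ?a / (c * norm u))"
    using x1 by (intro mult_left_mono) auto
  also have "\<dots> = c * norm ?a / (C * norm u)" using c nu by (simp add: field_simps power2_eq_square)
  finally have "(c/C)^2 * (r f1 - m) \<le> r f2 - m" using x2 by linarith
  then have "M' - m' \<le> (1 - (c/C)^2) * (r f1 - m)" unfolding f1 f2 by (simp add: algebra_simps)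
  also have "\<dots> \<le> \<kappa> * (r f1 - m)" using k ml(1)[OF f1(1)] by (intro mult_right_mono) auto
  also have "\<dots> \<le> \<kappa> * (M - m)" using k ml(2)[OF f1(1)] by (intro mult_left_mono) auto
  finally have "M' - m' \<le> \<kappa> * (M - m)" .
  moreover have "m' \<le> M'" using rb[OF f1(1)] by linarith
  moreover have "H l *v y - m' *\<^sub>R (H l *v u) \<in> fcone ?G" "M' *\<^sub>R (H l *v u) - H l *v y \<in> fcone ?G"
    unfolding fcone_def
  proof safe
    fix f assume f: "f \<in> ?G"
    have "m' * (f \<bullet> (H l *v u)) \<le> r f * (f \<bullet> (H l *v u))" "r f * (f \<bullet> (H l *v u)) \<le> M' * (f \<bullet> (H l *v u))"
      using rb[OF f] pos[OF f] by (auto intro: mult_right_mono)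
    then show "0 \<le> f \<bullet> (H l *v y - m' *\<^sub>R (H l *v u))" "0 \<le> f \<bullet> (M' *\<^sub>R (H l *v u) - H l *v y)"
      unfolding inner_diff_right inner_scaleR_right rf[OF f] by linarith+
  qed
  ultimately show ?thesis using ml f1 f2 by metis
qed

lemma alternating_snoc:
  assumes "L \<noteq> []" "alternating \<sigma> L"
  obtains L' l where "L = L' @ [l]" "alternating \<sigma> L'" "fst l = endst \<sigma> L'" "endst \<sigma> L = (\<not> fst l)"
proof -
  have alt: "alternating \<tau> (L' @ [l]) \<Longrightarrow> alternating \<tau> L' \<and> fst l = endst \<tau> L'" for L' l \<tau>
    by (induction L' arbitrary: \<tau>) simp_all
  show thesis
  proof (cases L rule: rev_cases)
    case (snoc L' l)
    then show ?thesis using that[OF snoc] alt[of \<sigma> L' l] assms(2) by (simp add: endst_def)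
  qed (use assms in simp)
qed

text \<open>The letter that acts first, the last one of L, is split off: it moves u into the
  interior, where other vectors can be squeezed between two multiples of the image of u. The
  remaining letters shrink the gap between these multiples by \<open>oscillation_step\<close>, and
  \<open>nrm\<close> converts a small gap into a small norm.\<close>

lemma contraction:
  obtains C \<kappa> where "C \<ge> 1" "0 < \<kappa>" "\<kappa> < 1"
    "\<And>\<sigma> L u y. alternating \<sigma> L \<Longrightarrow> u \<in> fcone (F (endst \<sigma> L)) \<Longrightarrow> u \<noteq> 0 \<Longrightarrow>
      pn (HL L *v u) (HL L *v y) \<le> C * \<kappa> ^ length L * pn u y"
    "\<And>\<sigma> L u w. alternating \<sigma> L \<Longrightarrow> u \<in> fcone (F (endst \<sigma> L)) \<Longrightarrow> u \<noteq> 0 \<Longrightarrow>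
      w \<in> fcone (F (endst \<sigma> L)) \<Longrightarrow> w \<noteq> 0 \<Longrightarrow>
      norm (sgn (HL L *v u) - sgn (HL L *v w)) \<le> C * \<kappa> ^ length L"
proof (rule constants)
  fix c C K :: real
  assume k: "c > 0" "C > 0" "K \<ge> 1" and
    fl: "\<And>\<sigma> u. u \<in> fcone (F \<sigma>) \<Longrightarrow> c * norm u \<le> fs \<sigma> \<bullet> u" and
    lo: "\<And>l u f. u \<in> fcone (F (\<not> fst l)) \<Longrightarrow> f \<in> F (fst l) \<Longrightarrow> c * norm u \<le> f \<bullet> (H l *v u)" and
    hi: "\<And>l u f. f \<in> F (fst l) \<Longrightarrow> \<bar>f \<bullet> (H l *v u)\<bar> \<le> C * norm u" and
    fb: "\<And>\<sigma> u f. f \<in> F \<sigma> \<Longrightarrow> \<bar>f \<bullet> u\<bar> \<le> C * norm u" and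
    fsb: "\<And>\<sigma> u. \<bar>fs \<sigma> \<bullet> u\<bar> \<le> C * norm u" and
    Hb: "\<And>l u. norm (H l *v u) \<le> C * norm u" and
    Lip: "\<And>l u y. u \<noteq> 0 \<Longrightarrow> pn (H l *v u) (H l *v y) \<le> K * pn u y"
  \<comment> \<open>The maximum with 1/2 keeps \<kappa> positive and makes
    \<open>\<kappa> ^ (n - 1)\<close> at most twice \<open>\<kappa> ^ n\<close>, which pays for the
    letter that is split off.\<close>
  define \<kappa> where "\<kappa> = max (1/2) (1 - (c / C)^2)"
  have \<kappa>: "0 < \<kappa>" "\<kappa> < 1" "1 - (c / C)^2 \<le> \<kappa>" "1 / \<kappa> \<le> 2"
    using k by (auto simp: \<kappa>_def field_simps)
  have osc: "\<exists>m' M'. HL L *v y - m' *\<^sub>R (HL L *v u) \<in> fcone (F \<sigma>) \<and>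
      M' *\<^sub>R (HL L *v u) - HL L *v y \<in> fcone (F \<sigma>) \<and> m \<le> m' \<and> m' \<le> M' \<and> M' \<le> M \<and>
      M' - m' \<le> \<kappa> ^ length L * (M - m)"
    if "alternating \<sigma> L" "u \<in> fcone (F (endst \<sigma> L))" "u \<noteq> 0"
     "y - m *\<^sub>R u \<in> fcone (F (endst \<sigma> L))" "M *\<^sub>R u - y \<in> fcone (F (endst \<sigma> L))" "m \<le> M"
    for \<sigma> L u y m M
    using that
  proof (induction L arbitrary: \<sigma>)
    case Nil
    then show ?case by (intro exI[of _ m] exI[of _ M]) simp
  next
    case (Cons l L)
    let ?u = "HL L *v u" and ?y = "HL L *v y"
    have l: "fst l = \<sigma>" "alternating (\<not> \<sigma>) L" using Cons.prems(1) by auto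
    obtain m1 M1 where 1: "?y - m1 *\<^sub>R ?u \<in> fcone (F (\<not> fst l))" "M1 *\<^sub>R ?u - ?y \<in> fcone (F (\<not> fst l))"
      "m \<le> m1" "M1 \<le> M" "M1 - m1 \<le> \<kappa> ^ length L * (M - m)"
      using Cons.IH[OF l(2)] Cons.prems l(1) by auto
    have u: "?u \<in> fcone (F (\<not> fst l))" "?u \<noteq> 0"
      using HL_cone[OF l(2)] Cons.prems l(1) by (auto simp: HL_eq_0)
    obtain m2 M2 where 2: "H l *v ?y - m2 *\<^sub>R (H l *v ?u) \<in> fcone (F (fst l))"
      "M2 *\<^sub>R (H l *v ?u) - H l *v ?y \<in> fcone (F (fst l))" "m1 \<le> m2" "m2 \<le> M2" "M2 \<le> M1"
      "M2 - m2 \<le> \<kappa> * (M1 - m1)"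
      using oscillation_step[OF k(1,2) lo hi \<kappa>(3) less_imp_le[OF \<kappa>(1)] u 1(1,2)] by blast
    have "\<kappa> * (M1 - m1) \<le> \<kappa> * (\<kappa> ^ length L * (M - m))" using 1(5) \<kappa>(1) by (intro mult_left_mono) auto
    then have "M2 - m2 \<le> \<kappa> ^ length (l # L) * (M - m)" using 2(6) by (simp add: mult.assoc)
    then show ?case using 1 2 l(1) by (intro exI[of _ m2] exI[of _ M2]) auto
  qed
  \<comment> \<open>The cone is normal: being below t u in the order of the cone bounds the norm, as
    \<open>fs\<close> shows.\<close>
  have nrm: "norm a \<le> C / c * t * norm u" if "a \<in> fcone (F \<sigma>)" "t *\<^sub>R u - a \<in> fcone (F \<sigma>)" "t \<ge> 0" for a t u \<sigma>
  proof -
    have "c * norm a \<le> fs \<sigma> \<bullet> a" using fl[OF that(1)] .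
    also have "\<dots> \<le> t * (fs \<sigma> \<bullet> u)"
    proof -
      have "0 \<le> c * norm (t *\<^sub>R u - a)" using k by simp
      also have "\<dots> \<le> fs \<sigma> \<bullet> (t *\<^sub>R u - a)" by (rule fl[OF that(2)])
      finally show ?thesis by (simp add: inner_diff_right)
    qed
    also have "\<dots> \<le> t * (C * norm u)" using fsb[of \<sigma> u] that(3) by (intro mult_left_mono) auto
    finally show ?thesis using k by (simp add: field_simps)
  qed
  have cC: "c \<le> C"
  proof -
    obtain f where f: "f \<in> F True" using F_nonempty by blast
    have "c * norm (v False) \<le> C * norm (v False)"
    proof -
      have "v False \<in> fcone (F (\<not> fst (True,True)))" "f \<in> F (fst (True,True))" using f v(1)[of False] by simp_all
      from lo[OF this] hi[OF this(2), of "v False"] show ?thesis by linarith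
    qed
    then show ?thesis using v(2)[of False] by simp
  qed
  define C1 where "C1 = 4 * C^3 * K / c^2"
  define C2 where "C2 = 4 * C^3 / c^3"
  have C12: "C1 \<ge> 0" "C2 \<ge> 0" using k by (auto simp: C1_def C2_def)
  have 1: "pn (HL L *v u) (HL L *v y) \<le> C1 * \<kappa> ^ length L * pn u y"
    if L: "L \<noteq> []" "alternating \<sigma> L" and u: "u \<in> fcone (F (endst \<sigma> L))" "u \<noteq> 0" for \<sigma> L u y
    using L
  proof (rule alternating_snoc)
    fix L' l assume L': "L = L' @ [l]" "alternating \<sigma> L'" "fst l = endst \<sigma> L'" "endst \<sigma> L = (\<not> fst l)"
    define U where "U = H l *v u"
    define Y where "Y = H l *v y"
    \<comment> \<open>Chosen such that t times the lower bound (c/C) |U| for f on U equals the upper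
      bound C |Y - r U| for |f| on Y - r U; so Y lies between (r - t) U and (r + t) U.\<close>
    define t where "t = C * C / c * pn U Y"
    define r where "r = pcoef U Y"
    have u': "u \<in> fcone (F (\<not> fst l))" using u(1) L'(4) by simp
    have U0: "U \<noteq> 0" using u(2) by (simp add: U_def H_eq_0)
    have UF: "U \<in> fcone (F (endst \<sigma> L'))" using H_cone'[OF u'] L'(3) by (simp add: U_def)
    have pw: "\<kappa> ^ length L' \<le> 2 * \<kappa> ^ length L"
    proof -
      have "1 * \<kappa> ^ length L' \<le> (2 * \<kappa>) * \<kappa> ^ length L'"
        using \<kappa> by (intro mult_right_mono) (auto simp: field_simps)
      then show ?thesis unfolding L'(1) by simp
    qed
    have t0: "t \<ge> 0" using k pn_nonneg[of U Y] by (simp add: t_def)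
    have fU: "f \<bullet> U \<ge> c / C * norm U" if "f \<in> F (fst l)" for f
    proof -
      have "c / C * norm U \<le> c / C * (C * norm u)" using Hb[of l u] k unfolding U_def by (intro mult_left_mono) auto
      also have "\<dots> = c * norm u" using k by simp
      also have "\<dots> \<le> f \<bullet> U" unfolding U_def by (rule lo[OF u' that])
      finally show ?thesis .
    qed
    have ny: "norm (Y - r *\<^sub>R U) = pn U Y * norm U" using U0 by (simp add: pn_def r_def)
    have tb: "t * (f \<bullet> U) \<ge> C * norm (Y - r *\<^sub>R U)" if "f \<in> F (fst l)" for f
    proof -
      have "C * norm (Y - r *\<^sub>R U) = t * (c / C * norm U)" unfolding ny t_def using k by (simp add: field_simps)
      also have "\<dots> \<le> t * (f \<bullet> U)" by (rule mult_left_mono[OF fU[OF that] t0])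
      finally show ?thesis .
    qed
    have y1: "Y - (r - t) *\<^sub>R U \<in> fcone (F (endst \<sigma> L'))" "(r + t) *\<^sub>R U - Y \<in> fcone (F (endst \<sigma> L'))"
      unfolding fcone_def L'(3)[symmetric]
    proof safe
      fix f assume f: "f \<in> F (fst l)"
      have "\<bar>f \<bullet> (Y - r *\<^sub>R U)\<bar> \<le> t * (f \<bullet> U)" using fb[OF f, of "Y - r *\<^sub>R U"] tb[OF f] by linarith
      then show "0 \<le> f \<bullet> (Y - (r - t) *\<^sub>R U)" "0 \<le> f \<bullet> ((r + t) *\<^sub>R U - Y)"
        by (auto simp: inner_diff_right algebra_simps)
    qed
    obtain m' M' where o: "HL L' *v Y - m' *\<^sub>R (HL L' *v U) \<in> fcone (F \<sigma>)"
       "M' *\<^sub>R (HL L' *v U) - HL L' *v Y \<in> fcone (F \<sigma>)" "m' \<le> M'"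
       "M' - m' \<le> \<kappa> ^ length L' * ((r + t) - (r - t))"
      using osc[OF L'(2) UF U0 y1] t0 by auto
    let ?U = "HL L' *v U" and ?Y = "HL L' *v Y"
    have U1: "?U \<noteq> 0" using U0 by (simp add: HL_eq_0)
    have eq: "(M' - m') *\<^sub>R ?U - (?Y - m' *\<^sub>R ?U) = M' *\<^sub>R ?U - ?Y" by (simp add: algebra_simps)
    have "(M' - m') *\<^sub>R ?U - (?Y - m' *\<^sub>R ?U) \<in> fcone (F \<sigma>)" unfolding eq by (rule o(2))
    from nrm[OF o(1) this] have a: "norm (?Y - m' *\<^sub>R ?U) \<le> C / c * (M' - m') * norm ?U"
      using o(3) by simp
    then have "pn ?U ?Y \<le> C / c * (M' - m')"
    proof -
      have "norm (?Y - m' *\<^sub>R ?U) / norm ?U \<le> C / c * (M' - m')"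
        using a U1 by (simp add: divide_le_eq)
      then show ?thesis using pn_le[OF U1, of ?Y m'] by linarith
    qed
    also have "\<dots> \<le> C / c * (\<kappa> ^ length L' * (2 * t))"
      using o(4) k by (intro mult_left_mono) auto
    also have "\<dots> = (2 * C^3 / c^2) * \<kappa> ^ length L' * pn U Y"
      by (simp add: t_def power2_eq_square power3_eq_cube mult_ac)
    also have "\<dots> \<le> (2 * C^3 / c^2) * \<kappa> ^ length L' * (K * pn u y)"
      using Lip[OF u(2), of l y] k \<kappa> unfolding U_def Y_def by (intro mult_left_mono) auto
    also have "\<dots> \<le> (2 * C^3 / c^2) * (2 * \<kappa> ^ length L) * (K * pn u y)"
      using k pn_nonneg[of u y] by (intro mult_right_mono mult_left_mono[OF pw]) auto
    also have "\<dots> = C1 * \<kappa> ^ length L * pn u y" by (simp add: C1_def)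
    finally show ?thesis unfolding L'(1) U_def Y_def by (simp add: HL_append)
  qed
  have 2: "norm (sgn (HL L *v u) - sgn (HL L *v w)) \<le> C2 * \<kappa> ^ length L"
    if L: "L \<noteq> []" "alternating \<sigma> L" and u: "u \<in> fcone (F (endst \<sigma> L))" "u \<noteq> 0"
      and w: "w \<in> fcone (F (endst \<sigma> L))" "w \<noteq> 0" for \<sigma> L u w
    using L
  proof (rule alternating_snoc)
    fix L' l assume L': "L = L' @ [l]" "alternating \<sigma> L'" "fst l = endst \<sigma> L'" "endst \<sigma> L = (\<not> fst l)"
    define U where "U = H l *v u"
    define Y where "Y = H l *v w"
    \<comment> \<open>After one letter the value of f on U lies between c |u| and C |u|, and on Y
      between c |w| and C |w|; m and M are the extreme ratios.\<close>
    define m where "m = c * norm w / (C * norm u)"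
    define M where "M = C * norm w / (c * norm u)"
    have u': "u \<in> fcone (F (\<not> fst l))" and w': "w \<in> fcone (F (\<not> fst l))" using u(1) w(1) L'(4) by simp_all
    have U0: "U \<noteq> 0" and Y0: "Y \<noteq> 0" using u(2) w(2) by (simp_all add: U_def Y_def H_eq_0)
    have UF: "U \<in> fcone (F (endst \<sigma> L'))" using H_cone'[OF u'] L'(3) by (simp add: U_def)
    have pw: "\<kappa> ^ length L' \<le> 2 * \<kappa> ^ length L"
    proof -
      have "1 * \<kappa> ^ length L' \<le> (2 * \<kappa>) * \<kappa> ^ length L'"
        using \<kappa> by (intro mult_right_mono) (auto simp: field_simps)
      then show ?thesis unfolding L'(1) by simp
    qed
    have m0: "m > 0" using u(2) w(2) k by (simp add: m_def)
    have Mm: "M = (C / c)^2 * m" using k u(2) by (simp add: m_def M_def field_simps power2_eq_square)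
    have "1 \<le> (C / c)^2" using k cC by (simp add: one_le_power)
    then have mM: "m \<le> M" unfolding Mm using m0 by simp
    have y1: "Y - m *\<^sub>R U \<in> fcone (F (endst \<sigma> L'))" "M *\<^sub>R U - Y \<in> fcone (F (endst \<sigma> L'))"
      unfolding fcone_def L'(3)[symmetric]
    proof safe
      fix f assume f: "f \<in> F (fst l)"
      have "m * (f \<bullet> U) \<le> m * (C * norm u)" unfolding U_def using hi[OF f, of u] m0 by (intro mult_left_mono) auto
      also have "\<dots> = c * norm w" using k u(2) by (simp add: m_def)
      also have "\<dots> \<le> f \<bullet> Y" unfolding Y_def by (rule lo[OF w' f])
      finally show "0 \<le> f \<bullet> (Y - m *\<^sub>R U)" by (simp add: inner_diff_right)
      have "f \<bullet> Y \<le> C * norm w" unfolding Y_def using hi[OF f, of w] by linarith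
      also have "\<dots> = M * (c * norm u)" using k u(2) by (simp add: M_def)
      also have "\<dots> \<le> M * (f \<bullet> U)" unfolding U_def using lo[OF u' f] m0 mM by (intro mult_left_mono) auto
      finally show "0 \<le> f \<bullet> (M *\<^sub>R U - Y)" by (simp add: inner_diff_right)
    qed
    obtain m' M' where o: "HL L' *v Y - m' *\<^sub>R (HL L' *v U) \<in> fcone (F \<sigma>)"
       "M' *\<^sub>R (HL L' *v U) - HL L' *v Y \<in> fcone (F \<sigma>)" "m' \<le> M'" "m \<le> m'"
       "M' - m' \<le> \<kappa> ^ length L' * (M - m)"
      using osc[OF L'(2) UF U0 y1 mM] by auto
    let ?U = "HL L' *v U" and ?Y = "HL L' *v Y"
    have U1: "?U \<noteq> 0" and Y1: "?Y \<noteq> 0" using U0 Y0 by (simp_all add: HL_eq_0)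
    have m'0: "m' > 0" using m0 o(4) by linarith
    have eq: "(M' - m') *\<^sub>R ?U - (?Y - m' *\<^sub>R ?U) = M' *\<^sub>R ?U - ?Y" by (simp add: algebra_simps)
    have "(M' - m') *\<^sub>R ?U - (?Y - m' *\<^sub>R ?U) \<in> fcone (F \<sigma>)" unfolding eq by (rule o(2))
    from nrm[OF o(1) this] have a: "norm (?Y - m' *\<^sub>R ?U) \<le> C / c * (M' - m') * norm ?U"
      using o(3) by simp
    have "sgn ?Y = sgn (inverse m' *\<^sub>R ?Y)" using m'0 by (simp add: sgn_scaleR)
    then have "norm (sgn ?Y - sgn ?U) \<le> 2 * norm (inverse m' *\<^sub>R ?Y - ?U) / norm ?U"
      using norm_sgn_diff[of "inverse m' *\<^sub>R ?Y" ?U] U1 Y1 m'0 by simp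
    also have "inverse m' *\<^sub>R ?Y - ?U = inverse m' *\<^sub>R (?Y - m' *\<^sub>R ?U)"
      using m'0 by (simp add: algebra_simps)
    also have "2 * norm (inverse m' *\<^sub>R (?Y - m' *\<^sub>R ?U)) / norm ?U = 2 * (norm (?Y - m' *\<^sub>R ?U) / norm ?U) / m'"
      using m'0 by (simp add: divide_inverse)
    also have "\<dots> \<le> 2 * (C / c * (M' - m')) / m'"
      using a U1 m'0 by (intro divide_right_mono mult_left_mono) (auto simp: divide_le_eq)
    also have "\<dots> \<le> 2 * (C / c * (M' - m')) / m"
      using o(3,4) m0 k by (intro divide_left_mono mult_nonneg_nonneg mult_pos_pos) auto
    also have "\<dots> \<le> 2 * (C / c * (\<kappa> ^ length L' * M)) / m"
    proof (intro divide_right_mono mult_left_mono)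
      have "\<kappa> ^ length L' * (M - m) \<le> \<kappa> ^ length L' * M" using \<kappa> m0 by (intro mult_left_mono) auto
      then show "M' - m' \<le> \<kappa> ^ length L' * M" using o(5) by linarith
    qed (use k m0 in auto)
    also have "\<dots> = 2 * (C^3 / c^3) * \<kappa> ^ length L'"
      unfolding Mm using m0 k by (simp add: field_simps power2_eq_square power3_eq_cube)
    also have "\<dots> \<le> 2 * (C^3 / c^3) * (2 * \<kappa> ^ length L)"
      using k by (intro mult_left_mono[OF pw]) auto
    also have "\<dots> = C2 * \<kappa> ^ length L" by (simp add: C2_def)
    finally show ?thesis unfolding L'(1) U_def Y_def by (simp add: HL_append norm_minus_commute)
  qed
  show thesis
  proof (rule that[of "2 + C1 + C2" \<kappa>])
    show "2 + C1 + C2 \<ge> 1" using C12 by simp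
    show "0 < \<kappa>" "\<kappa> < 1" by fact+
    show "pn (HL L *v u) (HL L *v y) \<le> (2 + C1 + C2) * \<kappa> ^ length L * pn u y"
      if "alternating \<sigma> L" "u \<in> fcone (F (endst \<sigma> L))" "u \<noteq> 0" for \<sigma> L u y
    proof (cases "L = []")
      case True
      have "1 * pn u y \<le> (2 + C1 + C2) * pn u y" using C12 by (intro mult_right_mono pn_nonneg) auto
      then show ?thesis using True by simp
    next
      case False
      have "C1 * \<kappa> ^ length L * pn u y \<le> (2 + C1 + C2) * \<kappa> ^ length L * pn u y"
        using C12 \<kappa> by (intro mult_right_mono pn_nonneg) auto
      then show ?thesis using 1[OF False that, of y] by linarith
    qed
    show "norm (sgn (HL L *v u) - sgn (HL L *v w)) \<le> (2 + C1 + C2) * \<kappa> ^ length L"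
      if "alternating \<sigma> L" "u \<in> fcone (F (endst \<sigma> L))" "u \<noteq> 0" "w \<in> fcone (F (endst \<sigma> L))" "w \<noteq> 0" for \<sigma> L u w
    proof (cases "L = []")
      case True
      have "norm (sgn u - sgn w) \<le> 1 + 1"
        using norm_triangle_ineq4[of "sgn u" "sgn w"] that by (simp add: norm_sgn)
      then show ?thesis using True C12 by simp
    next
      case False
      have "C2 * \<kappa> ^ length L \<le> (2 + C1 + C2) * \<kappa> ^ length L"
        using C12 \<kappa> by (intro mult_right_mono) auto
      then show ?thesis using 2[OF False that] by linarith
    qed
  qed
qed

end

section \<open>The limit map\<close>

context cone_rep
begin

text \<open>The base vector of the side reached after n shifts, carried back by the first n letters.
  That side is the one on which the word of these letters acts, so the result lies in the cone of
  \<xi>.\<close>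

definition phin :: "nat \<Rightarrow> complex \<Rightarrow> real^3" where
  "phin n \<xi> = HL (its n \<xi>) *v v (sd ((sh ^^ n) \<xi>))"

lemma phin_0: "phin 0 \<xi> = v (sd \<xi>)" by (simp add: phin_def)

lemma phin_Suc: "phin (Suc n) \<xi> = H (lt \<xi>) *v phin n (sh \<xi>)"
  by (simp add: phin_def funpow_swap1)

lemma phin_nz: "phin n \<xi> \<noteq> 0" by (simp add: phin_def HL_eq_0 v)

lemma sd_funpow: "\<xi> \<in> \<Lambda> \<Longrightarrow> sd ((sh ^^ n) \<xi>) = endst (sd \<xi>) (its n \<xi>)"
proof (induction n arbitrary: \<xi>)
  case (Suc n)
  have "sd ((sh ^^ Suc n) \<xi>) = sd ((sh ^^ n) (sh \<xi>))" by (simp add: funpow_swap1)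
  then show ?case using Suc.IH[OF sh_limit[OF Suc.prems]] ltI[OF Suc.prems] by simp
qed simp

lemma phin_cone: "\<xi> \<in> \<Lambda> \<Longrightarrow> phin n \<xi> \<in> fcone (F (sd \<xi>))"
  unfolding phin_def
  by (rule HL_cone[OF alternating_its]) (use v(1)[of "sd ((sh ^^ n) \<xi>)"] sd_funpow[of \<xi> n] in simp_all)

lemma phin_add: "phin (n + k) \<xi> = HL (its n \<xi>) *v phin k ((sh ^^ n) \<xi>)"
  by (induction n arbitrary: \<xi>) (simp_all add: phin_Suc funpow_swap1)

text \<open>On each of the four closed pieces the first letter is constant and the shift is a fixed
  Moebius map, so the restrictions are continuous and glue.\<close>

lemma phin_cont: "continuous_on \<Lambda> (phin n)"
proof (induction n)
  case 0
  show ?case using sd_cont[of v] by (simp add: phin_0[abs_def])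
next
  case (Suc n)
  have "continuous_on (\<Union>l. piece l) (phin (Suc n))"
  proof (rule continuous_on_closed_Union)
    fix l
    have pl: "piece l \<subseteq> \<Lambda>" by (auto simp: piece_def)
    then have "piece l \<subseteq> cball 0 1" by auto
    then have b: "continuous_on (piece l) (bact (lw (linv l)))" by (rule continuous_on_subset[OF bact_cont])
    have "continuous_on (piece l) (\<lambda>\<xi>. phin n (bact (lw (linv l)) \<xi>))"
      by (rule continuous_on_compose2[OF Suc b]) (use pl limit_bact in auto)
    then have "continuous_on (piece l) (\<lambda>\<xi>. H l *v phin n (bact (lw (linv l)) \<xi>))"
      by (rule bounded_linear.continuous_on[OF matrix_vector_mul_bounded_linear])
    then show "continuous_on (piece l) (phin (Suc n))"
      by (rule continuous_on_eq) (auto simp: piece_def phin_Suc sh_def)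
  qed (auto simp: closed_piece)
  then show ?case using limit_pieces by simp
qed

definition phi :: "complex \<Rightarrow> real^3" where "phi \<xi> = lim (\<lambda>n. sgn (phin n \<xi>))"

text \<open>Both vectors are images of vectors of one cone under the same n letters, so
  \<open>contraction\<close> applies with constants independent of \<xi>.\<close>

lemma phin_Cauchy:
  obtains C \<kappa> where "C \<ge> 1" "0 < \<kappa>" "\<kappa> < 1"
    "\<And>\<xi> n k. \<xi> \<in> \<Lambda> \<Longrightarrow> norm (sgn (phin n \<xi>) - sgn (phin (n + k) \<xi>)) \<le> C * \<kappa> ^ n"
proof (rule contraction)
  fix C \<kappa> :: real
  assume C: "C \<ge> 1" "0 < \<kappa>" "\<kappa> < 1" and
    c: "\<And>\<sigma> L u w. alternating \<sigma> L \<Longrightarrow> u \<in> fcone (F (endst \<sigma> L)) \<Longrightarrow> u \<noteq> 0 \<Longrightarrow>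
      w \<in> fcone (F (endst \<sigma> L)) \<Longrightarrow> w \<noteq> 0 \<Longrightarrow>
      norm (sgn (HL L *v u) - sgn (HL L *v w)) \<le> C * \<kappa> ^ length L"
  show thesis
  proof (rule that[OF C])
    fix \<xi> n k assume \<xi>: "\<xi> \<in> \<Lambda>"
    have e: "endst (sd \<xi>) (its n \<xi>) = sd ((sh ^^ n) \<xi>)" using sd_funpow[OF \<xi>] by simp
    show "norm (sgn (phin n \<xi>) - sgn (phin (n + k) \<xi>)) \<le> C * \<kappa> ^ n"
      unfolding phin_add unfolding phin_def[of n]
      using c[OF alternating_its[OF \<xi>, of n], unfolded e] v phin_cone[OF funpow_sh_limit[OF \<xi>]] phin_nz
      by simp
  qed
qed

lemma phi_lim:
  assumes \<xi>: "\<xi> \<in> \<Lambda>" shows "(\<lambda>n. sgn (phin n \<xi>)) \<longlonglongrightarrow> phi \<xi>"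
proof -
  obtain C \<kappa> where C: "C \<ge> 1" "0 < \<kappa>" "\<kappa> < 1" and
    c: "\<And>n k. norm (sgn (phin n \<xi>) - sgn (phin (n + k) \<xi>)) \<le> C * \<kappa> ^ n"
    by (rule phin_Cauchy) (use \<xi> in blast)
  have lim: "(\<lambda>n. C * \<kappa> ^ n) \<longlonglongrightarrow> 0" using C by (intro tendsto_mult_right_zero LIMSEQ_power_zero) auto
  have "Cauchy (\<lambda>n. sgn (phin n \<xi>))"
  proof (rule CauchyI')
    fix e :: real assume "e > 0"
    then obtain M where M: "\<And>n. n \<ge> M \<Longrightarrow> C * \<kappa> ^ n < e"
      using order_tendstoD(2)[OF lim] unfolding eventually_sequentially by blast
    have "norm (sgn (phin m \<xi>) - sgn (phin n \<xi>)) < e" if "m \<ge> M" "n > m" for m n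
      using c[of m "n - m"] M[OF that(1)] that(2) by simp
    then show "\<exists>M. \<forall>m\<ge>M. \<forall>n>m. dist (sgn (phin m \<xi>)) (sgn (phin n \<xi>)) < e"
      unfolding dist_norm by blast
  qed
  then show ?thesis unfolding phi_def by (metis Cauchy_convergent convergent_LIMSEQ_iff)
qed

lemma phi_cont: "continuous_on \<Lambda> phi"
proof -
  obtain C \<kappa> where C: "C \<ge> 1" "0 < \<kappa>" "\<kappa> < 1" and
    c: "\<And>\<xi> n k. \<xi> \<in> \<Lambda> \<Longrightarrow> norm (sgn (phin n \<xi>) - sgn (phin (n + k) \<xi>)) \<le> C * \<kappa> ^ n"
    by (rule phin_Cauchy) blast
  have lim: "(\<lambda>n. C * \<kappa> ^ n) \<longlonglongrightarrow> 0" using C by (intro tendsto_mult_right_zero LIMSEQ_power_zero) auto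
  have b: "norm (sgn (phin n \<xi>) - phi \<xi>) \<le> C * \<kappa> ^ n" if \<xi>: "\<xi> \<in> \<Lambda>" for \<xi> n
  proof (rule tendsto_upperbound)
    show "(\<lambda>k. norm (sgn (phin n \<xi>) - sgn (phin (n + k) \<xi>))) \<longlonglongrightarrow> norm (sgn (phin n \<xi>) - phi \<xi>)"
      using LIMSEQ_ignore_initial_segment[OF phi_lim[OF \<xi>], of n]
      by (intro tendsto_intros) (simp add: add.commute)
  qed (use c[OF \<xi>] in auto)
  have "uniform_limit \<Lambda> (\<lambda>n \<xi>. sgn (phin n \<xi>)) phi sequentially"
  proof (rule uniform_limitI)
    fix e :: real assume "e > 0"
    from order_tendstoD(2)[OF lim this]
    show "\<forall>\<^sub>F n in sequentially. \<forall>\<xi>\<in>\<Lambda>. dist (sgn (phin n \<xi>)) (phi \<xi>) < e"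
      by eventually_elim (use b in \<open>auto simp: dist_norm intro: le_less_trans\<close>)
  qed
  moreover have "\<forall>\<^sub>F n in sequentially. continuous_on \<Lambda> (\<lambda>\<xi>. sgn (phin n \<xi>))"
    using phin_cont phin_nz unfolding sgn_div_norm
    by (intro always_eventually allI continuous_intros) auto
  ultimately show ?thesis by (intro uniform_limit_theorem) auto
qed

lemma phi_norm: assumes \<xi>: "\<xi> \<in> \<Lambda>" shows "norm (phi \<xi>) = 1"
proof -
  have "(\<lambda>n. norm (sgn (phin n \<xi>))) \<longlonglongrightarrow> norm (phi \<xi>)" by (intro tendsto_norm phi_lim \<xi>)
  moreover have "norm (sgn (phin n \<xi>)) = 1" for n using phin_nz by (simp add: norm_sgn)
  ultimately show ?thesis by (simp add: LIMSEQ_const_iff)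
qed

lemma phi_nz: "\<xi> \<in> \<Lambda> \<Longrightarrow> phi \<xi> \<noteq> 0" using phi_norm by force

lemma phi_cone: assumes \<xi>: "\<xi> \<in> \<Lambda>" shows "phi \<xi> \<in> fcone (F (sd \<xi>))"
proof (rule Lim_in_closed_set[OF closed_cone])
  show "\<forall>\<^sub>F n in sequentially. sgn (phin n \<xi>) \<in> fcone (F (sd \<xi>))"
    using phin_cone[OF \<xi>] by (auto simp: fcone_def sgn_div_norm)
qed (use phi_lim[OF \<xi>] in auto)

lemma phi_step: assumes \<xi>: "\<xi> \<in> \<Lambda>" shows "phi \<xi> = sgn (H (lt \<xi>) *v phi (sh \<xi>))"
proof (rule LIMSEQ_unique)
  show "(\<lambda>n. sgn (phin (Suc n) \<xi>)) \<longlonglongrightarrow> phi \<xi>"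
    using LIMSEQ_Suc[OF phi_lim[OF \<xi>]] .
  have "sgn (phin (Suc n) \<xi>) = sgn (H (lt \<xi>) *v sgn (phin n (sh \<xi>)))" for n
    using phin_nz[of n "sh \<xi>"] unfolding phin_Suc
    by (simp add: sgn_div_norm[of "phin n (sh \<xi>)"] matrix_vector_mult_scaleR sgn_scaleR)
  moreover have "(\<lambda>n. sgn (H (lt \<xi>) *v sgn (phin n (sh \<xi>)))) \<longlonglongrightarrow> sgn (H (lt \<xi>) *v phi (sh \<xi>))"
    using phi_nz[OF sh_limit[OF \<xi>]]
    by (intro tendsto_sgn bounded_linear.tendsto[OF matrix_vector_mul_bounded_linear] phi_lim sh_limit \<xi>)
      (simp add: H_eq_0)
  ultimately show "(\<lambda>n. sgn (phin (Suc n) \<xi>)) \<longlonglongrightarrow> sgn (H (lt \<xi>) *v phi (sh \<xi>))" by simp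
qed

lemma proj_eq_refl: "proj_eq u u" by (auto simp: proj_eq_def intro: exI[of _ 1])

lemma proj_eq_sym: "proj_eq u w \<Longrightarrow> proj_eq w u"
proof -
  assume "proj_eq u w"
  then obtain c where "c \<noteq> 0" "u = c *\<^sub>R w" by (auto simp: proj_eq_def)
  then show ?thesis unfolding proj_eq_def by (intro exI[of _ "inverse c"]) simp
qed

lemma proj_eq_trans: "proj_eq u w \<Longrightarrow> proj_eq w x \<Longrightarrow> proj_eq u x"
proof -
  assume "proj_eq u w" "proj_eq w x"
  then obtain c d where "c \<noteq> 0" "u = c *\<^sub>R w" "d \<noteq> 0" "w = d *\<^sub>R x" by (auto simp: proj_eq_def)
  then show ?thesis unfolding proj_eq_def by (intro exI[of _ "c * d"]) simp
qed

lemma proj_eq_mult: "proj_eq u w \<Longrightarrow> proj_eq (M *v u) (M *v w)"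
  by (auto simp: proj_eq_def matrix_vector_mult_scaleR)

lemma proj_eq_scale: "k \<noteq> 0 \<Longrightarrow> proj_eq (k *\<^sub>R u) u" by (auto simp: proj_eq_def)

lemma phi_step': assumes \<xi>: "\<xi> \<in> \<Lambda>" shows "proj_eq (phi \<xi>) (W (lw (lt \<xi>)) *v phi (sh \<xi>))"
proof -
  have "H (lt \<xi>) *v phi (sh \<xi>) \<noteq> 0" using phi_nz[OF sh_limit[OF \<xi>]] by (simp add: H_eq_0)
  then show ?thesis unfolding phi_step[OF \<xi>] sgn_div_norm H_vec scaleR_scaleR
    using e[of "lt \<xi>"] by (intro proj_eq_scale) auto
qed

lemma phi_step_word:
  assumes "\<xi> \<in> \<Lambda>" "lw (lt \<xi>) = ws"
  shows "proj_eq (phi \<xi>) (W ws *v phi (sh \<xi>))"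
  using phi_step'[OF assms(1)] unfolding assms(2) .

text \<open>Three cases: the generator becomes a new first letter, it turns the first letter into
  the square, or the first letter is the square and gets cancelled. In the last case the cube is a
  scalar matrix.\<close>

lemma phi_gen: assumes \<xi>: "\<xi> \<in> \<Lambda>" shows "proj_eq (phi (bact [\<sigma>] \<xi>)) (W [\<sigma>] *v phi \<xi>)"
proof (cases "sd \<xi> = \<sigma>")
  case False
  let ?l = "(\<sigma>, True)"
  have lw: "lw ?l = [\<sigma>]" by (simp add: lw_def)
  have "lt (bact [\<sigma>] \<xi>) = ?l" "sh (bact [\<sigma>] \<xi>) = \<xi>"
    using lt_bact_lw[OF \<xi>, of ?l] False unfolding lw by simp_all
  then show ?thesis using phi_step_word[OF limit_bact[OF \<xi>], of "[\<sigma>]" "[\<sigma>]"] lw by simp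
next
  case True
  have s: "sh \<xi> \<in> \<Lambda>" "sd (sh \<xi>) \<noteq> \<sigma>" using ltI[OF \<xi>] sh_limit[OF \<xi>] True by auto
  have fl: "fst (lt \<xi>) = \<sigma>" using ltI(1)[OF \<xi>] True by simp
  show ?thesis
  proof (cases "snd (lt \<xi>)")
    case snd: True
    have l: "lw (lt \<xi>) = [\<sigma>]" using snd fl by (simp add: lw_def)
    have lw2: "lw (\<sigma>, False) = [\<sigma>,\<sigma>]" by (simp add: lw_def)
    have eq: "bact [\<sigma>] \<xi> = bact [\<sigma>,\<sigma>] (sh \<xi>)"
      using bact_sh[OF \<xi>] bact_append[of "sh \<xi>" "[\<sigma>]" "[\<sigma>]"] s(1) unfolding l by simp
    have "lt (bact [\<sigma>] \<xi>) = (\<sigma>, False)" and sh: "sh (bact [\<sigma>] \<xi>) = sh \<xi>"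
      unfolding eq using lt_bact_lw[OF s(1), of "(\<sigma>, False)"] s(2) unfolding lw2 by simp_all
    then have "proj_eq (phi (bact [\<sigma>] \<xi>)) (W [\<sigma>,\<sigma>] *v phi (sh \<xi>))"
      using phi_step_word[OF limit_bact[OF \<xi>], of "[\<sigma>]" "[\<sigma>,\<sigma>]"] lw2 by simp
    moreover have "W [\<sigma>,\<sigma>] *v phi (sh \<xi>) = W [\<sigma>] *v (W [\<sigma>] *v phi (sh \<xi>))"
      using W_append[of "[\<sigma>]" "[\<sigma>]" "phi (sh \<xi>)"] by simp
    ultimately have "proj_eq (phi (bact [\<sigma>] \<xi>)) (W [\<sigma>] *v (W [\<sigma>] *v phi (sh \<xi>)))" by simp
    then show ?thesis
      by (rule proj_eq_trans[OF _ proj_eq_sym[OF proj_eq_mult[OF phi_step_word[OF \<xi> l]]]])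
  next
    case snd: False
    have l: "lw (lt \<xi>) = [\<sigma>,\<sigma>]" using snd fl by (simp add: lw_def)
    have eq: "bact [\<sigma>] \<xi> = sh \<xi>"
      using bact_sh[OF \<xi>] bact_append[of "sh \<xi>" "[\<sigma>]" "[\<sigma>,\<sigma>]"] s(1) unfolding l by simp
    obtain k where k: "k \<noteq> 0" "\<And>x. W [\<sigma>,\<sigma>,\<sigma>] *v x = k *\<^sub>R (W [] *v x)" using W_cube[of \<sigma> "[]"] by blast
    have "W [\<sigma>] *v (W [\<sigma>,\<sigma>] *v phi (sh \<xi>)) = k *\<^sub>R phi (sh \<xi>)"
      using k(2)[of "phi (sh \<xi>)"] W_append[of "[\<sigma>]" "[\<sigma>,\<sigma>]" "phi (sh \<xi>)"] by simp
    then have "proj_eq (W [\<sigma>] *v (W [\<sigma>,\<sigma>] *v phi (sh \<xi>))) (phi (sh \<xi>))"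
      using proj_eq_scale[OF k(1)] by simp
    from proj_eq_sym[OF proj_eq_trans[OF proj_eq_mult[OF phi_step_word[OF \<xi> l]] this]]
    show ?thesis unfolding eq .
  qed
qed

lemma phi_equivariant: "\<xi> \<in> \<Lambda> \<Longrightarrow> proj_eq (phi (bact ws \<xi>)) (W ws *v phi \<xi>)"
proof (induction ws)
  case Nil then show ?case by (simp add: proj_eq_refl)
next
  case (Cons \<sigma> ws)
  have "bact (\<sigma> # ws) \<xi> = bact [\<sigma>] (bact ws \<xi>)" "W (\<sigma> # ws) *v phi \<xi> = W [\<sigma>] *v (W ws *v phi \<xi>)"
    using bact_append[of \<xi> "[\<sigma>]" ws] W_append[of "[\<sigma>]" ws] Cons.prems by simp_all
  then show ?case
    using proj_eq_trans[OF phi_gen[OF limit_bact[OF Cons.prems]] proj_eq_mult[OF Cons.IH[OF Cons.prems]]] by simp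
qed

text \<open>Up to scale the limit point is the image of a cone vector under its itinerary, which is
  the form in which \<open>contraction\<close> applies.\<close>

lemma phi_its:
  assumes \<xi>: "\<xi> \<in> \<Lambda>"
  shows "\<exists>u k. u \<in> fcone (F (endst (sd \<xi>) (its n \<xi>))) \<and> u \<noteq> 0 \<and> k \<noteq> 0 \<and> phi \<xi> = k *\<^sub>R (HL (its n \<xi>) *v u)"
proof -
  let ?u = "phi ((sh ^^ n) \<xi>)"
  have "proj_eq (phi \<xi>) (HL (its n \<xi>) *v ?u)"
    using \<xi>
  proof (induction n arbitrary: \<xi>)
    case 0 then show ?case by (simp add: proj_eq_refl)
  next
    case (Suc n)
    have "proj_eq (phi \<xi>) (H (lt \<xi>) *v phi (sh \<xi>))"
      unfolding phi_step[OF Suc.prems] sgn_div_norm using phi_nz[OF sh_limit[OF Suc.prems]]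
      by (intro proj_eq_scale) (simp add: H_eq_0)
    from proj_eq_trans[OF this proj_eq_mult[OF Suc.IH[OF sh_limit[OF Suc.prems]]]]
    show ?case by (simp add: funpow_swap1)
  qed
  then obtain k where "k \<noteq> 0" "phi \<xi> = k *\<^sub>R (HL (its n \<xi>) *v ?u)" by (auto simp: proj_eq_def)
  then show ?thesis
    using phi_cone[OF funpow_sh_limit[OF \<xi>], of n] phi_nz[OF funpow_sh_limit[OF \<xi>], of n] sd_funpow[OF \<xi>, of n]
    by (intro exI[of _ ?u] exI[of _ k]) simp
qed

definition near :: "complex \<Rightarrow> bool list set" where "near x = {ws. chd (act ws x) \<i> \<le> DD}"

text \<open>Taking all words that bring x near i, rather than one chosen word, makes the family of
  norms equivariant without a fundamental domain. The norm depends on the base point and not on the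
  direction of the unit vector.\<close>

definition nu :: "complex \<Rightarrow> real^3 \<Rightarrow> real^3 \<Rightarrow> real" where
  "nu x u y = Sup ((\<lambda>ws. pn (W ws *v u) (W ws *v y)) ` near x)"

text \<open>Words contain no inverse generators, so a generator is undone by two more copies of it,
  up to a scalar on the linear side.\<close>

lemma inverse_word: "\<exists>gi k. k \<noteq> 0 \<and> (\<forall>z. Im z > 0 \<longrightarrow> act gi (act g z) = z) \<and> (\<forall>x. W gi *v (W g *v x) = k *\<^sub>R x)"
proof (induction g)
  case Nil show ?case by (intro exI[of _ "[]"] exI[of _ 1]) simp
next
  case (Cons \<sigma> g)
  then obtain gi k where g: "k \<noteq> 0" "\<And>z. Im z > 0 \<Longrightarrow> act gi (act g z) = z" "\<And>x. W gi *v (W g *v x) = k *\<^sub>R x" by blast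
  obtain k' where k': "k' \<noteq> 0" "\<And>x. W (\<sigma> # \<sigma> # \<sigma> # g) *v x = k' *\<^sub>R (W g *v x)" using W_cube[of \<sigma> g] by blast
  have "act (gi @ [\<sigma>,\<sigma>]) (act (\<sigma> # g) z) = z" if "Im z > 0" for z
  proof -
    have "act (gi @ [\<sigma>,\<sigma>]) (act (\<sigma> # g) z) = act gi (act [\<sigma>,\<sigma>] (act [\<sigma>] (act g z)))"
      using act_append[of z "[\<sigma>]" g] act_append[OF act_Im[OF that], of gi "[\<sigma>,\<sigma>]" "\<sigma> # g"] that by simp
    also have "act [\<sigma>,\<sigma>] (act [\<sigma>] (act g z)) = act [\<sigma>,\<sigma>,\<sigma>] (act g z)"
      using act_append[OF act_Im[OF that], of "[\<sigma>,\<sigma>]" "[\<sigma>]" g] by simp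
    finally show ?thesis using g(2)[OF that] by simp
  qed
  moreover have "W (gi @ [\<sigma>,\<sigma>]) *v (W (\<sigma> # g) *v x) = (k' * k) *\<^sub>R x" for x
  proof -
    have "W [\<sigma>,\<sigma>] *v (W (\<sigma> # g) *v x) = k' *\<^sub>R (W g *v x)"
      using W_append[of "[\<sigma>,\<sigma>]" "\<sigma> # g" x] k'(2)[of x] by simp
    then show ?thesis using W_append[of gi "[\<sigma>,\<sigma>]"] g(3) by (simp add: matrix_vector_mult_scaleR)
  qed
  ultimately show ?case using g(1) k'(1)
    by (intro exI[of _ "gi @ [\<sigma>,\<sigma>]"] exI[of _ "k' * k"]) auto
qed

text \<open>Proper discontinuity: the words that bring a given point close to \<open>i\<close> differ by
  alternating words of bounded length, so the norms in the supremum are comparable.\<close>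

lemma near_comparable:
  obtains K where "K \<ge> 1" "\<And>x ws ws' u y. Im x > 0 \<Longrightarrow> ws \<in> near x \<Longrightarrow> ws' \<in> near x \<Longrightarrow> u \<noteq> 0 \<Longrightarrow>
     pn (W ws' *v u) (W ws' *v y) \<le> K * pn (W ws *v u) (W ws *v y)"
proof (rule constants)
  fix c C K :: real
  assume K: "K \<ge> 1" and Lip: "\<And>l u y. u \<noteq> 0 \<Longrightarrow> pn (H l *v u) (H l *v y) \<le> K * pn u y"
  have Lw: "pn (HL L *v u) (HL L *v y) \<le> K ^ length L * pn u y" if "u \<noteq> 0" for L u y
  proof (induction L)
    case (Cons l L)
    have "pn (HL (l # L) *v u) (HL (l # L) *v y) \<le> K * pn (HL L *v u) (HL L *v y)"
      using Lip[of "HL L *v u"] that by (simp add: HL_eq_0)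
    also have "\<dots> \<le> K * (K ^ length L * pn u y)" using Cons K by (intro mult_left_mono) auto
    finally show ?case by (simp add: mult.assoc)
  qed simp
  \<comment> \<open>By \<open>alternating_slope\<close> a normal form that moves i by a cosh
    distance of at most 2 DD^2 has at most this many letters.\<close>
  define n where "n = nat \<lceil>2 * DD * DD / shift\<rceil>"
  have "pn (W ws' *v u) (W ws' *v y) \<le> K ^ n * pn (W ws *v u) (W ws *v y)"
    if x: "Im x > 0" and w: "ws \<in> near x" "ws' \<in> near x" and u: "u \<noteq> 0" for x ws ws' u y
  proof -
    obtain gi k where g: "k \<noteq> 0" "\<And>z. Im z > 0 \<Longrightarrow> act gi (act ws z) = z" "\<And>x. W gi *v (W ws *v x) = k *\<^sub>R x"
      using inverse_word[of ws] by blast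
    let ?h = "ws' @ gi"
    \<comment> \<open>The rewriting has to respect both actions at once: equality on the half-plane
      and proportionality of the matrices.\<close>
    let ?P = "\<lambda>x y. (\<forall>z. Im z > 0 \<longrightarrow> act x z = act y z) \<and> (\<exists>k. k \<noteq> 0 \<and> (\<forall>u. W x *v u = k *\<^sub>R (W y *v u)))"
    have "\<exists>\<sigma> L. alternating \<sigma> L \<and> ?P ?h (wd L)"
    proof (rule word_reduce)
      show "?P ws ws" for ws by (auto intro: exI[of _ 1])
      show "?P x z" if "?P x y" "?P y z" for x y z
      proof -
        from that obtain k1 k2 where "k1 \<noteq> 0" "k2 \<noteq> 0" "\<And>u. W x *v u = k1 *\<^sub>R (W y *v u)" "\<And>u. W y *v u = k2 *\<^sub>R (W z *v u)" by blast
        then show ?thesis using that by (auto intro!: exI[of _ "k1 * k2"])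
      qed
      show "?P (\<sigma> # x) (\<sigma> # y)" if "?P x y" for \<sigma> x y
      proof -
        from that obtain k1 where "k1 \<noteq> 0" "\<And>u. W x *v u = k1 *\<^sub>R (W y *v u)" by blast
        then show ?thesis using that act_append[of _ "[\<sigma>]" x] act_append[of _ "[\<sigma>]" y]
            W_append[of "[\<sigma>]" x] W_append[of "[\<sigma>]" y]
          by (auto simp: matrix_vector_mult_scaleR intro!: exI[of _ k1])
      qed
      show "?P (\<sigma> # \<sigma> # \<sigma> # x) x" for \<sigma> x
        using W_cube[of \<sigma> x] act_append[of _ "[\<sigma>,\<sigma>,\<sigma>]" x] by simp
    qed
    then obtain \<sigma> L k1 where L: "alternating \<sigma> L" "\<And>z. Im z > 0 \<Longrightarrow> act ?h z = act (wd L) z"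
      "k1 \<noteq> 0" "\<And>u. W ?h *v u = k1 *\<^sub>R (W (wd L) *v u)" by blast
    obtain k2 where k2: "k2 \<noteq> 0" "\<And>x. HL L *v x = k2 *\<^sub>R (W (wd L) *v x)" using HL_word by blast
    have a1: "act ?h (act ws x) = act ws' x" using x g(2) by (simp add: act_append act_Im)
    have "length L * shift \<le> sg \<sigma> * slope (act ?h \<i>)" using alternating_slope[OF L(1)] L(2)[of \<i>] by simp
    also have "\<dots> \<le> \<bar>slope (act ?h \<i>)\<bar>" by (cases \<sigma>) auto
    also have "\<dots> \<le> chd (act ?h \<i>) \<i>" by (rule slope_le_chd[OF act_Im]) simp
    also have "\<dots> \<le> 2 * chd (act ?h \<i>) (act ?h (act ws x)) * chd (act ?h (act ws x)) \<i>"
      by (rule chd_quasi_triangle') (auto intro!: act_Im x)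
    also have "chd (act ?h \<i>) (act ?h (act ws x)) = chd (act ws x) \<i>"
      by (subst act_chd) (auto intro: act_Im x simp: chd_commute)
    also have "2 * chd (act ws x) \<i> * chd (act ?h (act ws x)) \<i> \<le> 2 * DD * DD"
      unfolding a1 using w chd_ge1[OF act_Im[OF x], of \<i>] unfolding near_def
      by (intro mult_mono) (auto intro: order_trans[OF zero_le_one] order_trans)
    finally have "length L \<le> 2 * DD * DD / shift" using shift_pos by (simp add: field_simps)
    then have n: "length L \<le> n" unfolding n_def by linarith
    have Wu: "W ws *v u \<noteq> 0" using u invertible_vec_eq_0[OF invertible_W] by simp
    have Wz: "W ws' *v z = (k1 / (k * k2)) *\<^sub>R (HL L *v (W ws *v z))" for z
    proof -
      have "W ?h *v (W ws *v z) = k *\<^sub>R (W ws' *v z)" by (simp add: W_append g(3) matrix_vector_mult_scaleR)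
      then have "k *\<^sub>R (W ws' *v z) = k1 *\<^sub>R (W (wd L) *v (W ws *v z))" using L(4) by simp
      then have "(1/k) *\<^sub>R (k *\<^sub>R (W ws' *v z)) = (1/k) *\<^sub>R (k1 *\<^sub>R (W (wd L) *v (W ws *v z)))" by simp
      then show ?thesis unfolding k2(2) using g(1) k2(1) by simp
    qed
    have "k1 / (k * k2) \<noteq> 0" using g(1) k2(1) L(3) by simp
    from pn_scale'[OF this] have "pn (W ws' *v u) (W ws' *v y) = pn (HL L *v (W ws *v u)) (HL L *v (W ws *v y))"
      by (simp only: Wz)
    also have "\<dots> \<le> K ^ length L * pn (W ws *v u) (W ws *v y)" by (rule Lw[OF Wu])
    also have "\<dots> \<le> K ^ n * pn (W ws *v u) (W ws *v y)"
      by (intro mult_right_mono pn_nonneg power_increasing n K)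
    finally show ?thesis .
  qed
  then show thesis using that[of "K ^ n"] K by (simp add: one_le_power)
qed

end

section \<open>Expansion along geodesics\<close>

lemma inner_transpose: "((M::real^'n^'n) *v x) \<bullet> w = x \<bullet> (transpose M *v w)"
  by (metis dot_lmul_matrix transpose_matrix_vector inner_commute transpose_transpose)

lemma invertible_transpose': "invertible (M::real^'n^'n) \<Longrightarrow> invertible (transpose M)"
  by (simp add: invertible_det_nz det_transpose)

lemma invT_inner: "invertible M \<Longrightarrow> (M *v x) \<bullet> (invT M *v y) = x \<bullet> y"
  unfolding inner_transpose invT_def
  by (simp add: matrix_vector_mul_assoc matrix_inv_both invertible_transpose')

lemma invT_mult:
  assumes "invertible M" "invertible N" shows "invT (M ** N) = invT M ** invT N"
  unfolding invT_def
proof (rule matrix_inv_eqI)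
  have "transpose (M ** N) ** (matrix_inv (transpose M) ** matrix_inv (transpose N))
     = transpose N ** (transpose M ** matrix_inv (transpose M)) ** matrix_inv (transpose N)"
    by (simp add: matrix_transpose_mul matrix_mul_assoc)
  then show "transpose (M ** N) ** (matrix_inv (transpose M) ** matrix_inv (transpose N)) = mat 1"
    using assms by (simp add: matrix_inv_both invertible_transpose')
qed

lemma invT_mat1: "invT (mat 1) = mat 1"
  unfolding invT_def by (rule matrix_inv_eqI) (simp add: transpose_mat)

lemma invertible_invT: "invertible M \<Longrightarrow> invertible (invT M)"
  unfolding invT_def using matrix_inv_both[OF invertible_transpose'[of M]] unfolding invertible_def by blast

lemma invertible_word_mat: "invertible A \<Longrightarrow> invertible B \<Longrightarrow> invertible (word_mat A B ws)"
proof (induction ws)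
  case Nil show ?case by (auto simp: invertible_def intro!: exI[of _ "mat 1"])
qed (simp add: word_mat_Cons invertible_mult)

lemma word_mat_invT:
  assumes "invertible A" "invertible B"
  shows "word_mat (invT A) (invT B) ws = invT (word_mat A B ws)"
  by (induction ws) (simp_all add: invT_mat1 word_mat_Cons invT_mult assms invertible_word_mat)

lemma continuous_on_pmat:
  assumes "continuous_on S f" "\<And>x. x \<in> S \<Longrightarrow> f x \<noteq> 0"
  shows "continuous_on S (\<lambda>x. pmat (f x))"
  unfolding pmat_def
  by (intro continuous_on_vec_lambda continuous_intros assms) (use assms(2) in auto)

context cone_rep
begin

lemma W_scaleR: "W ws *v (k *\<^sub>R x) = k *\<^sub>R (W ws *v x)" and W_add: "W ws *v (x + y) = W ws *v x + W ws *v y"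
  by (simp_all add: matrix_vector_mult_scaleR matrix_vector_right_distrib)

lemma W_eq_0: "W ws *v x = 0 \<longleftrightarrow> x = 0" by (rule invertible_vec_eq_0[OF invertible_W])

text \<open>All norms in the supremum are comparable with one constant, so the supremum is finite
  and comparable to each of them.\<close>

lemma nu_bounds:
  obtains K where "K \<ge> 1" "\<And>x ws u y. Im x > 0 \<Longrightarrow> ws \<in> near x \<Longrightarrow> u \<noteq> 0 \<Longrightarrow>
     pn (W ws *v u) (W ws *v y) \<le> nu x u y \<and> nu x u y \<le> K * pn (W ws *v u) (W ws *v y)"
proof (rule near_comparable)
  fix K :: real
  assume K: "K \<ge> 1" and c: "\<And>x ws ws' u y. Im x > 0 \<Longrightarrow> ws \<in> near x \<Longrightarrow> ws' \<in> near x \<Longrightarrow> u \<noteq> 0 \<Longrightarrow>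
     pn (W ws' *v u) (W ws' *v y) \<le> K * pn (W ws *v u) (W ws *v y)"
  show thesis
  proof (rule that[OF K])
    fix x ws and u y :: "real^3" assume x: "Im x > 0" "ws \<in> near x" "u \<noteq> 0"
    let ?S = "(\<lambda>ws. pn (W ws *v u) (W ws *v y)) ` near x"
    have b: "r \<le> K * pn (W ws *v u) (W ws *v y)" if "r \<in> ?S" for r
      using that c[OF x(1,2) _ x(3)] by auto
    then have "bdd_above ?S" unfolding bdd_above_def by blast
    then show "pn (W ws *v u) (W ws *v y) \<le> nu x u y \<and> nu x u y \<le> K * pn (W ws *v u) (W ws *v y)"
      unfolding nu_def using x(2) b by (intro conjI cSup_upper cSup_least) auto
  qed
qed

lemma nu_least: "near x \<noteq> {} \<Longrightarrow> (\<And>ws. ws \<in> near x \<Longrightarrow> pn (W ws *v u) (W ws *v y) \<le> r) \<Longrightarrow> nu x u y \<le> r"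
  unfolding nu_def by (rule cSup_least) auto

lemma nu_upper: "Im x > 0 \<Longrightarrow> ws \<in> near x \<Longrightarrow> u \<noteq> 0 \<Longrightarrow> pn (W ws *v u) (W ws *v y) \<le> nu x u y"
  by (rule nu_bounds) blast

lemma nu_scale: "c \<noteq> 0 \<Longrightarrow> nu x (c *\<^sub>R u) (c *\<^sub>R y + t *\<^sub>R u) = nu x u y"
  unfolding nu_def W_add W_scaleR by (simp add: pn_scale)

lemma nu_tangent_norm:
  assumes x: "Im x > 0" and ne: "near x \<noteq> {}" and u: "u \<noteq> 0"
  shows "tangent_norm u (nu x)"
proof -
  obtain ws where ws: "ws \<in> near x" using ne by blast
  note up = nu_upper[OF x _ u]
  have nn: "0 \<le> nu x u y" for y using up[OF ws, of y] pn_nonneg order_trans by blast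
  have z: "nu x u (t *\<^sub>R u) = 0" for t
  proof (rule antisym[OF nu_least[OF ne] nn])
    fix ws show "pn (W ws *v u) (W ws *v (t *\<^sub>R u)) \<le> 0"
      using u pn_eq_0[of "W ws *v u" "t *\<^sub>R (W ws *v u)"] by (auto simp: W_scaleR W_eq_0)
  qed
  have h: "nu x u (r *\<^sub>R y) \<le> \<bar>r\<bar> * nu x u y" for r y
  proof (rule nu_least[OF ne])
    fix ws assume "ws \<in> near x"
    then show "pn (W ws *v u) (W ws *v (r *\<^sub>R y)) \<le> \<bar>r\<bar> * nu x u y"
      unfolding W_scaleR pn_homogeneous using up by (intro mult_left_mono) auto
  qed
  have hom: "nu x u (r *\<^sub>R y) = \<bar>r\<bar> * nu x u y" for r y
  proof (cases "r = 0")
    case True then show ?thesis using z[of 0] by simp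
  next
    case False
    have "nu x u y \<le> \<bar>inverse r\<bar> * nu x u (r *\<^sub>R y)" using h[of "inverse r" "r *\<^sub>R y"] False by simp
    then have "\<bar>r\<bar> * nu x u y \<le> nu x u (r *\<^sub>R y)" using False by (simp add: field_simps)
    then show ?thesis using h[of r y] by linarith
  qed
  have "\<exists>t. y = t *\<^sub>R u" if "nu x u y = 0" for y
  proof -
    have "pn (W ws *v u) (W ws *v y) = 0" using up[OF ws, of y] that pn_nonneg[of "W ws *v u" "W ws *v y"] by linarith
    then obtain t where "W ws *v y = t *\<^sub>R (W ws *v u)" using pn_eq_0[of "W ws *v u"] u by (auto simp: W_eq_0)
    then have "W ws *v (y + (- t) *\<^sub>R u) = 0" unfolding W_add W_scaleR by simp
    then have "y = t *\<^sub>R u" by (simp add: W_eq_0)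
    then show ?thesis by blast
  qed
  moreover have "nu x u (y + z) \<le> nu x u y + nu x u z" for y z
  proof (rule nu_least[OF ne])
    fix ws assume w: "ws \<in> near x"
    show "pn (W ws *v u) (W ws *v (y + z)) \<le> nu x u y + nu x u z"
      unfolding W_add using pn_triangle[of "W ws *v u" "W ws *v y" "W ws *v z"] up[OF w, of y] up[OF w, of z] by linarith
  qed
  ultimately show ?thesis unfolding tangent_norm_def using nu_scale nn z hom by blast
qed

text \<open>Appending g to the words near \<open>act g x\<close> gives words near x, and appending
  an inverse word goes back. The scalars that arise do not change \<open>pn\<close>.\<close>

lemma nu_equivariant:
  assumes x: "Im x > 0"
  shows "nu (act g x) (W g *v u) (W g *v y) = nu x u y"
proof -
  obtain gi k where g: "k \<noteq> 0" "\<And>z. Im z > 0 \<Longrightarrow> act gi (act g z) = z" "\<And>x. W gi *v (W g *v x) = k *\<^sub>R x"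
    using inverse_word[of g] by blast
  have "(\<lambda>ws. pn (W ws *v (W g *v u)) (W ws *v (W g *v y))) ` near (act g x)
     = (\<lambda>ws. pn (W ws *v u) (W ws *v y)) ` near x" (is "?A = ?B")
  proof
    show "?A \<subseteq> ?B"
    proof
      fix r assume "r \<in> ?A"
      then obtain ws where "ws \<in> near (act g x)" "r = pn (W ws *v (W g *v u)) (W ws *v (W g *v y))" by blast
      then have "ws @ g \<in> near x" "r = pn (W (ws @ g) *v u) (W (ws @ g) *v y)"
        using x by (simp_all add: near_def act_append W_append)
      then show "r \<in> ?B" by blast
    qed
    show "?B \<subseteq> ?A"
    proof
      fix r assume "r \<in> ?B"
      then obtain ws where "ws \<in> near x" "r = pn (W ws *v u) (W ws *v y)" by blast
      then have "ws @ gi \<in> near (act g x)"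
        "r = pn (W (ws @ gi) *v (W g *v u)) (W (ws @ gi) *v (W g *v y))"
        using x g by (simp_all add: near_def act_append act_Im W_append W_scaleR pn_scale')
      then show "r \<in> ?A" by blast
    qed
  qed
  then show ?thesis unfolding nu_def by simp
qed

lemma W_lw_linv: "\<exists>k. k \<noteq> 0 \<and> (\<forall>x. W (lw l) *v (W (lw (linv l)) *v x) = k *\<^sub>R x)"
proof -
  have "lw l @ lw (linv l) = [fst l, fst l, fst l]" by (simp add: lw_def linv_def)
  then show ?thesis using W_cube[of "fst l" "[]"] W_append[of "lw l" "lw (linv l)"] by simp
qed

lemma HL_winv: "\<exists>k. k \<noteq> 0 \<and> (\<forall>x. HL L *v (W (winv L) *v x) = k *\<^sub>R x)"
proof (induction L)
  case Nil show ?case by (intro exI[of _ 1]) simp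
next
  case (Cons l L)
  then obtain k where k: "k \<noteq> 0" "\<And>x. HL L *v (W (winv L) *v x) = k *\<^sub>R x" by blast
  obtain k' where k': "k' \<noteq> 0" "\<And>x. W (lw l) *v (W (lw (linv l)) *v x) = k' *\<^sub>R x" using W_lw_linv by blast
  have "HL (l # L) *v (W (winv (l # L)) *v x) = (e l * k * k') *\<^sub>R x" for x
    by (simp add: W_append k k' H_vec W_scaleR)
  then show ?case using k(1) k'(1) e[of l] by (intro exI[of _ "e l * k * k'"]) auto
qed

lemma K0_pos: "K0 > 0"
proof -
  have "D0 > 0" using m0 by (simp add: D0_def)
  moreover have "D1 \<ge> 1" using letter_D1[of "(True,True)"] chd_ge1[OF act_Im, of \<i> \<i> "lw (True,True)"] by simp
  ultimately show ?thesis by (simp add: K0_def)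
qed

lemma geod_near:
  assumes "geod c \<xi>m \<xi>p" shows "near (c t) \<noteq> {}"
  using geodesic_itinerary[OF assms order_refl[of t]] unfolding near_def by blast

text \<open>Going back from t to s applies the first n letters of the itinerary of the head, and the
  limit point is the image of a cone vector under them, so \<open>pn\<close> shrinks by a multiple
  of \<kappa>^n. Read forwards this is expansion, since n grows linearly in t - s.\<close>

lemma expansion:
  obtains C a where "C > 0" "a > 0" "\<And>c \<xi>m \<xi>p s t y. geod c \<xi>m \<xi>p \<Longrightarrow> s \<le> t \<Longrightarrow>
    C * exp (a * (t - s)) * nu (c s) (phi \<xi>p) y \<le> nu (c t) (phi \<xi>p) y"
proof (rule nu_bounds, rule contraction)
  fix K C \<kappa> :: real
  assume K: "K \<ge> 1" "\<And>x ws u y. Im x > 0 \<Longrightarrow> ws \<in> near x \<Longrightarrow> u \<noteq> 0 \<Longrightarrow>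
     pn (W ws *v u) (W ws *v y) \<le> nu x u y \<and> nu x u y \<le> K * pn (W ws *v u) (W ws *v y)"
    and C: "C \<ge> 1" "0 < \<kappa>" "\<kappa> < 1" and
    con: "\<And>\<sigma> L u y. alternating \<sigma> L \<Longrightarrow> u \<in> fcone (F (endst \<sigma> L)) \<Longrightarrow> u \<noteq> 0 \<Longrightarrow>
      pn (HL L *v u) (HL L *v y) \<le> C * \<kappa> ^ length L * pn u y"
  \<comment> \<open>From n + 2 \<ge> (t - s) / K0 it follows that \<kappa>^n is at most exp (- a (t
    - s)) / \<kappa>^2.\<close>
  define a where "a = - ln \<kappa> / K0"
  have a: "a > 0" using C K0_pos by (simp add: a_def divide_neg_pos)
  have main: "nu (c s) (phi \<xi>p) y \<le> K * C / \<kappa>^2 * exp (- a * (t - s)) * nu (c t) (phi \<xi>p) y"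
    if g: "geod c \<xi>m \<xi>p" and st: "s \<le> t" for c \<xi>m \<xi>p s t y
  proof -
    obtain ws n where it: "chd (act ws (c s)) \<i> \<le> DD"
      "chd (act (winv (its n (bact ws \<xi>p))) (act ws (c t))) \<i> \<le> DD" "t - s \<le> (n + 2) * K0"
      using geodesic_itinerary[OF g st] by metis
    have p: "\<xi>p \<in> \<Lambda>" and im: "Im (c t) > 0" for t using geodD[OF g] by auto
    let ?\<xi> = "bact ws \<xi>p"
    have q: "?\<xi> \<in> \<Lambda>" by (rule limit_bact[OF p])
    let ?L = "its n ?\<xi>"
    define w where "w = winv ?L"
    define U where "U = W ws *v phi \<xi>p"
    define Y where "Y = W ws *v y"
    have ns: "ws \<in> near (c s)" using it(1) by (simp add: near_def)
    have nt: "w @ ws \<in> near (c t)" using it(2) im by (simp add: near_def act_append w_def)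
    have up: "nu (c s) (phi \<xi>p) y \<le> K * pn U Y"
      using K(2)[OF im ns phi_nz[OF p]] by (simp add: U_def Y_def)
    have lo: "pn (W w *v U) (W w *v Y) \<le> nu (c t) (phi \<xi>p) y"
      using nu_upper[OF im nt phi_nz[OF p], of y] by (simp add: U_def Y_def W_append)
    obtain u k where u: "u \<in> fcone (F (endst (sd ?\<xi>) ?L))" "u \<noteq> 0" "k \<noteq> 0" "phi ?\<xi> = k *\<^sub>R (HL ?L *v u)"
      using phi_its[OF q, of n] by blast
    obtain k1 where k1: "k1 \<noteq> 0" "U = k1 *\<^sub>R phi ?\<xi>"
      using proj_eq_sym[OF phi_equivariant[OF p, of ws]] unfolding proj_eq_def U_def by blast
    obtain k2 where k2: "k2 \<noteq> 0" "\<And>x. HL ?L *v (W w *v x) = k2 *\<^sub>R x" using HL_winv[of ?L] unfolding w_def by blast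
    define r where "r = k2 * k1 * k"
    have r: "r \<noteq> 0" using u(3) k1(1) k2(1) by (simp add: r_def)
    have "HL ?L *v (W w *v U - r *\<^sub>R u) = 0"
      using k1(2) k2(2) u(4) by (simp add: matrix_vector_mult_diff_distrib matrix_vector_mult_scaleR r_def)
    then have wU: "W w *v U = r *\<^sub>R u" by (simp add: HL_eq_0)
    let ?y = "inverse r *\<^sub>R (W w *v Y)"
    have "pn U Y = pn (k2 *\<^sub>R U) (k2 *\<^sub>R Y)" using k2(1) by (simp add: pn_scale')
    also have "\<dots> = pn (HL ?L *v (W w *v U)) (HL ?L *v (W w *v Y))" by (simp add: k2)
    also have "HL ?L *v (W w *v U) = r *\<^sub>R (HL ?L *v u)" by (simp add: wU matrix_vector_mult_scaleR)
    also have "HL ?L *v (W w *v Y) = r *\<^sub>R (HL ?L *v ?y)" using r by (simp add: matrix_vector_mult_scaleR)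
    also have "pn (r *\<^sub>R (HL ?L *v u)) (r *\<^sub>R (HL ?L *v ?y)) = pn (HL ?L *v u) (HL ?L *v ?y)" by (rule pn_scale'[OF r])
    also have "\<dots> \<le> C * \<kappa> ^ length ?L * pn u ?y" by (rule con[OF alternating_its[OF q] u(1,2)])
    also have "pn u ?y = pn (r *\<^sub>R u) (r *\<^sub>R ?y)" by (rule pn_scale'[OF r, symmetric])
    also have "\<dots> = pn (W w *v U) (W w *v Y)" using r by (simp add: wU)
    finally have 1: "pn U Y \<le> C * \<kappa> ^ n * pn (W w *v U) (W w *v Y)" by simp
    have kn: "\<kappa> ^ n \<le> exp (- a * (t - s)) / \<kappa>^2"
    proof -
      have "(t - s) / K0 \<le> real n + 2" using it(3) K0_pos by (simp add: field_simps)
      then have "(real n + 2) * ln \<kappa> \<le> (t - s) / K0 * ln \<kappa>" using C by (intro mult_right_mono_neg) auto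
      then have x1: "exp ((real n + 2) * ln \<kappa>) \<le> exp (- a * (t - s))" by (simp add: a_def mult.commute)
      have x2: "exp ((real n + 2) * ln \<kappa>) = \<kappa> ^ n * \<kappa>^2"
        using C exp_of_nat_mult[of "n + 2" "ln \<kappa>"] by (simp add: power_add add.commute power2_eq_square mult_ac)
      show ?thesis using x1 C unfolding x2 by (simp add: pos_le_divide_eq)
    qed
    have "nu (c s) (phi \<xi>p) y \<le> K * (C * \<kappa> ^ n * nu (c t) (phi \<xi>p) y)"
      using up 1 lo K(1) C by (smt (verit) mult_left_mono zero_le_power mult_nonneg_nonneg)
    also have "\<dots> = (K * C * nu (c t) (phi \<xi>p) y) * \<kappa> ^ n" by simp
    also have "\<dots> \<le> (K * C * nu (c t) (phi \<xi>p) y) * (exp (- a * (t - s)) / \<kappa>^2)"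
      using K(1) C order_trans[OF pn_nonneg lo] by (intro mult_left_mono[OF kn]) auto
    finally show ?thesis by (simp add: field_simps)
  qed
  show thesis
  proof (rule that[of "\<kappa>^2 / (K * C)" a])
    show "\<kappa>^2 / (K * C) > 0" using C K by simp
    fix c \<xi>m \<xi>p and s t :: real and y :: "real^3" assume gs: "geod c \<xi>m \<xi>p" "s \<le> t"
    have "\<kappa>^2 / (K * C) * exp (a * (t - s)) * nu (c s) (phi \<xi>p) y
      \<le> \<kappa>^2 / (K * C) * exp (a * (t - s)) * (K * C / \<kappa>^2 * exp (- a * (t - s)) * nu (c t) (phi \<xi>p) y)"
      using main[OF gs, of y] C K by (intro mult_left_mono) auto
    also have "\<dots> = (\<kappa>^2 / (K * C) * (K * C / \<kappa>^2)) * (exp (a * (t - s)) * exp (- a * (t - s))) * nu (c t) (phi \<xi>p) y"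
      by (simp only: mult_ac)
    also have "\<dots> = nu (c t) (phi \<xi>p) y" using C K by (simp add: exp_minus)
    finally show "\<kappa>^2 / (K * C) * exp (a * (t - s)) * nu (c s) (phi \<xi>p) y \<le> nu (c t) (phi \<xi>p) y" .
  qed (rule a)
qed

end

text \<open>The dual lifts are inverse transposes up to scalars, so the orthogonality of the base
  vectors passes to all approximations and to the limit, which is therefore a flag. The contraction
  of the second norm is the expansion of the dual representation along the reversed geodesic, whose
  head is \<xi>m.\<close>

lemma anosov_if_cones:
  assumes P: "cone_rep \<theta> A B e F v" and Q: "cone_rep \<theta> (invT A) (invT B) e' F' v'"
    and orth: "\<And>\<sigma>. v \<sigma> \<bullet> v' \<sigma> = 0"
  shows "anosov \<theta> A B"
proof -
  interpret P: cone_rep \<theta> A B e F v by (rule P)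
  interpret Q: cone_rep \<theta> "invT A" "invT B" e' F' v' by (rule Q)
  have QW: "Q.W ws = invT (P.W ws)" for ws
    unfolding P.W_def Q.W_def by (rule word_mat_invT[OF P.inv])
  have HLi: "(P.HL L *v x) \<bullet> (Q.HL L *v y) = 0" if "x \<bullet> y = 0" for L x y
  proof (induction L)
    case Nil then show ?case using that by simp
  next
    case (Cons l L)
    have "(P.H l *v x) \<bullet> (Q.H l *v y) = e l * e' l * (x \<bullet> y)" for x y
      by (simp add: P.H_vec Q.H_vec QW invT_inner P.invertible_W)
    then show ?case using Cons by simp
  qed
  have flag: "P.phi \<xi> \<bullet> Q.phi \<xi> = 0" if \<xi>: "\<xi> \<in> P.\<Lambda>" for \<xi>
  proof -
    have "P.phin n \<xi> \<bullet> Q.phin n \<xi> = 0" for n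
      unfolding P.phin_def Q.phin_def by (rule HLi[OF orth])
    then have "sgn (P.phin n \<xi>) \<bullet> sgn (Q.phin n \<xi>) = 0" for n by (simp add: sgn_div_norm)
    moreover have "(\<lambda>n. sgn (P.phin n \<xi>) \<bullet> sgn (Q.phin n \<xi>)) \<longlonglongrightarrow> P.phi \<xi> \<bullet> Q.phi \<xi>"
      by (intro tendsto_inner P.phi_lim Q.phi_lim \<xi>)
    ultimately show ?thesis by (simp add: LIMSEQ_const_iff)
  qed
  obtain C1 a1 where E1: "C1 > 0" "a1 > 0" "\<And>c \<xi>m \<xi>p s t y. P.geod c \<xi>m \<xi>p \<Longrightarrow> s \<le> t \<Longrightarrow>
    C1 * exp (a1 * (t - s)) * P.nu (c s) (P.phi \<xi>p) y \<le> P.nu (c t) (P.phi \<xi>p) y"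
    by (rule P.expansion) blast
  obtain C2 a2 where E2: "C2 > 0" "a2 > 0" "\<And>c \<xi>m \<xi>p s t y. P.geod c \<xi>m \<xi>p \<Longrightarrow> s \<le> t \<Longrightarrow>
    C2 * exp (a2 * (t - s)) * Q.nu (c s) (Q.phi \<xi>p) y \<le> Q.nu (c t) (Q.phi \<xi>p) y"
    by (rule Q.expansion) blast
  define C where "C = min C1 C2"
  define a where "a = min a1 a2"
  have Ca: "C > 0" "a > 0" using E1 E2 by (auto simp: C_def a_def)
  have tn: "tangent_norm (P.phi \<xi>p) (P.nu (c t))" "tangent_norm (Q.phi \<xi>m) (Q.nu (c t))"
    if g: "P.geod c \<xi>m \<xi>p" for c \<xi>m \<xi>p t
    using P.nu_tangent_norm[OF P.geodD(5)[OF g] P.geod_near[OF g] P.phi_nz]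
      Q.nu_tangent_norm[OF P.geodD(5)[OF g] Q.geod_near[OF g] Q.phi_nz] P.geodD(3,4)[OF g] by auto
  have eq: "P.nu (mob (word_mob \<theta> ws) (c t)) (word_mat A B ws *v x) (word_mat A B ws *v y) = P.nu (c t) x y"
    "Q.nu (mob (word_mob \<theta> ws) (c t)) (invT (word_mat A B ws) *v x) (invT (word_mat A B ws) *v y) = Q.nu (c t) x y"
    if g: "P.geod c \<xi>m \<xi>p" for c \<xi>m \<xi>p t ws x y
    using P.nu_equivariant[OF P.geodD(5)[OF g], where g = ws] Q.nu_equivariant[OF P.geodD(5)[OF g], where g = ws]
    unfolding QW unfolding P.W_def P.act_def by auto
  have ex: "C * exp (a * (t - s)) * P.nu (c s) (P.phi \<xi>p) y \<le> P.nu (c t) (P.phi \<xi>p) y"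
    if g: "P.geod c \<xi>m \<xi>p" and st: "s \<le> t" for c \<xi>m \<xi>p s t y
  proof -
    have "a * (t - s) \<le> a1 * (t - s)" using st by (intro mult_right_mono) (auto simp: a_def)
    moreover have "P.nu (c s) (P.phi \<xi>p) y \<ge> 0" using tn(1)[OF g] by (auto simp: tangent_norm_def)
    ultimately have "C * exp (a * (t - s)) * P.nu (c s) (P.phi \<xi>p) y
        \<le> C1 * exp (a1 * (t - s)) * P.nu (c s) (P.phi \<xi>p) y"
      using E1(1) by (intro mult_right_mono mult_mono) (auto simp: C_def)
    then show ?thesis using E1(3)[OF g st, of y] by linarith
  qed
  have co: "Q.nu (c t) (Q.phi \<xi>m) y \<le> (1 / C) * exp (- a * (t - s)) * Q.nu (c s) (Q.phi \<xi>m) y"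
    if g: "P.geod c \<xi>m \<xi>p" and st: "s \<le> t" for c \<xi>m \<xi>p s t y
  proof -
    have "a * (t - s) \<le> a2 * (t - s)" using st by (intro mult_right_mono) (auto simp: a_def)
    moreover have "Q.nu (c t) (Q.phi \<xi>m) y \<ge> 0" using tn(2)[OF g] by (auto simp: tangent_norm_def)
    ultimately have "C * exp (a * (t - s)) * Q.nu (c t) (Q.phi \<xi>m) y
        \<le> C2 * exp (a2 * (t - s)) * Q.nu (c t) (Q.phi \<xi>m) y"
      using E2(1) by (intro mult_right_mono mult_mono) (auto simp: C_def)
    moreover have "C2 * exp (a2 * (- s - - t)) * Q.nu (c (- (- t))) (Q.phi \<xi>m) y \<le> Q.nu (c (- (- s))) (Q.phi \<xi>m) y"
      using E2(3)[OF P.geod_reverse[OF g], of "- t" "- s" y] st by simp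
    ultimately have "C * exp (a * (t - s)) * Q.nu (c t) (Q.phi \<xi>m) y \<le> Q.nu (c s) (Q.phi \<xi>m) y" by simp
    then have "(1 / C) * exp (- a * (t - s)) * (C * exp (a * (t - s)) * Q.nu (c t) (Q.phi \<xi>m) y)
       \<le> (1 / C) * exp (- a * (t - s)) * Q.nu (c s) (Q.phi \<xi>m) y"
      using Ca(1) by (intro mult_left_mono) auto
    moreover have "(1 / C) * exp (- a * (t - s)) * (C * exp (a * (t - s)) * q) = q" for q
      using Ca(1) by (simp add: exp_minus)
    ultimately show ?thesis by simp
  qed
  show ?thesis
    unfolding anosov_def Let_def
  proof (intro exI conjI)
    show "\<forall>\<xi>\<in>P.\<Lambda>. P.phi \<xi> \<noteq> 0 \<and> Q.phi \<xi> \<noteq> 0 \<and> P.phi \<xi> \<bullet> Q.phi \<xi> = 0"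
      using P.phi_nz Q.phi_nz flag by blast
    show "continuous_on P.\<Lambda> (\<lambda>\<xi>. pmat (P.phi \<xi>))" by (rule continuous_on_pmat[OF P.phi_cont P.phi_nz])
    show "continuous_on P.\<Lambda> (\<lambda>\<xi>. pmat (Q.phi \<xi>))" by (rule continuous_on_pmat[OF Q.phi_cont Q.phi_nz])
    show "\<forall>ws. \<forall>\<xi>\<in>P.\<Lambda>. proj_eq (P.phi (bnd_act (word_mob \<theta> ws) \<xi>)) (word_mat A B ws *v P.phi \<xi>) \<and>
       proj_eq (Q.phi (bnd_act (word_mob \<theta> ws) \<xi>)) (invT (word_mat A B ws) *v Q.phi \<xi>)"
      using P.phi_equivariant Q.phi_equivariant unfolding QW unfolding P.W_def P.bact_def by blast
    show "0 < C" "0 < a" by (rule Ca)+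
    show "\<forall>c \<xi>m \<xi>p. is_geodesic c \<and> geod_ends c \<xi>m \<xi>p \<and> \<xi>m \<in> P.\<Lambda> \<and> \<xi>p \<in> P.\<Lambda> \<longrightarrow>
       (\<forall>t. tangent_norm (P.phi \<xi>p) ((\<lambda>z. P.nu (fst z)) (c t, vector_derivative c (at t))) \<and>
            tangent_norm (Q.phi \<xi>m) ((\<lambda>z. Q.nu (fst z)) (c t, vector_derivative c (at t)))) \<and>
       (\<forall>ws t y. (\<lambda>z. P.nu (fst z)) (mob (word_mob \<theta> ws) (c t), mob_deriv (word_mob \<theta> ws) (c t) * vector_derivative c (at t))
              (word_mat A B ws *v P.phi \<xi>p) (word_mat A B ws *v y) =
             (\<lambda>z. P.nu (fst z)) (c t, vector_derivative c (at t)) (P.phi \<xi>p) y \<and>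
            (\<lambda>z. Q.nu (fst z)) (mob (word_mob \<theta> ws) (c t), mob_deriv (word_mob \<theta> ws) (c t) * vector_derivative c (at t))
              (invT (word_mat A B ws) *v Q.phi \<xi>m) (invT (word_mat A B ws) *v y) =
             (\<lambda>z. Q.nu (fst z)) (c t, vector_derivative c (at t)) (Q.phi \<xi>m) y) \<and>
       (\<forall>s t y. s \<le> t \<longrightarrow>
           C * exp (a * (t - s)) * (\<lambda>z. P.nu (fst z)) (c s, vector_derivative c (at s)) (P.phi \<xi>p) y
             \<le> (\<lambda>z. P.nu (fst z)) (c t, vector_derivative c (at t)) (P.phi \<xi>p) y \<and>
           (\<lambda>z. Q.nu (fst z)) (c t, vector_derivative c (at t)) (Q.phi \<xi>m) y
             \<le> 1 / C * exp (- a * (t - s)) * (\<lambda>z. Q.nu (fst z)) (c s, vector_derivative c (at s)) (Q.phi \<xi>m) y)"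
      (is "\<forall>c \<xi>m \<xi>p. ?A c \<xi>m \<xi>p \<longrightarrow> ?G c \<xi>m \<xi>p")
    proof (intro allI impI)
      fix c \<xi>m \<xi>p assume "is_geodesic c \<and> geod_ends c \<xi>m \<xi>p \<and> \<xi>m \<in> P.\<Lambda> \<and> \<xi>p \<in> P.\<Lambda>"
      then have g: "P.geod c \<xi>m \<xi>p" by (simp add: P.geod_def)
      show "?G c \<xi>m \<xi>p"
        unfolding fst_conv using tn[OF g] eq[OF g] ex[OF g] co[OF g] by blast
    qed
  qed
qed

section \<open>The matrices of a convex box\<close>

lemma V3: "(vector [a,b,c] :: 'a::zero^3) $ 1 = a" "(vector [a,b,c] :: 'a^3) $ 2 = b" "(vector [a,b,c] :: 'a^3) $ 3 = c"
  by (rule vector_3)+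

lemmas mat3 = vec_eq_iff forall_3 matrix_matrix_mult_def matrix_vector_mult_def sum_3 transpose_def mat_def

lemma scaleR_matrix_mult: "(k *\<^sub>R M) ** N = k *\<^sub>R (M ** (N::real^'n^'n))" "M ** (k *\<^sub>R N) = k *\<^sub>R (M ** (N::real^'n^'n))"
  by (simp_all add: scalar_matrix_assoc[symmetric] matrix_scalar_ac)

lemma mult_vec_minus: "(M::real^'n^'m) *v (- x) = - (M *v x)"
  using matrix_vector_mult_scaleR[of M "- 1" x] by simp

lemma minus_mult_vec: "(- M) *v x = - ((M::real^'n^'m) *v x)"
  using scaleR_matrix_vector_assoc[of "- 1" M x] by simp

lemma A_cube: "A_Th t b ** A_Th t b ** A_Th t b = (- ((1 - t^2)^2 * (1 - b^2))) *\<^sub>R mat 1"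
  by (simp add: mat3 A_Th_def V3 power2_eq_square algebra_simps)

lemma invertible_cube:
  assumes "(M::real^'n^'n) ** M ** M = k *\<^sub>R mat 1" "k \<noteq> 0" shows "invertible M"
proof -
  have "M ** (inverse k *\<^sub>R (M ** M)) = mat 1"
    using assms by (simp add: scaleR_matrix_mult matrix_mul_assoc)
  then show ?thesis using invertible_right_inverse by blast
qed

lemma invT_cube:
  assumes "(M::real^3^3) ** M ** M = k *\<^sub>R mat 1" "k \<noteq> 0"
  shows "invT M = inverse k *\<^sub>R transpose (M ** M)"
  unfolding invT_def
proof (rule matrix_inv_eqI)
  have "transpose M ** (inverse k *\<^sub>R transpose (M ** M)) = inverse k *\<^sub>R transpose (M ** M ** M)"
    by (simp only: scaleR_matrix_mult matrix_transpose_mul)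
  then show "transpose M ** (inverse k *\<^sub>R transpose (M ** M)) = mat 1"
    using assms by (simp add: transpose_scalar transpose_mat)
qed

text \<open>Open cones over the two quadrilaterals with vertices p, q, r, s: \<open>inT\<close> is
  spanned by (\<plusminus>1,1,0) and (\<plusminus>1,0,1), \<open>inI\<close> by (\<plusminus>1,1,0)
  and (\<plusminus>1,0,-1). \<open>clT\<close> and \<open>clI\<close> are the closed cones.\<close>

definition inT :: "real^3 \<Rightarrow> bool" where "inT u \<longleftrightarrow> 0 < u$2 \<and> 0 < u$3 \<and> \<bar>u$1\<bar> < u$2 + u$3"
definition inI :: "real^3 \<Rightarrow> bool" where "inI u \<longleftrightarrow> 0 < u$2 \<and> u$3 < 0 \<and> \<bar>u$1\<bar> < u$2 - u$3"
definition clT :: "real^3 \<Rightarrow> bool" where "clT u \<longleftrightarrow> 0 \<le> u$2 \<and> 0 \<le> u$3 \<and> \<bar>u$1\<bar> \<le> u$2 + u$3"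
definition clI :: "real^3 \<Rightarrow> bool" where "clI u \<longleftrightarrow> 0 \<le> u$2 \<and> u$3 \<le> 0 \<and> \<bar>u$1\<bar> \<le> u$2 - u$3"

lemma inT_scale: "0 < k \<Longrightarrow> inT u \<Longrightarrow> inT (k *\<^sub>R u)"
  by (auto simp: inT_def abs_mult distrib_left[symmetric])

lemma inI_scale: "0 < k \<Longrightarrow> inI u \<Longrightarrow> inI (k *\<^sub>R u)"
  by (auto simp: inI_def abs_mult right_diff_distrib[symmetric] mult_pos_neg)

locale convex_box =
  fixes t b :: real
  assumes t: "- 1 < t" "t < 1" and b: "- 1 < b" "b < 1"
begin

lemma tb_pos: "0 < (1 - t) * (1 - b)" "0 < (1 - t) * (1 + b)" "0 < (1 + t) * (1 - b)" "0 < (1 + t) * (1 + b)"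
  "0 < 1 - t^2" "0 < 1 - b^2"
proof -
  show "0 < (1 - t) * (1 - b)" "0 < (1 - t) * (1 + b)" "0 < (1 + t) * (1 - b)" "0 < (1 + t) * (1 + b)"
    using t b by auto
  have "1 - t^2 = (1 - t) * (1 + t)" "1 - b^2 = (1 - b) * (1 + b)" by (simp_all add: power2_eq_square algebra_simps)
  then show "0 < 1 - t^2" "0 < 1 - b^2" using t b by auto
qed

definition "\<kappa>A = - ((1 - t^2)^2 * (1 - b^2))"

lemma \<kappa>A: "\<kappa>A < 0" "A_Th t b ** A_Th t b ** A_Th t b = \<kappa>A *\<^sub>R mat 1"
  using tb_pos A_cube[of t b] by (auto simp: \<kappa>A_def)

lemma inv_A: "invertible (A_Th t b)"
  using invertible_cube[OF \<kappa>A(2)] \<kappa>A(1) by simp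

lemma invT_A: "invT (A_Th t b) = inverse \<kappa>A *\<^sub>R transpose (A_Th t b ** A_Th t b)"
  using invT_cube[OF \<kappa>A(2)] \<kappa>A(1) by simp

lemma inv_D: "invertible (D_Th t b)"
proof -
  have "det (D_Th t b) = (1 - t^2) * (1 - b^2)"
    by (simp add: det_3 D_Th_def V3 power2_eq_square algebra_simps)
  then show ?thesis using tb_pos by (simp add: invertible_det_nz)
qed

lemma btx: "\<bar>b - t\<bar> < 1 - t * b" "\<bar>b + t\<bar> < 1 + t * b"
  using tb_pos(1-4) by (auto simp: algebra_simps abs_less_iff)

text \<open>The slanted inequalities for the image are combinations of those for u whose
  coefficients are products of 1 \<plusminus> t and 1 \<plusminus> b. Positivity of the second
  coordinate rests on |b - t| < 1 - tb, which says that (1 - b)(1 + t) and (1 + b)(1 - t) are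
  positive.\<close>

lemma A_inI:
  assumes "inI u" shows "inT (A_Th t b *v u)"
proof -
  define x y w where "x = u$1" and "y = u$2" and "w = - u$3"
  have u: "0 < y" "0 < w" "- (y + w) < x" "x < y + w" using assms by (auto simp: inI_def x_def y_def w_def)
  let ?v = "A_Th t b *v u"
  have c: "?v$1 = (t*b - 1)*x + t*(1 - t*b)*y - (b - t)*w" "?v$2 = (b - t)*x + (1 - t*b)*y + (1 - t*b)*w"
    "?v$3 = (1 - t^2)*y"
    by (simp_all add: A_Th_def matrix_vector_mult_def sum_3 V3 x_def y_def w_def algebra_simps)
  have "\<bar>(b - t) * x\<bar> \<le> \<bar>b - t\<bar> * (y + w)" unfolding abs_mult using u by (intro mult_left_mono) auto
  also have "\<dots> < (1 - t*b) * (y + w)" using btx(1) u by (intro mult_strict_right_mono) auto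
  finally have 2: "0 < ?v$2" unfolding c by (simp add: abs_less_iff algebra_simps)
  have 3: "0 < ?v$3" unfolding c using tb_pos u by simp
  have "?v$2 + ?v$3 - ?v$1 = (1 - t)*(1 + b)*(x + w + y) + (1 - t)*(1 + t)*(1 - b)*y"
    "?v$2 + ?v$3 + ?v$1 = (1 + t)*(1 - b)*(y + w - x) + (1 + t)*(1 - t)*(1 + b)*y"
    unfolding c by (simp_all add: power2_eq_square algebra_simps)
  moreover have "0 < (1 - t)*(1 + b)*(x + w + y)" "0 < (1 + t)*(1 - b)*(y + w - x)"
    "0 < (1 - t)*(1 + t)*(1 - b)*y" "0 < (1 + t)*(1 - t)*(1 + b)*y"
    using t b u by auto
  ultimately show ?thesis using 2 3 unfolding inT_def by linarith
qed

lemma AA_inI: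
  assumes "inI u" shows "inT (A_Th t b ** A_Th t b *v u)"
proof -
  define x y w where "x = u$1" and "y = u$2" and "w = - u$3"
  have u: "0 < y" "0 < w" "- (y + w) < x" "x < y + w" using assms by (auto simp: inI_def x_def y_def w_def)
  define v :: "real^3" where "v = vector [(1 - b*t)*x + (b - t)*y + b*(1 - b*t)*w, (1 - b^2)*w, (b - t)*x + (1 - b*t)*(y + w)]"
  have v: "A_Th t b ** A_Th t b *v u = (1 - t^2) *\<^sub>R v"
    by (simp add: mat3 A_Th_def V3 v_def x_def y_def w_def power2_eq_square algebra_simps)
  have "\<bar>(b - t) * x\<bar> \<le> \<bar>b - t\<bar> * (y + w)" unfolding abs_mult using u by (intro mult_left_mono) auto
  also have "\<dots> < (1 - t*b) * (y + w)" using btx(1) u by (intro mult_strict_right_mono) auto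
  finally have 3: "0 < v$3" unfolding v_def V3 by (simp add: abs_less_iff algebra_simps)
  have 2: "0 < v$2" unfolding v_def V3 using tb_pos u by simp
  have "v$2 + v$3 - v$1 = (1 + t)*(1 - b)*(y + w - x) + (1 - b)*(1 + b)*(1 - t)*w"
    "v$2 + v$3 + v$1 = (1 - t)*(1 + b)*(x + y + w) + (1 + b)*(1 - b)*(1 + t)*w"
    unfolding v_def V3 by (simp_all add: power2_eq_square algebra_simps)
  moreover have "0 < (1 + t)*(1 - b)*(y + w - x)" "0 < (1 - b)*(1 + b)*(1 - t)*w"
    "0 < (1 - t)*(1 + b)*(x + y + w)" "0 < (1 + b)*(1 - b)*(1 + t)*w"
    using t b u by auto
  ultimately have "inT v" using 2 3 unfolding inT_def by linarith
  then show ?thesis unfolding v using tb_pos by (intro inT_scale)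
qed

text \<open>Up to scalars \<open>Bx\<close> and \<open>By\<close> are the conjugate of the inverse
  transpose of A by D and its square: the image of IRI and its square before the conjugation by
  \<open>Sigma\<close>.\<close>

definition Bx :: "real^3^3" where
  "Bx = vector [vector [1 + b*t, - (b + t), - b*(1 + b*t)], vector [0, 0, 1 - b^2], vector [b + t, - (1 + b*t), - (1 + b*t)]]"
definition By :: "real^3^3" where
  "By = vector [vector [- (1 + b*t), t*(1 + b*t), b + t], vector [- (b + t), 1 + b*t, 1 + b*t], vector [0, - (1 - t^2), 0]]"

lemma Bx_D: "transpose (A_Th t b ** A_Th t b) ** D_Th t b = (1 - t^2) *\<^sub>R (D_Th t b ** Bx)"
  by (simp add: mat3 A_Th_def D_Th_def Bx_def V3 power2_eq_square algebra_simps)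

lemma Bx_sq: "Bx ** Bx = (- (1 - b^2)) *\<^sub>R By"
  by (simp add: mat3 Bx_def By_def V3 power2_eq_square algebra_simps)

lemma Bx_inT:
  assumes "inT u" shows "inI (Bx *v u)"
proof -
  define x y z where "x = u$1" and "y = u$2" and "z = u$3"
  have u: "0 < y" "0 < z" "- (y + z) < x" "x < y + z" using assms by (auto simp: inT_def x_def y_def z_def)
  let ?v = "Bx *v u"
  have c: "?v$1 = (1 + b*t)*x - (b + t)*y - b*(1 + b*t)*z" "?v$2 = (1 - b^2)*z"
    "?v$3 = (b + t)*x - (1 + b*t)*(y + z)"
    by (simp_all add: Bx_def matrix_vector_mult_def sum_3 V3 x_def y_def z_def algebra_simps)
  have "\<bar>(b + t) * x\<bar> \<le> \<bar>b + t\<bar> * (y + z)" unfolding abs_mult using u by (intro mult_left_mono) auto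
  also have "\<dots> < (1 + t*b) * (y + z)" using btx(2) u by (intro mult_strict_right_mono) auto
  finally have 3: "?v$3 < 0" unfolding c by (simp add: abs_less_iff mult.commute)
  have 2: "0 < ?v$2" unfolding c using tb_pos u by simp
  have "?v$2 - ?v$3 - ?v$1 = (1 + b)*(1 + t)*(y + z - x) + (1 + b)*(1 - b)*(1 - t)*z"
    "?v$2 - ?v$3 + ?v$1 = (1 - b)*(1 - t)*(x + y + z) + (1 - b)*(1 + b)*(1 + t)*z"
    unfolding c by (simp_all add: power2_eq_square algebra_simps)
  moreover have "0 < (1 + b)*(1 + t)*(y + z - x)" "0 < (1 + b)*(1 - b)*(1 - t)*z"
    "0 < (1 - b)*(1 - t)*(x + y + z)" "0 < (1 - b)*(1 + b)*(1 + t)*z"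
    using t b u by auto
  ultimately show ?thesis using 2 3 unfolding inI_def by linarith
qed

lemma By_inT:
  assumes "inT u" shows "inI (By *v u)"
proof -
  define x y z where "x = u$1" and "y = u$2" and "z = u$3"
  have u: "0 < y" "0 < z" "- (y + z) < x" "x < y + z" using assms by (auto simp: inT_def x_def y_def z_def)
  let ?v = "By *v u"
  have c: "?v$1 = - (1 + b*t)*x + t*(1 + b*t)*y + (b + t)*z" "?v$2 = - (b + t)*x + (1 + b*t)*(y + z)"
    "?v$3 = - (1 - t^2)*y"
    by (simp_all add: By_def matrix_vector_mult_def sum_3 V3 x_def y_def z_def algebra_simps)
  have "\<bar>(b + t) * x\<bar> \<le> \<bar>b + t\<bar> * (y + z)" unfolding abs_mult using u by (intro mult_left_mono) auto
  also have "\<dots> < (1 + t*b) * (y + z)" using btx(2) u by (intro mult_strict_right_mono) auto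
  finally have 2: "?v$2 > 0" unfolding c by (simp add: abs_less_iff algebra_simps)
  have 3: "?v$3 < 0" unfolding c using tb_pos u by (simp add: mult_neg_pos)
  have "?v$2 - ?v$3 - ?v$1 = (1 - b)*(1 - t)*(x + y + z) + (1 - t)*(1 + b)*(1 + t)*y"
    "?v$2 - ?v$3 + ?v$1 = (1 + b)*(1 + t)*(y + z - x) + (1 + t)*(1 - b)*(1 - t)*y"
    unfolding c by (simp_all add: power2_eq_square algebra_simps)
  moreover have "0 < (1 - b)*(1 - t)*(x + y + z)" "0 < (1 - t)*(1 + b)*(1 + t)*y"
    "0 < (1 + b)*(1 + t)*(y + z - x)" "0 < (1 + t)*(1 - b)*(1 - t)*y"
    using t b u by auto
  ultimately show ?thesis using 2 3 unfolding inI_def by linarith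
qed

end

section \<open>The second generator as a conjugate\<close>

lemma conjugate_mult:
  fixes P Pi X Y :: "real^'n^'n"
  assumes "P ** Pi = mat 1" shows "(Pi ** X ** P) ** (Pi ** Y ** P) = Pi ** (X ** Y) ** P"
proof -
  have "(Pi ** X ** P) ** (Pi ** Y ** P) = Pi ** X ** (P ** Pi) ** Y ** P" by (simp add: matrix_mul_assoc)
  then show ?thesis using assms by (simp add: matrix_mul_assoc)
qed

lemma invT_scaleR:
  assumes "k \<noteq> 0" shows "invT (k *\<^sub>R mat 1) = inverse k *\<^sub>R (mat 1 :: real^3^3)"
  unfolding invT_def by (rule matrix_inv_eqI) (simp add: assms transpose_scalar transpose_mat scaleR_matrix_mult)

lemma invT_cube_scalar:
  assumes "(M::real^3^3) ** M ** M = k *\<^sub>R mat 1" "k \<noteq> 0"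
  shows "invT M ** invT M ** invT M = inverse k *\<^sub>R mat 1"
proof -
  have i: "invertible M" by (rule invertible_cube[OF assms])
  have "invT M ** invT M ** invT M = invT (M ** M ** M)"
    using i by (simp add: invT_mult invertible_mult)
  then show ?thesis using assms by (simp add: invT_scaleR)
qed

lemma Sigma_det: "det (Sigma e d) = 1"
proof -
  have e1: "exp (-d) * cosh e * (exp d * cosh e) = cosh e * cosh e" by (simp add: exp_minus)
  show ?thesis using cosh_square_eq[of e]
    by (simp add: det_3 Sigma_def V3 e1 power2_eq_square)
qed

lemma inv_Sigma: "invertible (Sigma e d)"
  using Sigma_det by (simp add: invertible_det_nz)

lemma Sigma_inv: "matrix_inv (Sigma e d) = vector [vector [1, 0, 0], vector [0, exp d * cosh e, sinh e],
    vector [0, sinh e, exp (-d) * cosh e]]"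
proof (rule matrix_inv_eqI)
  have "exp (-d) * exp d = 1" by (simp add: exp_minus)
  then have "exp (-d) * (cosh e * (exp d * cosh e)) = cosh e * cosh e"
     "exp d * (cosh e * (exp (-d) * cosh e)) = cosh e * cosh e"
    by (simp_all add: exp_minus)
  moreover have "cosh e * cosh e = 1 + sinh e * sinh e" using cosh_square_eq[of e] by (simp add: power2_eq_square)
  ultimately show "Sigma e d ** vector [vector [1, 0, 0], vector [0, exp d * cosh e, sinh e],
    vector [0, sinh e, exp (-d) * cosh e]] = mat 1"
    by (simp add: mat3 Sigma_def V3 algebra_simps)
qed

locale shifted_box = convex_box +
  fixes e d :: real
begin

definition "P0 = D_Th t b ** Sigma e d"

lemma inv_P: "invertible P0"
  unfolding P0_def by (intro invertible_mult inv_D inv_Sigma)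

lemma B_conj: "B_lam t b e d = matrix_inv P0 ** invT (A_Th t b) ** P0"
proof -
  have "matrix_inv P0 = matrix_inv (Sigma e d) ** matrix_inv (D_Th t b)"
  proof (rule matrix_inv_eqI)
    have "P0 ** (matrix_inv (Sigma e d) ** matrix_inv (D_Th t b))
       = D_Th t b ** (Sigma e d ** matrix_inv (Sigma e d)) ** matrix_inv (D_Th t b)"
      unfolding P0_def by (simp add: matrix_mul_assoc)
    then show "P0 ** (matrix_inv (Sigma e d) ** matrix_inv (D_Th t b)) = mat 1"
      using inv_Sigma[of e d] inv_D by (simp add: matrix_inv_both)
  qed
  then show ?thesis unfolding B_lam_def P0_def by (simp add: matrix_mul_assoc)
qed

lemma B_cube: "B_lam t b e d ** B_lam t b e d ** B_lam t b e d = inverse (\<kappa>A) *\<^sub>R mat 1"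
proof -
  have k: "\<kappa>A \<noteq> 0" using \<kappa>A by simp
  show ?thesis
    unfolding B_conj conjugate_mult[OF matrix_inv_both(1)[OF inv_P]] invT_cube_scalar[OF \<kappa>A(2) k]
    using matrix_inv_both[OF inv_P] by (simp add: scaleR_matrix_mult)
qed

lemma inv_B: "invertible (B_lam t b e d)"
  using invertible_cube[OF B_cube] \<kappa>A by simp

text \<open>\<open>Sigma\<close> conjugates the second generator to a multiple of \<open>Bx\<close>,
  so its ping-pong can be verified in the unshifted coordinates. The scalar is negative because
  \<open>\<kappa>A\<close> is.\<close>

lemma Sigma_B: "Sigma e d *v (B_lam t b e d *v u) = ((1 - t^2) / \<kappa>A) *\<^sub>R (Bx *v (Sigma e d *v u))"
proof -
  let ?D = "D_Th t b" and ?S = "Sigma e d" and ?X = "invT (A_Th t b)"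
  have "?X ** ?D = ((1 - t^2) / \<kappa>A) *\<^sub>R (?D ** Bx)"
    unfolding invT_A scaleR_matrix_mult Bx_D by (simp add: divide_inverse mult.commute)
  then have "matrix_inv ?D ** (?X ** ?D) = ((1 - t^2) / \<kappa>A) *\<^sub>R ((matrix_inv ?D ** ?D) ** Bx)"
    by (simp only: scaleR_matrix_mult matrix_mul_assoc)
  then have 1: "matrix_inv ?D ** (?X ** ?D) = ((1 - t^2) / \<kappa>A) *\<^sub>R Bx"
    using matrix_inv_both[OF inv_D] by simp
  have "?S ** B_lam t b e d = (?S ** matrix_inv ?S) ** (matrix_inv ?D ** (?X ** ?D)) ** ?S"
    unfolding B_lam_def by (simp only: matrix_mul_assoc)
  then have "?S ** B_lam t b e d = ((1 - t^2) / \<kappa>A) *\<^sub>R (Bx ** ?S)"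
    using matrix_inv_both[OF inv_Sigma] by (simp add: 1 scaleR_matrix_mult)
  then show ?thesis by (simp add: matrix_vector_mul_assoc scaleR_matrix_vector_assoc)
qed

lemma Sigma_BB: "Sigma e d *v (B_lam t b e d ** B_lam t b e d *v u)
   = (- (((1 - t^2) / \<kappa>A)^2 * (1 - b^2))) *\<^sub>R (By *v (Sigma e d *v u))"
proof -
  let ?k = "(1 - t^2) / \<kappa>A"
  have "Sigma e d *v (B_lam t b e d ** B_lam t b e d *v u) = (?k * ?k) *\<^sub>R (Bx ** Bx *v (Sigma e d *v u))"
    by (simp add: matrix_vector_mul_assoc[symmetric] Sigma_B matrix_vector_mult_scaleR)
  moreover have "?k * ?k * (- (1 - b^2)) = - (?k^2 * (1 - b^2))"
    by (simp only: power2_eq_square mult_minus_right)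
  ultimately show ?thesis unfolding Bx_sq
    by (simp only: scaleR_matrix_vector_assoc[symmetric] scaleR_scaleR)
qed

end

section \<open>Functionals, extremal rays and polar cones\<close>

definition FT :: "(real^3) set" where "FT = {vector [0,1,0], vector [0,0,1], vector [1,1,1], vector [-1,1,1]}"
definition FI :: "(real^3) set" where "FI = {vector [0,1,0], vector [0,0,-1], vector [1,1,-1], vector [-1,1,-1]}"
definition RT :: "(real^3) set" where "RT = {vector [-1,1,0], vector [1,1,0], vector [1,0,1], vector [-1,0,1]}"
definition RI :: "(real^3) set" where "RI = {vector [-1,1,0], vector [1,1,0], vector [-1,0,-1], vector [1,0,-1]}"

lemma inner_V3: "(vector [a,b,c] :: real^3) \<bullet> u = a * u$1 + b * u$2 + c * u$3"
  by (simp add: inner_vec_def sum_3 V3)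

lemma fcone_T: "u \<in> fcone FT \<longleftrightarrow> clT u" and fcone_I: "u \<in> fcone FI \<longleftrightarrow> clI u"
  by (auto simp: fcone_def FT_def FI_def clT_def clI_def inner_V3)

lemma int_T: "(\<forall>f\<in>FT. 0 < f \<bullet> u) \<longleftrightarrow> inT u" and int_I: "(\<forall>f\<in>FI. 0 < f \<bullet> u) \<longleftrightarrow> inI u"
  by (auto simp: FT_def FI_def inT_def inI_def inner_V3)

lemma separating:
  "\<forall>f\<in>FT. f \<bullet> u = 0 \<Longrightarrow> u = 0" "\<forall>f\<in>FI. f \<bullet> u = 0 \<Longrightarrow> u = 0"
  "\<forall>f\<in>RT. f \<bullet> u = 0 \<Longrightarrow> u = 0" "\<forall>f\<in>RI. f \<bullet> u = 0 \<Longrightarrow> u = 0"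
  unfolding FT_def FI_def RT_def RI_def vec_eq_iff forall_3
  by (auto simp: inner_V3)

lemma RT_cone: "r \<in> RT \<Longrightarrow> clT r" and RI_cone: "r \<in> RI \<Longrightarrow> clI r"
  by (auto simp: RT_def RI_def clT_def clI_def V3)

lemma dual_positive:
  fixes a1 a2 a3 a4 p q r s :: real
  assumes "0 < a1" "0 < a2" "0 < a3" "0 < a4" "0 \<le> p" "0 \<le> q" "0 \<le> r" "0 \<le> s"
    and "\<not> (p = 0 \<and> q = 0 \<and> r = 0 \<and> s = 0)"
  shows "0 < a1 * p + a2 * q + a3 * r + a4 * s"
proof -
  have nn: "0 \<le> a1 * p" "0 \<le> a2 * q" "0 \<le> a3 * r" "0 \<le> a4 * s" using assms by auto
  have "0 < a1 * p \<or> 0 < a2 * q \<or> 0 < a3 * r \<or> 0 < a4 * s" using assms by (auto simp: less_le)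
  then show ?thesis using nn by linarith
qed

text \<open>An interior point is a combination of all four rays with positive coefficients: x2 is
  distributed over the first two rays and x3 over the other two, with weights (1 \<plusminus> l) / 2
  where l = x1 / (x2 + x3).\<close>

lemma dual_T:
  assumes x: "inT x" and w: "w \<noteq> 0" "\<forall>r\<in>RT. 0 \<le> r \<bullet> w" shows "0 < x \<bullet> w"
proof -
  define l where "l = x$1 / (x$2 + x$3)"
  have p: "0 < x$2" "0 < x$3" "\<bar>x$1\<bar> < x$2 + x$3" using x by (auto simp: inT_def)
  have l: "- 1 < l" "l < 1" "x$1 = l * (x$2 + x$3)" using p by (auto simp: l_def field_simps abs_less_iff)
  have "0 < (x$2 * (1 - l) / 2) * (- w$1 + w$2) + (x$2 * (1 + l) / 2) * (w$1 + w$2)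
      + (x$3 * (1 + l) / 2) * (w$1 + w$3) + (x$3 * (1 - l) / 2) * (- w$1 + w$3)"
  proof (rule dual_positive)
    show "\<not> (- w$1 + w$2 = 0 \<and> w$1 + w$2 = 0 \<and> w$1 + w$3 = 0 \<and> - w$1 + w$3 = 0)"
      using w(1) unfolding vec_eq_iff forall_3 by auto
  qed (use p l w(2) in \<open>auto simp: RT_def inner_V3\<close>)
  also have "\<dots> = x \<bullet> w" unfolding inner_vec_def sum_3 l(3) by (simp add: field_simps)
  finally show ?thesis .
qed

lemma dual_I:
  assumes x: "inI x" and w: "w \<noteq> 0" "\<forall>r\<in>RI. 0 \<le> r \<bullet> w" shows "0 < x \<bullet> w"
proof -
  define l where "l = x$1 / (x$2 - x$3)"
  have p: "0 < x$2" "x$3 < 0" "\<bar>x$1\<bar> < x$2 - x$3" using x by (auto simp: inI_def)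
  have l: "- 1 < l" "l < 1" "x$1 = l * (x$2 - x$3)" using p by (auto simp: l_def field_simps abs_less_iff)
  have "0 < (x$2 * (1 - l) / 2) * (- w$1 + w$2) + (x$2 * (1 + l) / 2) * (w$1 + w$2)
      + (- x$3 * (1 - l) / 2) * (- w$1 - w$3) + (- x$3 * (1 + l) / 2) * (w$1 - w$3)"
  proof (rule dual_positive)
    show "\<not> (- w$1 + w$2 = 0 \<and> w$1 + w$2 = 0 \<and> - w$1 - w$3 = 0 \<and> w$1 - w$3 = 0)"
      using w(1) unfolding vec_eq_iff forall_3 by auto
  qed (use p l w(2) in \<open>auto simp: RI_def inner_V3 mult_neg_pos\<close>)
  also have "\<dots> = x \<bullet> w" unfolding inner_vec_def sum_3 l(3) by (simp add: field_simps)
  finally show ?thesis .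
qed

text \<open>Up to a scalar the inverse transpose of a letter is the transpose of the letter
  \<open>linv l\<close>. Transposition reverses the direction between the two polar cones, so side
  \<sigma> of the dual data is the polar of the cone of the opposite side.\<close>

lemma cone_rep_dual:
  assumes P: "cone_rep \<theta> A B e F v"
    and E: "\<And>\<sigma>. finite (E \<sigma>)" "\<And>\<sigma> x. x \<in> E \<sigma> \<Longrightarrow> x \<in> fcone (F \<sigma>) \<and> x \<noteq> 0"
      "\<And>\<sigma> w. (\<And>x. x \<in> E \<sigma> \<Longrightarrow> x \<bullet> w = 0) \<Longrightarrow> w = 0"
    and dp: "\<And>\<sigma> x w. (\<And>f. f \<in> F \<sigma> \<Longrightarrow> 0 < f \<bullet> x) \<Longrightarrow> w \<noteq> 0 \<Longrightarrow> (\<And>r. r \<in> E \<sigma> \<Longrightarrow> 0 \<le> r \<bullet> w) \<Longrightarrow> 0 < x \<bullet> w"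
    and v': "\<And>\<sigma>. v' \<sigma> \<in> fcone (E (\<not> \<sigma>))" "\<And>\<sigma>. v' \<sigma> \<noteq> 0"
  shows "\<exists>e'. cone_rep \<theta> (invT A) (invT B) e' (\<lambda>\<sigma>. E (\<not> \<sigma>)) v'"
proof -
  interpret P: cone_rep \<theta> A B e F v by (rule P)
  have "\<forall>l. \<exists>k. k \<noteq> 0 \<and> P.W (lw (linv l)) ** P.W (lw l) = k *\<^sub>R mat 1"
  proof
    fix l
    obtain k where "k \<noteq> 0" "\<And>x. P.W (lw (linv l)) *v (P.W (lw l) *v x) = k *\<^sub>R x"
      using P.W_lw_linv[of "linv l"] by auto
    then show "\<exists>k. k \<noteq> 0 \<and> P.W (lw (linv l)) ** P.W (lw l) = k *\<^sub>R mat 1"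
      by (intro exI[of _ k]) (simp add: matrix_eq matrix_vector_mul_assoc[symmetric] scaleR_matrix_vector_assoc[symmetric])
  qed
  then obtain k where k: "\<And>l. k l \<noteq> 0" "\<And>l. P.W (lw (linv l)) ** P.W (lw l) = k l *\<^sub>R mat 1" by metis
  define e' where "e' l = k l * e (linv l)" for l
  have eW: "e' l *\<^sub>R word_mat (invT A) (invT B) (lw l) = transpose (P.H (linv l))" for l
  proof -
    have "invT (P.W (lw l)) = inverse (k l) *\<^sub>R transpose (P.W (lw (linv l)))"
      unfolding invT_def
    proof (rule matrix_inv_eqI)
      show "transpose (P.W (lw l)) ** (inverse (k l) *\<^sub>R transpose (P.W (lw (linv l)))) = mat 1"
        using k[of l] by (simp add: scaleR_matrix_mult matrix_transpose_mul[symmetric] transpose_scalar transpose_mat)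
    qed
    then show ?thesis using k(1)[of l]
      by (simp add: word_mat_invT P.inv P.W_def[symmetric] e'_def P.H_def transpose_scalar)
  qed
  have "cone_rep \<theta> (invT A) (invT B) e' (\<lambda>\<sigma>. E (\<not> \<sigma>)) v'"
  proof unfold_locales
    show "invertible (invT A)" "invertible (invT B)" using P.inv invertible_invT by auto
    show "\<exists>k. k \<noteq> 0 \<and> invT A ** invT A ** invT A = k *\<^sub>R mat 1" "\<exists>k. k \<noteq> 0 \<and> invT B ** invT B ** invT B = k *\<^sub>R mat 1"
      using P.cube invT_cube_scalar by (metis nonzero_imp_inverse_nonzero)+
    show "e' l \<noteq> 0" for l using k(1) P.e by (simp add: e'_def)
    show "finite (E (\<not> \<sigma>))" for \<sigma> by (rule E)
    show "u = 0" if "\<And>f. f \<in> E (\<not> \<sigma>) \<Longrightarrow> f \<bullet> u = 0" for \<sigma> u using E(3) that by blast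
    show "v' \<sigma> \<in> fcone (E (\<not> \<sigma>))" "v' \<sigma> \<noteq> 0" for \<sigma> by (rule v')+
    show "0 < f \<bullet> (e' l *\<^sub>R word_mat (invT A) (invT B) (lw l) *v u)"
      if u: "u \<in> fcone (E (\<not> (\<not> fst l)))" "u \<noteq> 0" and f: "f \<in> E (\<not> fst l)" for u l f
    proof -
      have "0 < (P.H (linv l) *v f) \<bullet> u"
      proof (rule dp[of "fst l"])
        show "0 < g \<bullet> (P.H (linv l) *v f)" if "g \<in> F (fst l)" for g
          using P.H_cone[of f "linv l" g] E(2)[OF f] that by simp
      qed (use u in \<open>auto simp: fcone_def\<close>)
      then show ?thesis unfolding eW inner_transpose .
    qed
  qed
  then show ?thesis by blast
qed

text \<open>The lower block of \<open>Sigma\<close> has positive entries and column sums greater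
  than 1. So on the closed cone it increases x2 + x3 and makes both coordinates positive, while x1
  stays fixed: the closed cone enters its interior.\<close>

locale nested_box = shifted_box +
  assumes sh: "sinh e < 0" and yz: "exp (-d) * cosh e - sinh e > 1" "exp d * cosh e - sinh e > 1"
begin

definition "y = exp (-d) * cosh e"
definition "z = exp d * cosh e"

lemma yz_pos: "y > 0" "z > 0" by (simp_all add: y_def z_def)

lemma Sigma_vec: "Sigma e d *v u = vector [u$1, y * u$2 - sinh e * u$3, - sinh e * u$2 + z * u$3]"
  by (simp add: mat3 Sigma_def V3 y_def z_def)

lemma Sigma_inv_vec: "matrix_inv (Sigma e d) *v u = vector [u$1, z * u$2 + sinh e * u$3, sinh e * u$2 + y * u$3]"
  by (simp add: mat3 Sigma_inv V3 y_def z_def)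

lemma Sigma_cancel: "Sigma e d *v (matrix_inv (Sigma e d) *v u) = u" "matrix_inv (Sigma e d) *v (Sigma e d *v u) = u"
  using matrix_inv_both[OF inv_Sigma] by (simp_all add: matrix_vector_mul_assoc)

text \<open>After a sign change of the third coordinate the inverse of \<open>Sigma\<close> has the
  same block with y and z exchanged. The doubled conclusions serve \<open>clT\<close> under
  \<open>Sigma\<close> and \<open>clI\<close> under the inverse.\<close>

lemma expand:
  fixes p q :: real
  assumes "0 \<le> p" "0 \<le> q" "\<not> (p = 0 \<and> q = 0)"
  shows "0 < y * p - sinh e * q" "0 < z * q - sinh e * p" "0 < z * p - sinh e * q" "0 < y * q - sinh e * p"
    "p + q < (y - sinh e) * p + (z - sinh e) * q" "p + q < (z - sinh e) * p + (y - sinh e) * q"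
proof -
  have nn: "0 \<le> y * p" "0 \<le> z * q" "0 \<le> z * p" "0 \<le> y * q" "sinh e * p \<le> 0" "sinh e * q \<le> 0"
    using assms sh yz_pos by (auto simp: mult_nonpos_nonneg)
  consider "p > 0" | "q > 0" using assms by force
  then have st: "0 < y * p - sinh e * q \<and> 0 < z * q - sinh e * p \<and> 0 < z * p - sinh e * q \<and> 0 < y * q - sinh e * p"
  proof cases
    case 1
    then have "0 < y * p" "0 < z * p" "sinh e * p < 0" using yz_pos sh by (auto simp: mult_neg_pos)
    then show ?thesis using nn by linarith
  next
    case 2
    then have "0 < y * q" "0 < z * q" "sinh e * q < 0" using yz_pos sh by (auto simp: mult_neg_pos)
    then show ?thesis using nn by linarith
  qed
  then show "0 < y * p - sinh e * q" "0 < z * q - sinh e * p" "0 < z * p - sinh e * q" "0 < y * q - sinh e * p" by auto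
  have "0 < (y - sinh e - 1) * p + (z - sinh e - 1) * q + 0 * 0 + 0 * 0 \<and> 0 < (z - sinh e - 1) * p + (y - sinh e - 1) * q + 0 * 0 + 0 * 0"
  proof -
    have yz': "y - sinh e - 1 > 0" "z - sinh e - 1 > 0" using yz by (simp_all add: y_def z_def)
    have n: "0 \<le> (y - sinh e - 1) * p" "0 \<le> (z - sinh e - 1) * q" "0 \<le> (z - sinh e - 1) * p" "0 \<le> (y - sinh e - 1) * q"
      using yz' assms by auto
    have "0 < (y - sinh e - 1) * p \<and> 0 < (z - sinh e - 1) * p \<or> 0 < (z - sinh e - 1) * q \<and> 0 < (y - sinh e - 1) * q"
      using yz' assms by (auto simp: less_le)
    then show ?thesis using n by auto
  qed
  then show "p + q < (y - sinh e) * p + (z - sinh e) * q" "p + q < (z - sinh e) * p + (y - sinh e) * q"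
    by (auto simp: algebra_simps)
qed

lemma Sigma_clT: assumes "clT u" "u \<noteq> 0" shows "inT (Sigma e d *v u)"
proof -
  have "\<not> (u$2 = 0 \<and> u$3 = 0)" using assms unfolding clT_def vec_eq_iff forall_3 by auto
  then show ?thesis using expand[of "u$2" "u$3"] assms(1) unfolding Sigma_vec inT_def clT_def V3
    by (auto simp: algebra_simps)
qed

lemma Sigma_clI: assumes "clI (Sigma e d *v u)" "u \<noteq> 0" shows "inI u"
proof -
  define w where "w = Sigma e d *v u"
  have u: "u = matrix_inv (Sigma e d) *v w" by (simp add: w_def Sigma_cancel)
  have w: "clI w" "w \<noteq> 0" using assms Sigma_cancel(2)[of u] by (auto simp: w_def)
  have "\<not> (w$2 = 0 \<and> - w$3 = 0)" using w unfolding clI_def vec_eq_iff forall_3 by auto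
  then show ?thesis using expand[of "w$2" "- w$3"] w(1) unfolding u Sigma_inv_vec inI_def clI_def V3
    by (auto simp: algebra_simps)
qed

text \<open>The cone of side False is the preimage of \<open>clI\<close> under \<open>Sigma\<close>;
  its functionals are pulled back by the transpose, its rays by the inverse.\<close>

definition "Fc \<sigma> = (if \<sigma> then FT else (\<lambda>f. transpose (Sigma e d) *v f) ` FI)"
definition "Ec \<sigma> = (if \<sigma> then RT else (\<lambda>r. matrix_inv (Sigma e d) *v r) ` RI)"
text \<open>Both scalars, in \<open>Sigma_B\<close> and in \<open>Sigma_BB\<close>, are negative, so
  the second generator and its square need the lift with factor - 1.\<close>

definition "ec (l :: bool \<times> bool) = (if fst l then 1 else - 1 :: real)"
definition "vc \<sigma> = (if \<sigma> then vector [0,1,1] else matrix_inv (Sigma e d) *v vector [0,1,-1] :: real^3)"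
text \<open>A line through the point \<open>vc \<sigma>\<close> that is positive on the rays of the
  opposite cone. Its entries come from the image of (0,1,1) under \<open>Sigma\<close> and of
  (0,1,-1) under the inverse.\<close>

definition "vc' \<sigma> = (if \<sigma> then transpose (Sigma e d) *v vector [0, z - sinh e, - (y - sinh e)]
    else vector [0, y - sinh e, z - sinh e] :: real^3)"

lemma Fc_cone: "u \<in> fcone (Fc True) \<longleftrightarrow> clT u" "u \<in> fcone (Fc False) \<longleftrightarrow> clI (Sigma e d *v u)"
  unfolding fcone_T[symmetric] fcone_I[symmetric] by (auto simp: Fc_def fcone_def dot_lmul_matrix)

lemma Fc_int: "(\<forall>f\<in>Fc True. 0 < f \<bullet> u) \<longleftrightarrow> inT u" "(\<forall>f\<in>Fc False. 0 < f \<bullet> u) \<longleftrightarrow> inI (Sigma e d *v u)"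
  unfolding int_T[symmetric] int_I[symmetric] by (auto simp: Fc_def dot_lmul_matrix)

lemma letter_positive:
  assumes u: "u \<in> fcone (Fc (\<not> fst l))" "u \<noteq> 0"
  shows "\<forall>f\<in>Fc (fst l). 0 < f \<bullet> ((ec l *\<^sub>R word_mat (A_Th t b) (B_lam t b e d) (lw l)) *v u)"
proof (cases "fst l")
  case True
  have "inI u" using u True Fc_cone(2) Sigma_clI by auto
  then have "inT (word_mat (A_Th t b) (B_lam t b e d) (lw l) *v u)"
    using A_inI AA_inI True by (auto simp: lw_def word_mat_Cons)
  then show ?thesis using True Fc_int(1) by (simp add: ec_def)
next
  case False
  define s where "s = Sigma e d *v u"
  have s: "inT s" using u False Fc_cone(1) Sigma_clT by (auto simp: s_def)
  have k: "(1 - t^2) / \<kappa>A < 0" using tb_pos \<kappa>A(1) by (simp add: divide_pos_neg)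
  have "inI (Sigma e d *v ((- 1) *\<^sub>R (word_mat (A_Th t b) (B_lam t b e d) (lw l) *v u)))"
  proof (cases "snd l")
    case True
    then have "Sigma e d *v ((- 1) *\<^sub>R (word_mat (A_Th t b) (B_lam t b e d) (lw l) *v u))
       = (- ((1 - t^2) / \<kappa>A)) *\<^sub>R (Bx *v s)"
      using False Sigma_B[of u]
      by (simp add: lw_def word_mat_Cons s_def mult_vec_minus)
    then show ?thesis using k by (simp only:) (intro inI_scale Bx_inT[OF s], simp)
  next
    case False
    then have "Sigma e d *v ((- 1) *\<^sub>R (word_mat (A_Th t b) (B_lam t b e d) (lw l) *v u))
       = (((1 - t^2) / \<kappa>A)^2 * (1 - b^2)) *\<^sub>R (By *v s)"
      using \<open>\<not> fst l\<close> Sigma_BB[of u]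
      by (simp add: lw_def word_mat_Cons s_def mult_vec_minus)
    moreover have "0 < ((1 - t^2) / \<kappa>A)^2 * (1 - b^2)"
      using k tb_pos(6) by (intro mult_pos_pos) (metis less_irrefl zero_less_power2)
    ultimately show ?thesis by (simp only:) (intro inI_scale By_inT[OF s])
  qed
  then have pos: "\<forall>f\<in>Fc False. 0 < f \<bullet> ((- 1) *\<^sub>R (word_mat (A_Th t b) (B_lam t b e d) (lw l) *v u))"
    using Fc_int(2) by blast
  have eq: "(ec l *\<^sub>R word_mat (A_Th t b) (B_lam t b e d) (lw l)) *v u
     = (- 1) *\<^sub>R (word_mat (A_Th t b) (B_lam t b e d) (lw l) *v u)" "Fc (fst l) = Fc False"
    using False by (simp_all add: ec_def minus_mult_vec)
  show ?thesis unfolding eq by (rule pos)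
qed

lemma cone_rep_primal:
  assumes "0 < \<theta>" "\<theta> < pi / 3"
  shows "cone_rep \<theta> (A_Th t b) (B_lam t b e d) ec Fc vc"
proof unfold_locales
  show "0 < \<theta>" "\<theta> < pi / 3" by fact+
  show "invertible (A_Th t b)" "invertible (B_lam t b e d)" using inv_A inv_B by auto
  show "\<exists>k. k \<noteq> 0 \<and> A_Th t b ** A_Th t b ** A_Th t b = k *\<^sub>R mat 1"
    using \<kappa>A by (intro exI[of _ "\<kappa>A"]) auto
  show "\<exists>k. k \<noteq> 0 \<and> B_lam t b e d ** B_lam t b e d ** B_lam t b e d = k *\<^sub>R mat 1"
    using B_cube \<kappa>A by (intro exI[of _ "inverse (\<kappa>A)"]) auto
  show "ec l \<noteq> 0" for l by (simp add: ec_def)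
  show "finite (Fc \<sigma>)" for \<sigma> by (auto simp: Fc_def FT_def FI_def)
  show "u = 0" if "\<And>f. f \<in> Fc \<sigma> \<Longrightarrow> f \<bullet> u = 0" for \<sigma> u
  proof (cases \<sigma>)
    case True then show ?thesis using that by (intro separating(1)) (simp add: Fc_def)
  next
    case False
    then have "Sigma e d *v u = 0" using that[of "transpose (Sigma e d) *v _"]
      by (intro separating(2)) (auto simp: Fc_def dot_lmul_matrix)
    then show ?thesis using invertible_vec_eq_0[OF inv_Sigma] by blast
  qed
  show "0 < f \<bullet> (ec l *\<^sub>R word_mat (A_Th t b) (B_lam t b e d) (lw l) *v u)"
    if "u \<in> fcone (Fc (\<not> fst l))" "u \<noteq> 0" "f \<in> Fc (fst l)" for u l f
    using letter_positive that by blast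
  show "vc \<sigma> \<in> fcone (Fc \<sigma>)" for \<sigma>
    by (cases \<sigma>) (simp_all add: Fc_cone vc_def Sigma_cancel clT_def clI_def V3)
  have "(vector [0,1,1] :: real^3) \<noteq> 0" "(vector [0,1,-1] :: real^3) \<noteq> 0"
    unfolding vec_eq_iff forall_3 by (simp_all add: V3)
  moreover have "matrix_inv (Sigma e d) *v w \<noteq> 0" if "w \<noteq> 0" for w using Sigma_cancel(1)[of w] that by auto
  ultimately show "vc \<sigma> \<noteq> 0" for \<sigma> by (simp add: vc_def)
qed

lemma anosov_lam:
  assumes th: "0 < \<theta>" "\<theta> < pi / 3"
  shows "anosov \<theta> (A_Th t b) (B_lam t b e d)"
proof -
  let ?S = "Sigma e d"
  have Si: "(matrix_inv ?S *v x) \<bullet> w = x \<bullet> (invT ?S *v w)" for x w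
    using invT_inner[OF inv_Sigma, of e d "matrix_inv ?S *v x" w]
    by (metis Sigma_cancel(1) Sigma_cancel(2) inner_transpose invT_inner inv_Sigma)
  have iS0: "invT ?S *v w = 0 \<Longrightarrow> w = 0" for w
    using invertible_vec_eq_0[OF invertible_invT[OF inv_Sigma]] by blast
  have y1: "y - sinh e > 0" "z - sinh e > 0" using yz by (simp_all add: y_def z_def)
  have "\<exists>e'. cone_rep \<theta> (invT (A_Th t b)) (invT (B_lam t b e d)) e' (\<lambda>\<sigma>. Ec (\<not> \<sigma>)) vc'"
  proof (rule cone_rep_dual[OF cone_rep_primal[OF th]])
    show "finite (Ec \<sigma>)" for \<sigma> by (auto simp: Ec_def RT_def RI_def)
    show "x \<in> fcone (Fc \<sigma>) \<and> x \<noteq> 0" if x: "x \<in> Ec \<sigma>" for \<sigma> x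
    proof -
      have nz: "r \<noteq> 0" if "r \<in> RT \<union> RI" for r
        using that unfolding RT_def RI_def vec_eq_iff forall_3 by (auto simp: V3)
      show ?thesis
      proof (cases \<sigma>)
        case True then show ?thesis using x RT_cone nz by (auto simp: Ec_def Fc_cone)
      next
        case False
        then obtain r where r: "x = matrix_inv ?S *v r" "r \<in> RI" using x by (auto simp: Ec_def)
        have Sx: "?S *v x = r" using r by (simp add: Sigma_cancel)
        have "r \<noteq> 0" using nz r(2) by blast
        then have "x \<noteq> 0" using Sx by auto
        then show ?thesis using False r(2) RI_cone Sx by (simp add: Fc_cone)
      qed
    qed
    show "w = 0" if "\<And>x. x \<in> Ec \<sigma> \<Longrightarrow> x \<bullet> w = 0" for \<sigma> w
    proof (cases \<sigma>)
      case True then show ?thesis using that by (intro separating(3)) (simp add: Ec_def)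
    next
      case False
      then have "invT ?S *v w = 0" using that[of "matrix_inv ?S *v _"]
        by (intro separating(4)) (auto simp: Ec_def Si)
      then show ?thesis by (rule iS0)
    qed
    show "0 < x \<bullet> w" if x: "\<And>f. f \<in> Fc \<sigma> \<Longrightarrow> 0 < f \<bullet> x" and w: "w \<noteq> 0" "\<And>r. r \<in> Ec \<sigma> \<Longrightarrow> 0 \<le> r \<bullet> w" for \<sigma> x w
    proof (cases \<sigma>)
      case True then show ?thesis using x w Fc_int(1)[of x] by (intro dual_T) (auto simp: Ec_def)
    next
      case False
      then have "inI (?S *v x)" using x Fc_int(2)[of x] by auto
      then have "0 < (?S *v x) \<bullet> (invT ?S *v w)"
        using w(1) w(2)[of "matrix_inv ?S *v _"] False iS0 by (intro dual_I) (auto simp: Ec_def Si)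
      then show ?thesis by (simp add: invT_inner inv_Sigma)
    qed
    show "vc' \<sigma> \<in> fcone (Ec (\<not> \<sigma>))" for \<sigma>
    proof (cases \<sigma>)
      case True
      have "(matrix_inv ?S *v r) \<bullet> (transpose ?S *v w) = r \<bullet> w" for r w
        by (metis Sigma_cancel(1) inner_transpose)
      then show ?thesis using True y1 by (auto simp: Ec_def vc'_def fcone_def RI_def inner_V3 V3)
    next
      case False
      then show ?thesis using y1 by (auto simp: Ec_def vc'_def fcone_def RT_def inner_V3 V3)
    qed
    show "vc' \<sigma> \<noteq> 0" for \<sigma>
    proof -
      have "transpose ?S *v w \<noteq> 0" if "w \<noteq> 0" for w
        using invertible_vec_eq_0[OF invertible_transpose'[OF inv_Sigma]] that by blast
      moreover have "(vector [0, z - sinh e, - (y - sinh e)] :: real^3) \<noteq> 0" "(vector [0, y - sinh e, z - sinh e] :: real^3) \<noteq> 0"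
        unfolding vec_eq_iff forall_3 using y1 by (auto simp: V3)
      ultimately show ?thesis by (simp add: vc'_def)
    qed
  qed
  then obtain e' where "cone_rep \<theta> (invT (A_Th t b)) (invT (B_lam t b e d)) e' (\<lambda>\<sigma>. Ec (\<not> \<sigma>)) vc'" by blast
  then show ?thesis
  proof (rule anosov_if_cones[OF cone_rep_primal[OF th]])
    fix \<sigma>
    have "vc True \<bullet> vc' True = (?S *v vector [0,1,1]) \<bullet> vector [0, z - sinh e, - (y - sinh e)]"
      by (simp add: vc_def vc'_def inner_transpose)
    also have "\<dots> = 0" unfolding Sigma_vec inner_V3 V3 by (simp add: algebra_simps)
    finally have T: "vc True \<bullet> vc' True = 0" .
    have "vc False \<bullet> vc' False = 0"
      unfolding vc_def vc'_def Sigma_inv_vec by (simp add: inner_V3 V3 algebra_simps)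
    then show "vc \<sigma> \<bullet> vc' \<sigma> = 0" using T by (cases \<sigma>) auto
  qed
qed

end

section \<open>Extension to the modular group\<close>

text \<open>A duality with symmetric matrix is an involution on flags, and conjugating [A] by it
  gives the projective map with matrix \<open>matrix_inv M ** invT A ** M\<close>.\<close>

lemma extends_repI:
  assumes A: "invertible A" and B: "invertible B" and M: "invertible M" "transpose M = M"
    and cube: "A ** A ** A = k *\<^sub>R mat 1" "k \<noteq> 0" and BM: "B = matrix_inv M ** invT A ** M"
  shows "extends_rep (True, M) A B"
proof -
  have iM: "invT M = matrix_inv M" by (simp add: invT_def M(2))
  have MM: "M *v (matrix_inv M *v x) = x" "matrix_inv M *v (M *v x) = x" for x
    using matrix_inv_both[OF M(1)] by (simp_all add: matrix_vector_mul_assoc)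
  have tMi: "transpose (matrix_inv M) = matrix_inv M"
  proof -
    have "transpose (matrix_inv M) = transpose (matrix_inv M) ** (M ** matrix_inv M)"
      using matrix_inv_both[OF M(1)] by simp
    also have "\<dots> = transpose (M ** matrix_inv M) ** matrix_inv M"
      by (simp add: matrix_transpose_mul M(2) matrix_mul_assoc)
    finally show ?thesis using matrix_inv_both[OF M(1)] by (simp add: transpose_mat)
  qed
  have iB: "invT B = M ** A ** matrix_inv M"
    unfolding invT_def
  proof (rule matrix_inv_eqI)
    have tA: "transpose (invT A) ** A = mat 1"
    proof -
      have "transpose (invT A) ** A = transpose (transpose A ** invT A)" by (simp add: matrix_transpose_mul)
      then show ?thesis using matrix_inv_both[OF invertible_transpose'[OF A]] by (simp add: invT_def transpose_mat)
    qed
    have "transpose B ** (M ** A ** matrix_inv M)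
       = M ** transpose (invT A) ** (matrix_inv M ** M) ** A ** matrix_inv M"
      unfolding BM by (simp add: matrix_transpose_mul M(2) tMi matrix_mul_assoc)
    also have "\<dots> = M ** (transpose (invT A) ** A) ** matrix_inv M"
      using matrix_inv_both[OF M(1)] by (simp add: matrix_mul_assoc)
    finally show "transpose B ** (M ** A ** matrix_inv M) = mat 1"
      using matrix_inv_both[OF M(1)] tA by simp
  qed
  have p1: "proj_eq x x" for x by (auto simp: proj_eq_def intro: exI[of _ 1])
  have p2: "proj_eq (c *\<^sub>R x) x" if "c \<noteq> 0" for c x using that by (auto simp: proj_eq_def)
  have A3: "A *v (A *v (A *v x)) = k *\<^sub>R x" for x
    using cube(1) by (simp add: matrix_vector_mul_assoc matrix_mul_assoc scaleR_matrix_vector_assoc[symmetric])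
  have A3': "invT A *v (invT A *v (invT A *v x)) = inverse k *\<^sub>R x" for x
    using invT_cube_scalar[OF cube] by (simp add: matrix_vector_mul_assoc matrix_mul_assoc scaleR_matrix_vector_assoc[symmetric])
  have Bx: "B *v x = matrix_inv M *v (invT A *v (M *v x))" "invT B *v x = M *v (A *v (matrix_inv M *v x))" for x
    unfolding iB by (simp_all add: BM matrix_vector_mul_assoc matrix_mul_assoc)
  show ?thesis
    unfolding extends_rep_def F_eq_def
    using A B M(1) p1 p2 cube(2) by (simp add: iM MM A3 A3' Bx)
qed

context shifted_box
begin

text \<open>Replacing \<open>P0\<close> by \<open>C ** P0\<close> does not change B when C commutes
  with the transpose of A. This is the freedom available to make the matrix symmetric.\<close>

lemma extends_commuting:
  assumes C: "invertible C" "C ** transpose (A_Th t b) = transpose (A_Th t b) ** C"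
    and sym: "transpose (C ** P0) = C ** P0"
  shows "extends_rep (True, C ** P0) (A_Th t b) (B_lam t b e d)"
proof (rule extends_repI[OF inv_A inv_B _ sym \<kappa>A(2)])
  show "invertible (C ** P0)" by (rule invertible_mult[OF C(1) inv_P])
  show "\<kappa>A \<noteq> 0" using \<kappa>A(1) by simp
  have Mi: "matrix_inv (C ** P0) = matrix_inv P0 ** matrix_inv C"
  proof (rule matrix_inv_eqI)
    have "C ** P0 ** (matrix_inv P0 ** matrix_inv C) = C ** (P0 ** matrix_inv P0) ** matrix_inv C"
      by (simp add: matrix_mul_assoc)
    then show "C ** P0 ** (matrix_inv P0 ** matrix_inv C) = mat 1"
      using matrix_inv_both[OF inv_P] matrix_inv_both[OF C(1)] by simp
  qed
  let ?T = "transpose (A_Th t b)"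
  have "C ** (?T ** ?T) = (?T ** ?T) ** C"
    by (metis C(2) matrix_mul_assoc)
  then have "invT (A_Th t b) ** C = C ** invT (A_Th t b)"
    unfolding invT_A matrix_transpose_mul scaleR_matrix_mult by simp
  then have "matrix_inv (C ** P0) ** invT (A_Th t b) ** (C ** P0)
     = matrix_inv P0 ** (matrix_inv C ** C) ** invT (A_Th t b) ** P0"
    unfolding Mi by (metis matrix_mul_assoc)
  then show "B_lam t b e d = matrix_inv (C ** P0) ** invT (A_Th t b) ** (C ** P0)"
    using matrix_inv_both[OF C(1)] by (simp add: B_conj)
qed

end

section \<open>The symmetry system and its determinant\<close>

definition Sg :: "real \<Rightarrow> real \<Rightarrow> real \<Rightarrow> real^3^3" where
  "Sg y s z = vector [vector [1, 0, 0], vector [0, y, - s], vector [0, - s, z]]"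

lemma Sigma_Sg: "Sigma e d = Sg (exp (-d) * cosh e) (sinh e) (exp d * cosh e)"
  by (simp add: Sigma_def Sg_def)

definition Cm :: "real \<Rightarrow> real \<Rightarrow> real \<Rightarrow> real \<Rightarrow> real \<Rightarrow> real^3^3" where
  "Cm t b c0 c1 c2 = c0 *\<^sub>R mat 1 + c1 *\<^sub>R transpose (A_Th t b) + c2 *\<^sub>R (transpose (A_Th t b) ** transpose (A_Th t b))"

lemma matrix_add_mult: "(X + Y) ** Z = X ** Z + Y ** (Z :: real^'n^'n)"
  by (simp add: matrix_matrix_mult_def vec_eq_iff sum.distrib distrib_right)

lemma Cm_commute: "Cm t b c0 c1 c2 ** transpose (A_Th t b) = transpose (A_Th t b) ** Cm t b c0 c1 c2"
  by (simp add: Cm_def matrix_add_ldistrib matrix_add_mult scaleR_matrix_mult matrix_mul_assoc)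

lemma symmetric3: "transpose (M::real^3^3) = M \<longleftrightarrow> M$1$2 = M$2$1 \<and> M$1$3 = M$3$1 \<and> M$2$3 = M$3$2"
  by (auto simp: vec_eq_iff forall_3 transpose_def)

text \<open>The three summands of each entry are the skew parts of \<open>D \<Sigma>\<close>, \<open>\<^sup>tA D \<Sigma>\<close> and \<open>(\<^sup>tA)\<^sup>2 D \<Sigma>\<close>; the last
  two are divisible by \<open>1 - t\<^sup>2\<close> and \<open>(1 - t\<^sup>2) (1 - b\<^sup>2)\<close>.\<close>

lemma Cm_skew:
  fixes t b y s z c0 c1 c2 :: real
  defines "M \<equiv> Cm t b c0 c1 c2 ** (D_Th t b ** Sg y s z)"
  shows "M$1$2 - M$2$1 = c0 * (b* s + t*(1-y)) + c1 * (1-t^2) * (b*(1+y-s)) + c2 * ((1-t^2)*(1-b^2)) * (t*(1+s-y))"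
    "M$1$3 - M$3$1 = c0 * (t* s + b*(1-z)) + c1 * (1-t^2) * (b*(z-1-s)) + c2 * ((1-t^2)*(1-b^2)) * (t*(s-1-z))"
    "M$2$3 - M$3$2 = c0 * (b*t*(z-y)) + c1 * (1-t^2) * (y+z-s*(1+b^2)) + c2 * ((1-t^2)*(1-b^2)) * (y+z-s*(1+t^2))"
  unfolding M_def
  by (simp_all add: Cm_def mat3 A_Th_def D_Th_def Sg_def V3 power2_eq_square algebra_simps)

text \<open>The determinant of the symmetry system, reduced modulo y z = 1 + s^2. Only y + z and y -
  z are left, which separates the even from the odd part in \<delta>.\<close>

definition obstruction :: "real \<Rightarrow> real \<Rightarrow> real \<Rightarrow> real \<Rightarrow> real \<Rightarrow> real" where
  "obstruction t b y s z = b*t* s*(t^2-b^2)*(2+2* s-(y+z)) + (y-z)*(s-(y+z))*(b^2+t^2-2*b^2*t^2)"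

text \<open>The left-hand side is the expansion along the third row; it differs from
  \<open>obstruction\<close> by a multiple of y z - (1 + s^2).\<close>

lemma obstruction_det:
  fixes t b y s z :: real
  assumes "y * z = 1 + s * s"
  shows "(b*t*(z-y)) * ((b*(1+y-s)) * (t*(s-1-z)) - (t*(1+s-y)) * (b*(z-1-s)))
     + (y+z-s*(1+b^2)) * ((t*(1+s-y)) * (t* s + b*(1-z)) - (b* s + t*(1-y)) * (t*(s-1-z)))
     + (y+z-s*(1+t^2)) * ((b* s + t*(1-y)) * (b*(z-1-s)) - (b*(1+y-s)) * (t* s + b*(1-z)))
     = obstruction t b y s z"
proof -
  have "(b*t*(z-y)) * ((b*(1+y-s)) * (t*(s-1-z)) - (t*(1+s-y)) * (b*(z-1-s)))
     + (y+z-s*(1+b^2)) * ((t*(1+s-y)) * (t* s + b*(1-z)) - (b* s + t*(1-y)) * (t*(s-1-z)))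
     + (y+z-s*(1+t^2)) * ((b* s + t*(1-y)) * (b*(z-1-s)) - (b*(1+y-s)) * (t* s + b*(1-z)))
     = obstruction t b y s z + (y*z - (1 + s* s)) * ((t^2 - b^2) * (b*t* s + s - y - z))"
    by (simp add: obstruction_def power2_eq_square algebra_simps)
  then show ?thesis using assms by simp
qed

lemma sinh_ge_self: "x \<ge> 0 \<Longrightarrow> sinh x \<ge> (x::real)"
proof -
  assume x: "x \<ge> 0"
  have "(\<lambda>x. sinh x - x) 0 \<le> (\<lambda>x. sinh x - x) x"
  proof (rule DERIV_nonneg_imp_nondecreasing[OF x])
    fix u :: real
    show "\<exists>y. DERIV (\<lambda>x. sinh x - x) u :> y \<and> 0 \<le> y"
      by (rule exI[of _ "cosh u - 1"]) (auto intro!: derivative_eq_intros cosh_real_ge_1)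
  qed
  then show ?thesis by simp
qed

text \<open>In \<open>g\<close> the summand with K is even in d and the one with L is odd. At h =
  |sinh e| / 2 the odd part is at least 4 h L = - 2 s L. The even part is at most that in modulus,
  since |K| \<le> L and \<open>small\<close> bounds its last factor by 2. So g changes sign between
  - h and h.\<close>

lemma exists_delta:
  fixes t b e :: real
  assumes t: "- 1 < t" "t < 1" and b: "- 1 < b" "b < 1"
    and s: "sinh e < 0" and small: "cosh e * cosh (sinh e / 2) - sinh e \<le> 2"
  shows "\<exists>d. \<bar>d\<bar> \<le> \<bar>sinh e\<bar> / 2 \<and> obstruction t b (exp (-d) * cosh e) (sinh e) (exp d * cosh e) = 0"
proof -
  define s where "s = sinh e"
  define c where "c = cosh e"
  define L where "L = b^2 + t^2 - 2*b^2*t^2"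
  define K where "K = b*t*(t^2-b^2)"
  define h where "h = - s / 2"
  have s0: "s < 0" and h0: "h > 0" using s by (auto simp: s_def h_def)
  have c1: "c \<ge> 1" unfolding c_def by (rule cosh_real_ge_1)
  define g where "g d = obstruction t b (exp (-d) * c) s (exp d * c)" for d
  have g: "g d = K * s * (2 + 2* s - 2*c* cosh d) + 2*c* sinh d * (2*c* cosh d - s) * L" for d
  proof -
    have y: "exp (-d) * c + exp d * c = 2*c* cosh d" "exp (-d) * c - exp d * c = - (2*c* sinh d)"
      by (simp_all add: cosh_field_def sinh_field_def field_simps)
    show ?thesis unfolding g_def obstruction_def y K_def L_def by (simp add: algebra_simps)
  qed
  have sq: "t^2 \<le> 1" "b^2 \<le> 1" using t b by (simp_all add: abs_square_le_1)
  have L0: "L = t^2*(1-b^2) + b^2*(1-t^2)" by (simp add: L_def algebra_simps)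
  have KL: "\<bar>K\<bar> \<le> L"
  proof -
    \<comment> \<open>L is the sum, and t^2 - b^2 the difference, of the same two nonnegative
      terms.\<close>
    have "t^2 - b^2 = t^2*(1-b^2) - b^2*(1-t^2)" by (simp add: algebra_simps)
    moreover have "0 \<le> t^2*(1-b^2)" "0 \<le> b^2*(1-t^2)" using sq by auto
    ultimately have l: "\<bar>t^2 - b^2\<bar> \<le> L" unfolding L0 by linarith
    have "\<bar>b * t\<bar> \<le> 1" using t b unfolding abs_mult by (intro mult_le_one) auto
    then have "\<bar>b * t\<bar> * \<bar>t^2 - b^2\<bar> \<le> 1 * L" using l by (intro mult_mono) auto
    then show ?thesis by (simp add: K_def abs_mult)
  qed
  have ch: "c * cosh h - s \<le> 2" "cosh h \<ge> 1"
    using small cosh_real_ge_1[of h] cosh_minus[of "s/2"] unfolding h_def c_def s_def by auto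
  have "1 * 1 \<le> c * cosh h" using c1 ch(2) by (intro mult_mono) auto
  then have w: "\<bar>2 + 2* s - 2*c* cosh h\<bar> \<le> 2" using ch(1) s0 by simp
  have first: "\<bar>K * s * (2 + 2* s - 2*c* cosh h)\<bar> \<le> - 2 * s * L"
  proof -
    have "\<bar>K\<bar> * \<bar>s\<bar> * \<bar>2 + 2* s - 2*c* cosh h\<bar> \<le> L * (- s) * 2"
      using KL w s0 by (intro mult_mono) (auto simp: mult_nonneg_nonpos)
    then show ?thesis by (simp add: abs_mult mult_ac)
  qed
  have second: "- 2 * s * L \<le> 2*c* sinh h * (2*c* cosh h - s) * L"
  proof -
    have L00: "L \<ge> 0" using KL by linarith
    have "1 * h \<le> c * sinh h" using c1 sinh_ge_self[of h] h0 by (intro mult_mono) auto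
    moreover have "2 \<le> 2*c* cosh h - s" using \<open>1 * 1 \<le> c * cosh h\<close> s0 by simp
    ultimately have "(2 * h) * 2 \<le> (2 * c * sinh h) * (2 * c * cosh h - s)"
      using h0 mult_mono[of "2 * h" "2 * c * sinh h" 2 "2 * c * cosh h - s"] by simp
    then have "(2 * h) * 2 * L \<le> (2*c* sinh h) * (2*c* cosh h - s) * L" using L00 by (rule mult_right_mono)
    then show ?thesis by (simp add: h_def)
  qed
  have "g h \<ge> 0" using first second unfolding g by linarith
  moreover have "g (- h) = K * s * (2 + 2 * s - 2 * c * cosh h) - 2 * c * sinh h * (2 * c * cosh h - s) * L"
    unfolding g by simp
  then have "g (- h) \<le> 0" using first second by linarith
  moreover have "continuous_on {- h..h} g"
    unfolding g_def obstruction_def by (intro continuous_intros)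
  ultimately obtain d where "- h \<le> d" "d \<le> h" "g d = 0"
    using IVT'[of g "- h" 0 h] h0 by auto
  then show ?thesis using s0 unfolding g_def h_def c_def s_def by (intro exI[of _ d]) auto
qed

lemma tendsto_det3:
  fixes C :: "'a \<Rightarrow> real^3^3"
  assumes "(C \<longlongrightarrow> C0) F" shows "((\<lambda>x. det (C x)) \<longlongrightarrow> det C0) F"
  unfolding det_3 by (intro tendsto_intros assms)

text \<open>Where the determinant vanishes, a solution is the cross product of two rows. It tends to
  (4b, 0, 0) or (4t, 0, 0) as e tends to 0, so C tends to a scalar matrix. For t = b = 0 both limits
  vanish, but then D \<open>Sigma\<close> is already symmetric and \<delta> = 0 works.\<close>

lemma exists_extension:
  fixes t b :: real
  assumes tb: "- 1 < t" "t < 1" "- 1 < b" "b < 1"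
  shows "\<forall>\<^sub>F e in at_left 0. \<exists>d M. \<bar>d\<bar> \<le> \<bar>sinh e\<bar> / 2 \<and> extends_rep (True, M) (A_Th t b) (B_lam t b e d)"
proof (cases "t = 0 \<and> b = 0")
  case True
  interpret shifted_box t b e 0 for e by unfold_locales (use tb in auto)
  have "extends_rep (True, mat 1 ** P0 e) (A_Th t b) (B_lam t b e 0)" for e
  proof (rule extends_commuting)
    have "transpose (P0 e) = P0 e" unfolding symmetric3 P0_def
      using True by (simp add: mat3 D_Th_def Sigma_def V3)
    then show "transpose (mat 1 ** P0 e) = mat 1 ** P0 e" by simp
  qed (auto simp: invertible_def intro!: exI[of _ "mat 1"])
  then have "\<bar>0\<bar> \<le> \<bar>sinh e\<bar> / 2 \<and> extends_rep (True, mat 1 ** P0 e) (A_Th t b) (B_lam t b e 0)" for e by simp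
  then show ?thesis by (intro always_eventually allI) blast
next
  case False
  define ok where "ok e d \<longleftrightarrow> \<bar>d\<bar> \<le> \<bar>sinh e\<bar> / 2 \<and>
     obstruction t b (exp (-d) * cosh e) (sinh e) (exp d * cosh e) = 0" for e d
  \<comment> \<open>The default 0 makes the bound on \<open>dl\<close> hold for every e, so
    \<open>dl\<close> tends to 0 with \<open>sinh\<close>.\<close>
  define dl where "dl e = (if \<exists>d. ok e d then SOME d. ok e d else 0)" for e
  have dl_ok: "ok e (dl e)" if "\<exists>d. ok e d" for e
    unfolding dl_def using someI_ex[OF that] that by simp
  have dl_le: "\<bar>dl e\<bar> \<le> \<bar>sinh e\<bar> / 2" for e
    using dl_ok[of e] by (cases "\<exists>d. ok e d") (auto simp: ok_def dl_def)
  have lim_s: "(sinh \<longlongrightarrow> (0::real)) (at_left 0)"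
    using tendsto_sinh[OF tendsto_ident_at, of "0::real" "{..<0}"] by simp
  have lim_c: "(cosh \<longlongrightarrow> (1::real)) (at_left 0)"
    using tendsto_cosh[OF tendsto_ident_at, of "0::real" "{..<0}"] by simp
  have lim_d: "(dl \<longlongrightarrow> 0) (at_left 0)"
  proof (rule tendsto_0_le[where K = "1/2" and f = sinh])
    show "\<forall>\<^sub>F e in at_left 0. norm (dl e) \<le> norm (sinh e) * (1/2)" using dl_le by (simp add: always_eventually)
  qed (rule lim_s)
  define y where "y e = exp (- dl e) * cosh e" for e
  define z where "z e = exp (dl e) * cosh e" for e
  have lim_y: "(y \<longlongrightarrow> 1) (at_left 0)" and lim_z: "(z \<longlongrightarrow> 1) (at_left 0)"
    unfolding y_def[abs_def] z_def[abs_def] by (rule tendsto_eq_intros lim_d lim_c | simp)+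
  have yz: "y e * z e = 1 + sinh e * sinh e" for e
  proof -
    have "y e * z e = cosh e * cosh e" by (simp add: y_def z_def exp_minus)
    then show ?thesis using cosh_square_eq[of e] by (simp add: power2_eq_square)
  qed
  have "\<forall>\<^sub>F e in at_left 0. cosh e * cosh (sinh e / 2) - sinh e < (2::real)"
  proof (rule order_tendstoD(2))
    have "((\<lambda>e. cosh (sinh e / 2)) \<longlongrightarrow> cosh (0 / 2)) (at_left (0::real))"
      by (intro tendsto_cosh tendsto_divide lim_s) auto
    then show "((\<lambda>e. cosh e * cosh (sinh e / 2) - sinh e) \<longlongrightarrow> 1 * cosh (0/2) - 0) (at_left (0::real))"
      by (intro tendsto_diff tendsto_mult lim_c lim_s)
  qed simp
  moreover have "\<forall>\<^sub>F e in at_left 0. e < (0::real)" by (simp add: eventually_at_filter)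
  ultimately have ev_ok: "\<forall>\<^sub>F e in at_left 0. ok e (dl e)"
  proof eventually_elim
    case (elim e)
    then show ?case using exists_delta[OF tb, of e] dl_ok[of e] unfolding ok_def by auto
  qed
  define a1 where "a1 e = b * (1 + y e - sinh e)" for e
  define a2 where "a2 e = b * (z e - 1 - sinh e)" for e
  define a3 where "a3 e = y e + z e - sinh e * (1 + b^2)" for e
  define b1 where "b1 e = t * (1 + sinh e - y e)" for e
  define b2 where "b2 e = t * (sinh e - 1 - z e)" for e
  define b3 where "b3 e = y e + z e - sinh e * (1 + t^2)" for e
  define o1 where "o1 e = b * sinh e + t * (1 - y e)" for e
  define o2 where "o2 e = t * sinh e + b * (1 - z e)" for e
  define o3 where "o3 e = b * t * (z e - y e)" for e
  note defs = a1_def a2_def a3_def b1_def b2_def b3_def o1_def o2_def o3_def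
  have lims: "(a1 \<longlongrightarrow> 2 * b) (at_left 0)" "(a2 \<longlongrightarrow> 0) (at_left 0)" "(a3 \<longlongrightarrow> 2) (at_left 0)"
    "(b1 \<longlongrightarrow> 0) (at_left 0)" "(b2 \<longlongrightarrow> - 2 * t) (at_left 0)" "(b3 \<longlongrightarrow> 2) (at_left 0)"
    "(o1 \<longlongrightarrow> 0) (at_left 0)" "(o2 \<longlongrightarrow> 0) (at_left 0)" "(o3 \<longlongrightarrow> 0) (at_left 0)"
    unfolding defs[abs_def] by (rule tendsto_eq_intros lim_s lim_y lim_z | simp)+
  have tb': "1 - t^2 \<noteq> 0" "1 - b^2 \<noteq> 0" using convex_box.tb_pos(5,6)[of t b] tb by (auto simp: convex_box_def)
  have fin: ?thesis
    if k: "(k0 \<longlongrightarrow> q) (at_left 0)" "(k1 \<longlongrightarrow> 0) (at_left 0)" "(k2 \<longlongrightarrow> 0) (at_left 0)" "q \<noteq> 0"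
      and v: "\<And>e. obstruction t b (y e) (sinh e) (z e) = 0 \<Longrightarrow>
        k0 e * o1 e + k1 e * a1 e + k2 e * b1 e = 0 \<and> k0 e * o2 e + k1 e * a2 e + k2 e * b2 e = 0 \<and>
        k0 e * o3 e + k1 e * a3 e + k2 e * b3 e = 0"
    for k0 k1 k2 q
  proof -
    \<comment> \<open>The divisions cancel the factors 1 - t^2 and (1 - t^2)(1 - b^2) of the last
      two columns in \<open>Cm_skew\<close>.\<close>
    define C where "C e = Cm t b (k0 e) (k1 e / (1 - t^2)) (k2 e / ((1 - t^2) * (1 - b^2)))" for e
    have "((\<lambda>e. k1 e / (1 - t^2)) \<longlongrightarrow> 0) (at_left 0)" "((\<lambda>e. k2 e / ((1 - t^2) * (1 - b^2))) \<longlongrightarrow> 0) (at_left 0)"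
      using tb' by (auto intro!: tendsto_eq_intros k)
    then have "(C \<longlongrightarrow> q *\<^sub>R mat 1 + 0 *\<^sub>R transpose (A_Th t b) + 0 *\<^sub>R (transpose (A_Th t b) ** transpose (A_Th t b))) (at_left 0)"
      unfolding C_def[abs_def] Cm_def by (intro tendsto_intros k)
    then have "((\<lambda>e. det (C e)) \<longlongrightarrow> det (q *\<^sub>R (mat 1 :: real^3^3))) (at_left 0)"
      by (intro tendsto_det3) simp
    moreover have "det (q *\<^sub>R (mat 1 :: real^3^3)) \<noteq> 0"
      using k(4) by (simp add: det_3 mat_def)
    ultimately have "\<forall>\<^sub>F e in at_left 0. det (C e) \<noteq> 0" by (rule tendsto_imp_eventually_ne)
    then show ?thesis using ev_ok
    proof eventually_elim
      case (elim e)
      interpret shifted_box t b e "dl e" by unfold_locales (use tb in auto)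
      have P0: "P0 = D_Th t b ** Sg (y e) (sinh e) (z e)" by (simp add: P0_def Sigma_Sg y_def z_def)
      have kk: "k1 e / (1 - t^2) * (1 - t^2) = k1 e"
        "k2 e / ((1 - t^2) * (1 - b^2)) * ((1 - t^2) * (1 - b^2)) = k2 e" using tb' by auto
      have "obstruction t b (y e) (sinh e) (z e) = 0" using elim by (simp add: ok_def y_def z_def)
      from v[OF this] have "transpose (C e ** P0) = C e ** P0"
        unfolding symmetric3 C_def P0 defs
        using Cm_skew[of t b "k0 e" "k1 e / (1 - t^2)" "k2 e / ((1 - t^2) * (1 - b^2))" "y e" "sinh e" "z e"]
        unfolding kk by auto
      then have "extends_rep (True, C e ** P0) (A_Th t b) (B_lam t b e (dl e))"
        using elim Cm_commute by (intro extends_commuting) (auto simp: invertible_det_nz C_def)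
      then show ?case using dl_le by blast
    qed
  qed
  show ?thesis
  proof (cases "b = 0")
    case False
    show ?thesis
    \<comment> \<open>Cross product of rows 1 and 3; it is orthogonal to row 2 because the
      determinant vanishes.\<close>
    proof (rule fin[of "\<lambda>e. a1 e * b3 e - b1 e * a3 e" "2 * b * 2 - 0 * 2"
          "\<lambda>e. b1 e * o3 e - o1 e * b3 e" "\<lambda>e. o1 e * a3 e - a1 e * o3 e"])
      show "((\<lambda>e. a1 e * b3 e - b1 e * a3 e) \<longlongrightarrow> 2 * b * 2 - 0 * 2) (at_left 0)"
        by (intro tendsto_diff tendsto_mult lims)
      show "((\<lambda>e. b1 e * o3 e - o1 e * b3 e) \<longlongrightarrow> 0) (at_left 0)" "((\<lambda>e. o1 e * a3 e - a1 e * o3 e) \<longlongrightarrow> 0) (at_left 0)"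
        by (auto intro!: tendsto_eq_intros lims)
      show "2 * b * 2 - 0 * 2 \<noteq> 0" using False by simp
      fix e assume o: "obstruction t b (y e) (sinh e) (z e) = 0"
      show "(a1 e * b3 e - b1 e * a3 e) * o1 e + (b1 e * o3 e - o1 e * b3 e) * a1 e + (o1 e * a3 e - a1 e * o3 e) * b1 e = 0 \<and>
        (a1 e * b3 e - b1 e * a3 e) * o2 e + (b1 e * o3 e - o1 e * b3 e) * a2 e + (o1 e * a3 e - a1 e * o3 e) * b2 e = 0 \<and>
        (a1 e * b3 e - b1 e * a3 e) * o3 e + (b1 e * o3 e - o1 e * b3 e) * a3 e + (o1 e * a3 e - a1 e * o3 e) * b3 e = 0"
        using o obstruction_det[OF yz[of e], of b t, folded defs] by (simp add: algebra_simps)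
    qed
  next
    case True
    then have t0: "t \<noteq> 0" using False by simp
    show ?thesis
    \<comment> \<open>For b = 0 the minor used above tends to 0; rows 2 and 3 give the limit 4t
      instead.\<close>
    proof (rule fin[of "\<lambda>e. a2 e * b3 e - b2 e * a3 e" "0 * 2 - - 2 * t * 2"
          "\<lambda>e. b2 e * o3 e - o2 e * b3 e" "\<lambda>e. o2 e * a3 e - a2 e * o3 e"])
      show "((\<lambda>e. a2 e * b3 e - b2 e * a3 e) \<longlongrightarrow> 0 * 2 - - 2 * t * 2) (at_left 0)"
        by (intro tendsto_diff tendsto_mult lims)
      show "((\<lambda>e. b2 e * o3 e - o2 e * b3 e) \<longlongrightarrow> 0) (at_left 0)" "((\<lambda>e. o2 e * a3 e - a2 e * o3 e) \<longlongrightarrow> 0) (at_left 0)"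
        by (auto intro!: tendsto_eq_intros lims)
      show "0 * 2 - - 2 * t * 2 \<noteq> 0" using t0 by simp
      fix e assume o: "obstruction t b (y e) (sinh e) (z e) = 0"
      show "(a2 e * b3 e - b2 e * a3 e) * o1 e + (b2 e * o3 e - o2 e * b3 e) * a1 e + (o2 e * a3 e - a2 e * o3 e) * b1 e = 0 \<and>
        (a2 e * b3 e - b2 e * a3 e) * o2 e + (b2 e * o3 e - o2 e * b3 e) * a2 e + (o2 e * a3 e - a2 e * o3 e) * b2 e = 0 \<and>
        (a2 e * b3 e - b2 e * a3 e) * o3 e + (b2 e * o3 e - o2 e * b3 e) * a3 e + (o2 e * a3 e - a2 e * o3 e) * b3 e = 0"
        using o obstruction_det[OF yz[of e], of b t, folded defs] by (simp add: algebra_simps)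
    qed
  qed
qed

lemma extends_rep_Schwartz:
  assumes "- 1 < t" "t < 1" "- 1 < b" "b < 1"
  shows "extends_rep (True, D_Th t b) (A_Th t b) (B_lam t b 0 0)"
proof -
  interpret shifted_box t b 0 0 by unfold_locales (use assms in auto)
  have "Sigma 0 0 = mat 1" by (simp add: mat3 Sigma_def V3)
  then have P: "mat 1 ** P0 = D_Th t b" by (simp add: P0_def)
  have "extends_rep (True, mat 1 ** P0) (A_Th t b) (B_lam t b 0 0)"
  proof (rule extends_commuting)
    show "transpose (mat 1 ** P0) = mat 1 ** P0" unfolding P symmetric3 by (simp add: D_Th_def V3)
  qed (auto simp: invertible_def intro!: exI[of _ "mat 1"])
  then show ?thesis unfolding P .
qed

text \<open>Since exp x \<ge> 1 + x and cosh \<ge> 1, the sum is at least 1 + x - sinh e, and x can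
  consume only half of the gain - sinh e.\<close>

lemma shift_nested:
  fixes e d :: real
  assumes "sinh e < 0" "\<bar>d\<bar> \<le> \<bar>sinh e\<bar> / 2"
  shows "exp (- d) * cosh e - sinh e > 1" "exp d * cosh e - sinh e > 1"
proof -
  have *: "exp x * cosh e - sinh e > 1" if "\<bar>x\<bar> \<le> \<bar>sinh e\<bar> / 2" for x
  proof -
    have "1 + x \<le> exp x * 1" using exp_ge_add_one_self[of x] by simp
    also have "\<dots> \<le> exp x * cosh e" using cosh_real_ge_1[of e] by (intro mult_left_mono) auto
    finally show ?thesis using that assms(1) by linarith
  qed
  show "exp (- d) * cosh e - sinh e > 1" "exp d * cosh e - sinh e > 1" using *[of "- d"] *[of d] assms(2) by auto
qed

theorem theorem1p2:
  fixes zt zb :: real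
  assumes "zt \<in> {-1<..<1}" and "zb \<in> {-1<..<1}"
  shows "\<exists>\<epsilon>0::real. \<epsilon>0 < 0 \<and> (\<exists>(\<delta>h :: real \<Rightarrow> real) (ext :: real \<Rightarrow> bool \<times> (real^3^3)).
     (\<forall>\<epsilon>\<in>{\<epsilon>0<..0}. extends_rep (ext \<epsilon>) (A_Th zt zb) (B_lam zt zb \<epsilon> (\<delta>h \<epsilon>))) \<and>
     F_eq (gact (ext 0)) (gact (True, D_Th zt zb)) \<and>
     (\<forall>\<epsilon>\<in>{\<epsilon>0<..<0}. \<forall>\<theta>\<in>{0<..<pi/3}.
        anosov \<theta> (A_Th zt zb) (B_lam zt zb \<epsilon> (\<delta>h \<epsilon>))))"
proof -
  have tb: "- 1 < zt" "zt < 1" "- 1 < zb" "zb < 1" using assms by auto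
  \<comment> \<open>The choice of \<epsilon>0 secures the extension; the strict nesting holds for
    every \<epsilon> < 0 with this bound on d.\<close>
  obtain \<epsilon>0 :: real where e0: "\<epsilon>0 < 0" and ex: "\<And>\<epsilon>. \<epsilon>0 < \<epsilon> \<Longrightarrow> \<epsilon> < 0 \<Longrightarrow>
      \<exists>d M. \<bar>d\<bar> \<le> \<bar>sinh \<epsilon>\<bar> / 2 \<and> extends_rep (True, M) (A_Th zt zb) (B_lam zt zb \<epsilon> d)"
    using exists_extension[OF tb] unfolding eventually_at_left_field by blast
  have "\<forall>\<epsilon>. \<exists>p. \<epsilon>0 < \<epsilon> \<and> \<epsilon> < 0 \<longrightarrow> \<bar>fst p\<bar> \<le> \<bar>sinh \<epsilon>\<bar> / 2 \<and>
      extends_rep (True, snd p) (A_Th zt zb) (B_lam zt zb \<epsilon> (fst p))"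
    using ex by (metis fst_conv snd_conv)
  then obtain p where p: "\<And>\<epsilon>. \<epsilon>0 < \<epsilon> \<Longrightarrow> \<epsilon> < 0 \<Longrightarrow> \<bar>fst (p \<epsilon>)\<bar> \<le> \<bar>sinh \<epsilon>\<bar> / 2 \<and>
      extends_rep (True, snd (p \<epsilon>)) (A_Th zt zb) (B_lam zt zb \<epsilon> (fst (p \<epsilon>)))" by metis
  \<comment> \<open>At \<epsilon> = 0 the values are prescribed: \<delta> = 0 makes
    \<open>Sigma\<close> the identity, and the duality is D itself.\<close>
  define \<delta>h where "\<delta>h \<epsilon> = (if \<epsilon> = 0 then 0 else fst (p \<epsilon>))" for \<epsilon>
  define ext where "ext \<epsilon> = (True, if \<epsilon> = 0 then D_Th zt zb else snd (p \<epsilon>))" for \<epsilon>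
  have "extends_rep (ext \<epsilon>) (A_Th zt zb) (B_lam zt zb \<epsilon> (\<delta>h \<epsilon>))" if "\<epsilon> \<in> {\<epsilon>0<..0}" for \<epsilon>
    using p[of \<epsilon>] that extends_rep_Schwartz[OF tb] by (cases "\<epsilon> = 0") (auto simp: \<delta>h_def ext_def)
  moreover have "F_eq (gact (ext 0)) (gact (True, D_Th zt zb))"
    unfolding F_eq_def proj_eq_def ext_def by (auto intro!: exI[of _ 1])
  moreover have "anosov \<theta> (A_Th zt zb) (B_lam zt zb \<epsilon> (\<delta>h \<epsilon>))"
    if e: "\<epsilon> \<in> {\<epsilon>0<..<0}" and th: "\<theta> \<in> {0<..<pi/3}" for \<epsilon> \<theta>
  proof -
    have s: "sinh \<epsilon> < 0" using e by simp
    have d: "\<bar>\<delta>h \<epsilon>\<bar> \<le> \<bar>sinh \<epsilon>\<bar> / 2" using p[of \<epsilon>] e by (simp add: \<delta>h_def)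
    interpret nested_box zt zb \<epsilon> "\<delta>h \<epsilon>"
      by unfold_locales (use tb s shift_nested[OF s d] in auto)
    show ?thesis using anosov_lam th by simp
  qed
  ultimately show ?thesis using e0 by blast
qed

end
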